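(* Let $m\in\{0,1\}$ and let $\mathcal S$ be a set of triples $(b,T,S_h(T))$ such that Assumptions A1 and A2 (given in the context) hold. Then there are constants $C$ (independent of $v$, $h$, $\tau$ and the position of $\Omega$ relative to the mesh) such that $$\|v\|_{s_{h,m}}\le C\tau^{1/2}\|\nabla^m v\|_{\Omega_h}\qquad\text{for all }v\in V_h,$$ and $$\|\pi_hv\|_{s_{h,m}}\le C\tau^{1/2}h^{k+1-m}\|v\|_{H^{k+1}(\Omega)}\qquad\text{for all }v\in H^{k+1}(\Omega).$$
   Context: Mesh and spaces. $\mathcal T_{h,0}$, $h\in(0,h_0]$, is a family of quasiuniform (in particular shape regular) meshes of closed simplices with mesh parameter $h$ on a closed polygonal domain $\Omega_0\subset\mathbb R^d$, and $V_{h,0}=\{v\in C^0(\Omega_0): v|_T\in\mathbb P_k(T)\ \forall T\in\mathcal T_{h,0}\}$, where $\mathbb P_k$ denotes polynomials of degree at most $k$, $k\ge1$. $\Omega\subset\Omega_0$ is a given closed domain, $\mathcal T_h=\{T\in\mathcal T_{h,0}:T\cap\Omega\ne\emptyset\}$, $\Omega_h=\bigcup_{T\in\mathcal T_h}T$, and $V_h=V_{h,0}|_{\Omega_h}$. $\|\cdot\|_X$ is the $L^2(X)$ norm; $\nabla^0v=v$, $\nabla^1v=\nabla v$. $\{\varphi_i\}_{i\in I}$ is the standard (nodal) finite element basis of $V_h$, and for $T\subset\mathrm{supp}(\varphi_i)$, $\varphi_{i,T}^*$ are the element degrees of freedom (dual to the element basis, $\varphi^*_{j,T}(\varphi_i|_T)=\delta_{ij}$);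 by conformity the value on $V_h$ does not depend on $T$, and one writes $\varphi_i^*$. Large and small elements. For a fixed $\gamma\in(0,1]$, $\mathcal T_h^L=\{T\in\mathcal T_h:|T\cap\Omega|\ge\gamma|T|\}$ and $\mathcal T_h^S=\mathcal T_h\setminus\mathcal T_h^L$. $S_h:\mathcal T_h^S\to\mathcal T_h^L$ is a given map. Stabilization. For a polynomial $p$ on an element, $p^e\in\mathbb P_k(\mathbb R^d)$ is its canonical extension. For $T_1,T_2\in\mathcal T_h$ and $v\in V_h$, $[v]_{T_1,T_2}=(v|_{T_1})^e-(v|_{T_2})^e$. $\mathcal S$ is a set of triples $(b,T,S_h(T))$ with $T\in\mathcal T_h^S$ and $b$ a symmetric positive semidefinite bilinear form on $\mathbb P_k(\mathbb R^d)$; $\|p\|_b=b(p,p)^{1/2}$. With a parameter $\tau>0$ and a real exponent $\alpha_m$, $$s_{h,m}(v,w)=\sum_{(b,T,S_h(T))\in\mathcal S}\tau h^{\alpha_m}b([v]_{T,S_h(T)},[w]_{T,S_h(T)}),\qquad \|v\|_{s_{h,m}}^2=s_{h,m}(v,v).$$ The number of triples in $\mathcal S$ associated with each $T\in\mathcal T_h^S$ is uniformly bounded. Assumptions, uniformly over all triples $(b,T,S_h(T))\in\mathcal S$ (and over $h$): A1: there is a constant $C$ with $h^{\alpha_m}\|p\|_b^2\le C\|\nabla^m p\|_T^2$ for all $p\in\mathbb P_k(\mathbb R^d)$. A2: there is a path $\mathcal P_h(T,S_h(T))=\{T_j\in\mathcal T_h:j=1,\dots,n\}$ of face-neighboring elements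 (consecutive elements share a face) with $T_1=T$, $T_n=S_h(T)$ and uniformly bounded length $n$. Interpolation. $E:H^s(\Omega)\ni v\mapsto v^E\in H^s(\mathbb R^d)$ is a universal (Stein) extension operator, $\|v^E\|_{H^s(\mathbb R^d)}\le C\|v\|_{H^s(\Omega)}$, $s\ge0$ ($\Omega$ is assumed regular enough for it to exist). $P_T:L^2(T)\to\mathbb P_k(T)$ is the $L^2$ projection. The Clément operator is $\pi_{h,Cl}w=\sum_{i\in I}\varphi_i^*(P_{T_i}w|_{T_i})\varphi_i$, $w\in L^2(\Omega_h)$, where $T_i\in\mathcal T_h$ is a chosen element in the support of $\varphi_i$, and $\pi_hv=\pi_{h,Cl}(v^E)$ for $v\in L^2(\Omega)$. *)

theory Defs
  imports "HOL-Analysis.Analysis"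
begin

section \<open>Polynomials\<close>

definition multi_indices :: "nat \<Rightarrow> ('a::euclidean_space \<Rightarrow> nat) set" where
  "multi_indices k = {a. (\<forall>b. b \<notin> Basis \<longrightarrow> a b = 0) \<and> (\<Sum>b\<in>Basis. a b) \<le> k}"

definition polys :: "nat \<Rightarrow> ('a::euclidean_space \<Rightarrow> real) set" where
  "polys k = {p. \<exists>c. p = (\<lambda>x. \<Sum>a\<in>multi_indices k. c a * (\<Prod>b\<in>Basis. (x \<bullet> b) ^ a b))}"

definition poly_ext :: "nat \<Rightarrow> 'a::euclidean_space set \<Rightarrow> ('a \<Rightarrow> real) \<Rightarrow> ('a \<Rightarrow> real)" where
  "poly_ext k T v = (THE p. p \<in> polys k \<and> (\<forall>x\<in>T. p x = v x))"


section \<open>Square-integrable functions, gradients and Sobolev spaces\<close>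

definition L2 :: "'a::euclidean_space set \<Rightarrow> ('a \<Rightarrow> real) set" where
  "L2 X = {f. set_borel_measurable lebesgue X f \<and> set_integrable lebesgue X (\<lambda>x. (f x)\<^sup>2)}"

definition L2_norm :: "'a::euclidean_space set \<Rightarrow> ('a \<Rightarrow> 'b::real_normed_vector) \<Rightarrow> real" where
  "L2_norm X f = sqrt (LINT x:X|lebesgue. (norm (f x))\<^sup>2)"

text \<open>The classical gradient. Finite element functions are polynomial on each element, so
  for them it exists off the (negligible) element boundaries and agrees there with the weak gradient.\<close>

definition grad :: "('a::euclidean_space \<Rightarrow> real) \<Rightarrow> 'a \<Rightarrow> 'a" where
  "grad f x = (\<Sum>b\<in>Basis. frechet_derivative f (at x) b *\<^sub>R b)"

definition nabla_norm :: "nat \<Rightarrow> 'a::euclidean_space set \<Rightarrow> ('a \<Rightarrow> real) \<Rightarrow> real" where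
  "nabla_norm m X v = (if m = 0 then L2_norm X v else L2_norm X (grad v))"

fun partials :: "'a::euclidean_space list \<Rightarrow> ('a \<Rightarrow> real) \<Rightarrow> ('a \<Rightarrow> real)" where
  "partials [] f = f"
| "partials (b # bs) f = (\<lambda>x. frechet_derivative (partials bs f) (at x) b)"

definition test_functions :: "'a::euclidean_space set \<Rightarrow> ('a \<Rightarrow> real) set" where
  "test_functions U = {f.
     (\<forall>bs. set bs \<subseteq> Basis \<longrightarrow> (\<forall>x. partials bs f differentiable (at x))) \<and>
     compact (closure {x. f x \<noteq> 0}) \<and> closure {x. f x \<noteq> 0} \<subseteq> U}"

definition is_weak_deriv ::
    "'a::euclidean_space set \<Rightarrow> 'a list \<Rightarrow> ('a \<Rightarrow> real) \<Rightarrow> ('a \<Rightarrow> real) \<Rightarrow> bool" where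
  "is_weak_deriv U bs v g \<longleftrightarrow> g \<in> L2 U \<and>
     (\<forall>\<phi>\<in>test_functions U.
        (LINT x:U|lebesgue. v x * partials bs \<phi> x)
        = (-1) ^ length bs * (LINT x:U|lebesgue. g x * \<phi> x))"

definition weak_deriv ::
    "'a::euclidean_space set \<Rightarrow> 'a list \<Rightarrow> ('a \<Rightarrow> real) \<Rightarrow> ('a \<Rightarrow> real)" where
  "weak_deriv U bs v = (SOME g. is_weak_deriv U bs v g)"

text \<open>Derivatives of order \<open>j\<close> are indexed by lists of \<open>j\<close> coordinate directions rather than by
  multi-indices; the squared norm below is the sum of the squared \<open>L2\<close> norms of the full derivative
  tensors of order at most \<open>s\<close> (Frobenius norm).  Elements are functions
  representing their almost-everywhere class on the open set \<open>U\<close>.\<close>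

definition derivs :: "nat \<Rightarrow> 'a::euclidean_space list set" where
  "derivs s = {bs. set bs \<subseteq> Basis \<and> length bs \<le> s}"

definition sobolev :: "nat \<Rightarrow> 'a::euclidean_space set \<Rightarrow> ('a \<Rightarrow> real) set" where
  "sobolev s U = {v \<in> L2 U. \<forall>bs\<in>derivs s. \<exists>g. is_weak_deriv U bs v g}"

definition sobolev_norm :: "nat \<Rightarrow> 'a::euclidean_space set \<Rightarrow> ('a \<Rightarrow> real) \<Rightarrow> real" where
  "sobolev_norm s U v = sqrt (\<Sum>bs\<in>derivs s. (L2_norm U (weak_deriv U bs v))\<^sup>2)"

definition closed_domain :: "'a::euclidean_space set \<Rightarrow> bool" where
  "closed_domain D \<longleftrightarrow> D \<noteq> {} \<and> connected (interior D) \<and> closure (interior D) = D"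

text \<open>Function spaces on a closed domain live on its interior; the extension operator is linear
  on almost-everywhere classes, and its norm on \<open>H^s\<close> is at most \<open>CE s\<close>.\<close>

definition extension_operator ::
    "(nat \<Rightarrow> real) \<Rightarrow> 'a::euclidean_space set \<Rightarrow> (('a \<Rightarrow> real) \<Rightarrow> ('a \<Rightarrow> real)) \<Rightarrow> bool" where
  "extension_operator CE D E \<longleftrightarrow>
     (\<forall>v\<in>L2 (interior D). AE x in lebesgue. x \<in> interior D \<longrightarrow> E v x = v x) \<and>
     (\<forall>v\<in>L2 (interior D). \<forall>w\<in>L2 (interior D). \<forall>a b.
        AE x in lebesgue. E (\<lambda>y. a * v y + b * w y) x = a * E v x + b * E w x) \<and>
     (\<forall>s. \<forall>v\<in>sobolev s (interior D). E v \<in> sobolev s UNIV \<and>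
        sobolev_norm s UNIV (E v) \<le> CE s * sobolev_norm s (interior D) v)"


section \<open>Meshes\<close>

text \<open>A conforming mesh of the closed polygonal domain \<open>D\<close>: shape regularity with
  constant \<open>\<sigma>\<close> (inscribed ball versus diameter) and quasiuniformity with constant \<open>\<kappa>\<close>
  (all diameters comparable to the mesh parameter \<open>h\<close>).\<close>

definition quasiuniform_mesh ::
    "real \<Rightarrow> real \<Rightarrow> real \<Rightarrow> 'a::euclidean_space set \<Rightarrow> 'a set set \<Rightarrow> bool" where
  "quasiuniform_mesh \<sigma> \<kappa> h D \<T> \<longleftrightarrow>
     triangulation \<T> \<and> (\<forall>T\<in>\<T>. int DIM('a) simplex T) \<and>
     closed_domain D \<and> \<Union>\<T> = D \<and>
     (\<forall>T\<in>\<T>. \<exists>x. cball x (\<sigma> * diameter T) \<subseteq> T) \<and>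
     (\<forall>T\<in>\<T>. h \<le> \<kappa> * diameter T \<and> diameter T \<le> \<kappa> * h)"

definition active_mesh :: "'a::euclidean_space set set \<Rightarrow> 'a set \<Rightarrow> 'a set set" where
  "active_mesh \<T>0 D = {T \<in> \<T>0. T \<inter> D \<noteq> {}}"

definition large_elements :: "real \<Rightarrow> 'a::euclidean_space set set \<Rightarrow> 'a set \<Rightarrow> 'a set set" where
  "large_elements \<gamma> \<T> D = {T \<in> \<T>. measure lebesgue (T \<inter> D) \<ge> \<gamma> * measure lebesgue T}"

definition small_elements :: "real \<Rightarrow> 'a::euclidean_space set set \<Rightarrow> 'a set \<Rightarrow> 'a set set" where
  "small_elements \<gamma> \<T> D = \<T> - large_elements \<gamma> \<T> D"


section \<open>Finite element spaces and the Lagrange basis\<close>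

definition fe_space :: "nat \<Rightarrow> 'a::euclidean_space set set \<Rightarrow> ('a \<Rightarrow> real) set" where
  "fe_space k \<T> = {v. continuous_on (\<Union>\<T>) v \<and> (\<forall>T\<in>\<T>. \<exists>p\<in>polys k. \<forall>x\<in>T. v x = p x)}"

text \<open>The restriction to \<open>\<Union>\<T>\<close> of the space on the background mesh \<open>\<T>0\<close>; values off \<open>\<Union>\<T>\<close> are
  \<open>undefined\<close>, so that functions on \<open>\<Union>\<T>\<close> are represented uniquely.\<close>

definition active_space ::
    "nat \<Rightarrow> 'a::euclidean_space set set \<Rightarrow> 'a set set \<Rightarrow> ('a \<Rightarrow> real) set" where
  "active_space k \<T>0 \<T> = (\<lambda>v. restrict v (\<Union>\<T>)) ` fe_space k \<T>0"

text \<open>The principal lattice of order \<open>k\<close> of a simplex, that is the points with barycentric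
  coordinates in \<open>{0, 1/k, \<dots>, 1}\<close>.\<close>

definition element_nodes :: "nat \<Rightarrow> 'a::euclidean_space set \<Rightarrow> 'a set" where
  "element_nodes k T =
     {\<Sum>a | a extreme_point_of T. (real (n a) / real k) *\<^sub>R a | n :: 'a \<Rightarrow> nat.
        (\<Sum>a | a extreme_point_of T. n a) = k}"

definition nodes :: "nat \<Rightarrow> 'a::euclidean_space set set \<Rightarrow> 'a set" where
  "nodes k \<T> = (\<Union>T\<in>\<T>. element_nodes k T)"

text \<open>The basis is indexed by the nodes, and the degree of freedom belonging to the node \<open>i\<close> is
  evaluation at \<open>i\<close>.\<close>

definition dof :: "'a \<Rightarrow> ('a \<Rightarrow> real) \<Rightarrow> real" where
  "dof i p = p i"

definition nodal_basis ::
    "nat \<Rightarrow> 'a::euclidean_space set set \<Rightarrow> 'a set set \<Rightarrow> 'a \<Rightarrow> ('a \<Rightarrow> real)" where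
  "nodal_basis k \<T>0 \<T> i =
     (THE \<phi>. \<phi> \<in> active_space k \<T>0 \<T> \<and> (\<forall>j\<in>nodes k \<T>. dof j \<phi> = (if j = i then 1 else 0)))"

definition basis_support ::
    "nat \<Rightarrow> 'a::euclidean_space set set \<Rightarrow> 'a set set \<Rightarrow> 'a \<Rightarrow> 'a set" where
  "basis_support k \<T>0 \<T> i = closure {x \<in> \<Union>\<T>. nodal_basis k \<T>0 \<T> i x \<noteq> 0}"


section \<open>Interpolation\<close>

definition L2_proj :: "nat \<Rightarrow> 'a::euclidean_space set \<Rightarrow> ('a \<Rightarrow> real) \<Rightarrow> ('a \<Rightarrow> real)" where
  "L2_proj k T w = (THE p. p \<in> polys k \<and> (\<forall>q\<in>polys k. (LINT x:T|lebesgue. (w x - p x) * q x) = 0))"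

text \<open>\<open>Tc i\<close> is the element chosen for the node \<open>i\<close>.\<close>

definition clement_choice ::
    "nat \<Rightarrow> 'a::euclidean_space set set \<Rightarrow> 'a set set \<Rightarrow> ('a \<Rightarrow> 'a set) \<Rightarrow> bool" where
  "clement_choice k \<T>0 \<T> Tc \<longleftrightarrow>
     (\<forall>i\<in>nodes k \<T>. Tc i \<in> \<T> \<and> Tc i \<subseteq> basis_support k \<T>0 \<T> i)"

definition clement ::
    "nat \<Rightarrow> 'a::euclidean_space set set \<Rightarrow> 'a set set \<Rightarrow> ('a \<Rightarrow> 'a set) \<Rightarrow> ('a \<Rightarrow> real) \<Rightarrow> ('a \<Rightarrow> real)" where
  "clement k \<T>0 \<T> Tc w =
     restrict (\<lambda>x. \<Sum>i\<in>nodes k \<T>. dof i (L2_proj k (Tc i) w) * nodal_basis k \<T>0 \<T> i x) (\<Union>\<T>)"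


section \<open>Stabilization\<close>

type_synonym 'a form = "('a \<Rightarrow> real) \<Rightarrow> ('a \<Rightarrow> real) \<Rightarrow> real"

definition psd_form :: "nat \<Rightarrow> 'a::euclidean_space form \<Rightarrow> bool" where
  "psd_form k b \<longleftrightarrow>
     (\<forall>p\<in>polys k. \<forall>q\<in>polys k. b p q = b q p) \<and>
     (\<forall>p\<in>polys k. \<forall>q\<in>polys k. \<forall>r\<in>polys k. \<forall>c. b (\<lambda>x. c * p x + q x) r = c * b p r + b q r) \<and>
     (\<forall>p\<in>polys k. b p p \<ge> 0)"

definition form_norm :: "'a form \<Rightarrow> ('a \<Rightarrow> real) \<Rightarrow> real" where
  "form_norm b p = sqrt (b p p)"

text \<open>\<open>M\<close> bounds the number of triples associated with each small element.\<close>

definition stab_triples ::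
    "nat \<Rightarrow> nat \<Rightarrow> 'a::euclidean_space set set \<Rightarrow> ('a set \<Rightarrow> 'a set)
      \<Rightarrow> ('a form \<times> 'a set \<times> 'a set) set \<Rightarrow> bool" where
  "stab_triples M k small Sh \<S> \<longleftrightarrow>
     (\<forall>(b, T, T')\<in>\<S>. psd_form k b \<and> T \<in> small \<and> T' = Sh T) \<and>
     (\<forall>T\<in>small. finite {b. (b, T, Sh T) \<in> \<S>} \<and> card {b. (b, T, Sh T) \<in> \<S>} \<le> M)"

definition jump :: "nat \<Rightarrow> ('a::euclidean_space \<Rightarrow> real) \<Rightarrow> 'a set \<Rightarrow> 'a set \<Rightarrow> ('a \<Rightarrow> real)" where
  "jump k v T1 T2 = (\<lambda>x. poly_ext k T1 v x - poly_ext k T2 v x)"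

definition stab ::
    "nat \<Rightarrow> real \<Rightarrow> real \<Rightarrow> real \<Rightarrow> ('a::euclidean_space form \<times> 'a set \<times> 'a set) set \<Rightarrow> 'a form" where
  "stab k \<tau> h \<alpha> \<S> v w =
     (\<Sum>(b, T, T')\<in>\<S>. \<tau> * h powr \<alpha> * b (jump k v T T') (jump k w T T'))"

definition stab_norm ::
    "nat \<Rightarrow> real \<Rightarrow> real \<Rightarrow> real \<Rightarrow> ('a::euclidean_space form \<times> 'a set \<times> 'a set) set
      \<Rightarrow> ('a \<Rightarrow> real) \<Rightarrow> real" where
  "stab_norm k \<tau> h \<alpha> \<S> v = sqrt (stab k \<tau> h \<alpha> \<S> v v)"

definition assumption_A1 ::
    "real \<Rightarrow> nat \<Rightarrow> nat \<Rightarrow> real \<Rightarrow> real \<Rightarrow> ('a::euclidean_space form \<times> 'a set \<times> 'a set) set \<Rightarrow> bool" where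
  "assumption_A1 C m k h \<alpha> \<S> \<longleftrightarrow>
     (\<forall>(b, T, T')\<in>\<S>. \<forall>p\<in>polys k. h powr \<alpha> * (form_norm b p)\<^sup>2 \<le> C * (nabla_norm m T p)\<^sup>2)"

definition face_neighbors :: "'a::euclidean_space set \<Rightarrow> 'a set \<Rightarrow> bool" where
  "face_neighbors T T' \<longleftrightarrow> (T \<inter> T') facet_of T \<and> (T \<inter> T') facet_of T'"

definition assumption_A2 ::
    "nat \<Rightarrow> 'a::euclidean_space set set \<Rightarrow> ('a form \<times> 'a set \<times> 'a set) set \<Rightarrow> bool" where
  "assumption_A2 N \<T> \<S> \<longleftrightarrow>
     (\<forall>(b, T, T')\<in>\<S>. \<exists>P. P \<noteq> [] \<and> set P \<subseteq> \<T> \<and> hd P = T \<and> last P = T' \<and> length P \<le> N \<and>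
        successively face_neighbors P)"

end

theory Submission
  imports Defs
begin

text \<open>
  Write the jump on a small element \<open>T\<close> as a difference of two polynomials.  By norm equivalence on
  \<open>polys k\<close>, scaled to balls of radius comparable to \<open>h\<close>, the norm on \<open>T\<close> of the polynomial living on
  \<open>Sh T\<close> is controlled by its norm on \<open>Sh T\<close>, because the path of A2 keeps the two elements within
  distance \<open>N \<kappa> h\<close>.  Comparing volumes of inscribed balls bounds the overlap of the patches around
  the elements, so that summation gives the first estimate.

  The interpolation operator reproduces polynomials, so its jump does not change if a polynomial \<open>p\<close>
  is subtracted from \<open>w = E v\<close>; local stability and the inverse estimate then bound the jump
  by \<open>w - p\<close> in \<open>L2\<close> of a patch of radius \<open>R h\<close>, and \<open>p\<close> is the \<open>L2\<close> projection of \<open>w\<close> on that patch.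
  For the Bramble--Hilbert estimate, Taylor's formula for a mollifier \<open>\<phi>\<close> is multiplied by \<open>w\<close> and
  integrated; the definition of weak derivatives turns the remainder into mollified weak derivatives
  of order \<open>k + 1\<close>, so nothing has to be differentiated under the integral sign.  The remainder is
  averaged over the base point of the expansion, and finally the mollification parameter tends to 0.
\<close>

section \<open>Polynomials\<close>

text \<open>The constant has to be fixed before \<open>h\<close> and the mesh are known. So elements
  are only compared through balls about the centre of an inscribed ball, with radii
  \<open>\<sigma> / \<kappa> * h\<close> and \<open>R * h\<close>: the ratio does not see the mesh,
  and scaling to \<open>h = 1\<close> leaves one finite-dimensional inequality. The value
  \<open>R = (N + 3) * \<kappa>\<close> counts element diameters from the centre of
  \<open>T\<close>: \<open>N + 1\<close> reach every point of \<open>T\<close> and of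
  \<open>Sh T\<close>, one more covers an element chosen for a node there, and the last gives room
  for an open ball. A Taylor expansion of a Sobolev function about one point cannot be controlled in
  L2, since the derivatives may concentrate at that point; this is what forces the average over base
  points, and segments between two points of a ball stay in it by convexity. The Taylor polynomial
  changes with the base point and with the mollifier. Therefore the quantity that is estimated is
  the distance to all of \<open>polys k\<close>, which the L2 projection attains and which depends
  on neither. The patches may leave \<open>\<Omega>\<close> and the mesh; the interpolated function
  is available there because \<open>E v\<close> lives on the whole space.\<close>

definition monomial :: "('a::euclidean_space \<Rightarrow> nat) \<Rightarrow> 'a \<Rightarrow> real" where
  "monomial a x = (\<Prod>b\<in>Basis. (x \<bullet> b) ^ a b)"

lemma polys_altdef: "polys k = {p. \<exists>c. p = (\<lambda>x. \<Sum>a\<in>multi_indices k. c a * monomial a x)}"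
  unfolding polys_def monomial_def ..

lemma finite_multi_indices: "finite (multi_indices k :: ('a::euclidean_space \<Rightarrow> nat) set)"
proof (rule finite_subset)
  show "finite {f :: 'a \<Rightarrow> nat. f ` Basis \<subseteq> {..k} \<and> {b. f b \<noteq> 0} \<subseteq> Basis}"
    using finite_set_of_finite_funs[of Basis "{..k}" "0::nat"]
    by (rule rev_finite_subset) auto
  show "multi_indices k \<subseteq> {f :: 'a \<Rightarrow> nat. f ` Basis \<subseteq> {..k} \<and> {b. f b \<noteq> 0} \<subseteq> Basis}"
  proof
    fix f :: "'a \<Rightarrow> nat" assume f: "f \<in> multi_indices k"
    have "f b \<le> k" if "b \<in> Basis" for b
      using f that member_le_sum[of b Basis f] by (fastforce simp: multi_indices_def)
    then show "f \<in> {f. f ` Basis \<subseteq> {..k} \<and> {b. f b \<noteq> 0} \<subseteq> Basis}"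
      using f by (auto simp: multi_indices_def)
  qed
qed

lemma multi_indices_mono: "k \<le> l \<Longrightarrow> multi_indices k \<subseteq> multi_indices l"
  by (auto simp: multi_indices_def)

lemma polys_add: "p \<in> polys k \<Longrightarrow> q \<in> polys k \<Longrightarrow> (\<lambda>x. p x + q x) \<in> polys k"
proof -
  assume "p \<in> polys k" "q \<in> polys k"
  then obtain c d where "p = (\<lambda>x. \<Sum>a\<in>multi_indices k. c a * monomial a x)"
      "q = (\<lambda>x. \<Sum>a\<in>multi_indices k. d a * monomial a x)"
    by (auto simp: polys_altdef)
  then have "(\<lambda>x. p x + q x) = (\<lambda>x. \<Sum>a\<in>multi_indices k. (c a + d a) * monomial a x)"
    by (simp add: algebra_simps sum.distrib)
  then show ?thesis by (auto simp: polys_altdef)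
qed

lemma polys_cmult: "p \<in> polys k \<Longrightarrow> (\<lambda>x. r * p x) \<in> polys k"
proof -
  assume "p \<in> polys k"
  then obtain c where "p = (\<lambda>x. \<Sum>a\<in>multi_indices k. c a * monomial a x)"
    by (auto simp: polys_altdef)
  then have "(\<lambda>x. r * p x) = (\<lambda>x. \<Sum>a\<in>multi_indices k. (r * c a) * monomial a x)"
    by (simp add: sum_distrib_left mult.assoc)
  then show ?thesis by (auto simp: polys_altdef)
qed

lemma polys_diff: "p \<in> polys k \<Longrightarrow> q \<in> polys k \<Longrightarrow> (\<lambda>x. p x - q x) \<in> polys k"
  using polys_add[of p k "\<lambda>x. (-1) * q x"] polys_cmult[of q k "-1"] by simp

lemma monomial_in_polys:
  assumes "a \<in> multi_indices k" shows "monomial a \<in> polys k"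
proof -
  have "monomial a = (\<lambda>x. \<Sum>a'\<in>multi_indices k. (if a' = a then 1 else 0) * monomial a' x)"
    using assms by (intro ext) (simp add: finite_multi_indices mult_if_delta)
  then show ?thesis by (auto simp: polys_altdef)
qed

lemma monomial_0 [simp]: "monomial (\<lambda>_. 0) x = 1"
  by (simp add: monomial_def)

lemma polys_const [simp, intro]: "(\<lambda>x::'a::euclidean_space. c) \<in> polys k"
proof -
  have "monomial (\<lambda>_::'a. 0) \<in> polys k"
    by (rule monomial_in_polys) (simp add: multi_indices_def)
  from polys_cmult[OF this, of c] show ?thesis by simp
qed

lemma polys_sum: "(\<And>i. i \<in> I \<Longrightarrow> p i \<in> polys k) \<Longrightarrow> (\<lambda>x. \<Sum>i\<in>I. p i x) \<in> polys k"
  by (induction I rule: infinite_finite_induct) (auto intro: polys_add)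

lemma polys_le: assumes "p \<in> polys k" "k \<le> l" shows "p \<in> polys l"
proof -
  obtain c where "p = (\<lambda>x. \<Sum>a\<in>multi_indices k. c a * monomial a x)"
    using assms by (auto simp: polys_altdef)
  moreover have "(\<lambda>x. \<Sum>a\<in>multi_indices k. c a * monomial a x) \<in> polys l"
    using multi_indices_mono[OF assms(2)]
    by (intro polys_sum polys_cmult monomial_in_polys) auto
  ultimately show ?thesis by simp
qed

lemma monomial_Suc:
  assumes "b \<in> Basis"
  shows "monomial (a(b := Suc (a b))) x = (x \<bullet> b) * monomial a x"
  using assms by (simp add: monomial_def prod.remove[of Basis b])

lemma polys_coord_mult:
  assumes "p \<in> polys k" "b \<in> Basis" shows "(\<lambda>x. (x \<bullet> b) * p x) \<in> polys (Suc k)"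
proof -
  obtain c where p: "p = (\<lambda>x. \<Sum>a\<in>multi_indices k. c a * monomial a x)"
    using assms by (auto simp: polys_altdef)
  have "(\<lambda>x. (x \<bullet> b) * p x) = (\<lambda>x. \<Sum>a\<in>multi_indices k. c a * monomial (a(b := Suc (a b))) x)"
    using assms by (simp add: p monomial_Suc sum_distrib_left algebra_simps)
  moreover have "a(b := Suc (a b)) \<in> multi_indices (Suc k)" if "a \<in> multi_indices k" for a
    using that assms by (auto simp: multi_indices_def sum.remove[of Basis b])
  ultimately show ?thesis
    by (auto intro!: polys_sum polys_cmult monomial_in_polys)
qed

lemma monomial_induct:
  assumes "a \<in> multi_indices k"
    and const: "\<And>k c. P k (\<lambda>_. c)"
    and step: "\<And>k b p. b \<in> Basis \<Longrightarrow> p \<in> polys k \<Longrightarrow> P k p \<Longrightarrow> P (Suc k) (\<lambda>x. (x \<bullet> b) * p x)"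
  shows "P k (monomial a)"
  using assms(1)
proof (induction k arbitrary: a)
  case 0
  then have "a b = 0" for b by (cases "b \<in> Basis") (auto simp: multi_indices_def)
  then have "a = (\<lambda>_. 0)" by auto
  then show ?case using const[of 0 1] by (simp add: monomial_def)
next
  case (Suc k)
  show ?case
  proof (cases "\<exists>b\<in>Basis. a b \<noteq> 0")
    case False
    then have "a b = 0" for b using Suc.prems by (cases "b \<in> Basis") (auto simp: multi_indices_def)
    then have "a = (\<lambda>_. 0)" by auto
    then show ?thesis using const[of "Suc k" 1] by (simp add: monomial_def)
  next
    case True
    then obtain b where b: "b \<in> Basis" "a b \<noteq> 0" by blast
    define a' where "a' = a(b := a b - 1)"
    have a: "a = a'(b := Suc (a' b))" using b by (auto simp: a'_def)
    have "a' \<in> multi_indices k"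
      using Suc.prems b by (auto simp: multi_indices_def a'_def sum.remove[of Basis b])
    from step[OF b(1) monomial_in_polys[OF this] Suc.IH[OF this]] show ?thesis
      using b(1) by (simp add: monomial_Suc[symmetric] fun_eq_iff a[symmetric])
  qed
qed

text \<open>The degree bound is an argument of \<open>P\<close>, so statements about degrees, such
  as \<open>polys_mult\<close> and \<open>polys_difference\<close>, go through the same induction as
  statements about functions. Later proofs thus avoid coefficient families.\<close>

lemma polys_induct [consumes 1, case_names const mult add]:
  assumes "p \<in> polys k"
    and const: "\<And>k c. P k (\<lambda>_. c)"
    and mult: "\<And>k b p. b \<in> Basis \<Longrightarrow> p \<in> polys k \<Longrightarrow> P k p \<Longrightarrow> P (Suc k) (\<lambda>x. (x \<bullet> b) * p x)"
    and add: "\<And>k r p q. p \<in> polys k \<Longrightarrow> q \<in> polys k \<Longrightarrow> P k p \<Longrightarrow> P k q \<Longrightarrow> P k (\<lambda>x. r * p x + q x)"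
  shows "P k p"
proof -
  obtain c where p: "p = (\<lambda>x. \<Sum>a\<in>multi_indices k. c a * monomial a x)"
    using assms by (auto simp: polys_altdef)
  have "P k (\<lambda>x. \<Sum>a\<in>A. c a * monomial a x)" if "finite A" "A \<subseteq> multi_indices k" for A
    using that
  proof (induction A)
    case empty
    show ?case using const[of k 0] by simp
  next
    case (insert a A)
    have a: "a \<in> multi_indices k" using insert by auto
    have "(\<lambda>x. \<Sum>a\<in>A. c a * monomial a x) \<in> polys k"
      using insert by (intro polys_sum polys_cmult monomial_in_polys) auto
    moreover have "P k (monomial a)"
      by (rule monomial_induct[where P = P, OF a]) (fact const, rule mult)
    moreover have "P k (\<lambda>x. \<Sum>a\<in>A. c a * monomial a x)"
      using insert by simp
    ultimately have "P k (\<lambda>x. c a * monomial a x + (\<Sum>a\<in>A. c a * monomial a x))"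
      by (intro add monomial_in_polys[OF a])
    then show ?case using insert by simp
  qed
  from this[OF finite_multi_indices order_refl] show ?thesis by (simp add: p)
qed

lemma polys_linear: "(\<lambda>x. x \<bullet> v + c) \<in> polys (Suc k)"
proof -
  have "(\<lambda>x. (\<Sum>b\<in>Basis. (v \<bullet> b) * ((x \<bullet> b) * 1)) + c) \<in> polys (Suc k)"
    by (intro polys_add polys_sum polys_cmult polys_coord_mult polys_const) auto
  moreover have "(\<lambda>x. (\<Sum>b\<in>Basis. (v \<bullet> b) * ((x \<bullet> b) * 1)) + c) = (\<lambda>x. x \<bullet> v + c)"
    by (subst euclidean_inner) (simp add: mult.commute fun_eq_iff)
  ultimately show ?thesis by simp
qed

lemma polys_mult:
  assumes "p \<in> polys k" "q \<in> polys l" shows "(\<lambda>x. p x * q x) \<in> polys (k + l)"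
  using assms(1)
proof (induction rule: polys_induct)
  case (const k c)
  show ?case using polys_le[OF polys_cmult[OF assms(2), of c], of "k + l"] by simp
next
  case (mult k b p)
  from polys_coord_mult[OF mult(3) mult(1)] show ?case by (simp add: mult.assoc)
next
  case (add k r p q')
  have "(\<lambda>x. r * (p x * q x) + q' x * q x) \<in> polys (k + l)"
    using add by (intro polys_add polys_cmult) auto
  then show ?case by (simp add: algebra_simps)
qed

lemma polys_affine_mult: "p \<in> polys k \<Longrightarrow> (\<lambda>x. (x \<bullet> v + c) * p x) \<in> polys (Suc k)"
  using polys_mult[OF polys_linear[of v c 0], of p k] by simp

lemma polys_prod_list:
  "(\<lambda>x. prod_list (map (\<lambda>(v, c). x \<bullet> v + c) vs)) \<in> polys (length vs)"
  by (induction vs) (auto intro: polys_affine_mult)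

lemma polys_comp_affine:
  assumes "p \<in> polys k" shows "(\<lambda>x. p (z + r *\<^sub>R x)) \<in> polys k"
  using assms
proof (induction rule: polys_induct)
  case (mult k b p)
  from polys_affine_mult[OF mult(3), of "r *\<^sub>R b" "z \<bullet> b"] show ?case
    by (simp add: inner_add_left add.commute)
qed (auto intro: polys_add polys_cmult)

lemma polys_shift: "p \<in> polys k \<Longrightarrow> (\<lambda>x. p (x + u)) \<in> polys k"
  using polys_comp_affine[of p k u 1] by (simp add: add.commute)

lemma polys_0_const:
  assumes "p \<in> polys 0" obtains c where "p = (\<lambda>_. c)"
proof -
  have "k = 0 \<longrightarrow> (\<exists>c. p = (\<lambda>_. c))" if "p \<in> polys k" for k
    using that by (induction rule: polys_induct) auto
  then show ?thesis using assms that by blast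
qed

lemma polys_difference:
  assumes "p \<in> polys (Suc k)" shows "(\<lambda>x. p (x + u) - p x) \<in> polys k"
proof -
  \<comment> \<open>Membership in \<open>polys (k - 1)\<close> is too weak for \<open>k = 0\<close>,
    where truncated subtraction only yields a constant. In the product step with
    \<open>k = 0\<close> the factor multiplied by a coordinate has to vanish, hence the extra
    conjunct.\<close>
  have "(k = 0 \<longrightarrow> (\<forall>x. p (x + u) - p x = 0)) \<and> (\<lambda>x. p (x + u) - p x) \<in> polys (k - 1)"
    if "p \<in> polys k" for k using that
  proof (induction rule: polys_induct)
    case (mult k b p)
    have eq: "((x + u) \<bullet> b) * p (x + u) - (x \<bullet> b) * p x
        = (x \<bullet> b) * (p (x + u) - p x) + (u \<bullet> b) * p (x + u)" for x
      by (simp add: algebra_simps inner_add_left)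
    have "(\<lambda>x. (x \<bullet> b) * (p (x + u) - p x)) \<in> polys k"
    proof (cases k)
      case 0
      then show ?thesis using mult(3) by simp
    next
      case (Suc j)
      then show ?thesis using mult(3) polys_coord_mult[OF _ mult(1)] by fastforce
    qed
    then show ?case unfolding eq
      using mult by (auto intro!: polys_add polys_cmult polys_shift)
  next
    case (add k r p q)
    have eq: "r * p (x + u) + q (x + u) - (r * p x + q x)
        = r * (p (x + u) - p x) + (q (x + u) - q x)" for x
      by (simp add: algebra_simps)
    show ?case unfolding eq using add by (auto intro: polys_add polys_cmult)
  qed auto
  from this[OF assms] show ?thesis by simp
qed

text \<open>Reduces questions about zeros to one variable, where a nonzero polynomial has only
  finitely many roots.\<close>

lemma polys_along_line:
  assumes "p \<in> polys k" shows "\<exists>q :: real poly. \<forall>t. p (x + t *\<^sub>R u) = poly q t"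
  using assms
proof (induction rule: polys_induct)
  case (const k c) show ?case by (rule exI[of _ "[:c:]"]) simp
next
  case (mult k b p)
  then obtain q where q: "\<forall>t. p (x + t *\<^sub>R u) = poly q t" by blast
  show ?case by (rule exI[of _ "[:x \<bullet> b, u \<bullet> b:] * q"]) (simp add: inner_add_left q algebra_simps)
next
  case (add k r p q)
  then obtain p' q' where "\<forall>t. p (x + t *\<^sub>R u) = poly p' t" "\<forall>t. q (x + t *\<^sub>R u) = poly q' t" by blast
  then show ?case by (intro exI[of _ "smult r p' + q'"]) simp
qed

text \<open>The degree bound of the partial derivatives is left at \<open>k\<close> on purpose: a
  polynomial and its partial derivatives then lie in the same finite-dimensional space, and one norm
  equivalence serves both.\<close>

lemma polys_has_derivative:
  assumes "p \<in> polys k"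
  shows "\<exists>D. (\<forall>b. D b \<in> polys k) \<and> (\<forall>x. (p has_derivative (\<lambda>v. \<Sum>b\<in>Basis. (v \<bullet> b) * D b x)) (at x))"
  using assms
proof (induction rule: polys_induct)
  case (const k c)
  show ?case by (rule exI[of _ "\<lambda>_ _. 0"]) auto
next
  case (mult k b p)
  then obtain D where D: "\<And>b. D b \<in> polys k"
    "\<And>x. (p has_derivative (\<lambda>v. \<Sum>b\<in>Basis. (v \<bullet> b) * D b x)) (at x)" by blast
  define D' where "D' c x = (x \<bullet> b) * D c x + (if c = b then 1 else 0) * p x" for c x
  have "D' c \<in> polys (Suc k)" for c unfolding D'_def
    using D(1) mult by (intro polys_add polys_coord_mult polys_cmult polys_le[of p k "Suc k"]) auto
  moreover have "((\<lambda>x. (x \<bullet> b) * p x) has_derivative (\<lambda>v. \<Sum>c\<in>Basis. (v \<bullet> c) * D' c x)) (at x)" for x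
  proof -
    have eq: "(\<Sum>c\<in>Basis. (v \<bullet> c) * D' c x) = (x \<bullet> b) * (\<Sum>c\<in>Basis. (v \<bullet> c) * D c x) + (v \<bullet> b) * p x" for v
    proof -
      have "(\<Sum>c\<in>Basis. (v \<bullet> c) * ((if c = b then 1 else 0) * p x))
          = (\<Sum>c\<in>Basis. if c = b then (v \<bullet> c) * p x else 0)"
        by (intro sum.cong) auto
      then show ?thesis
        using mult(1) by (simp add: D'_def distrib_left sum.distrib sum_distrib_left mult.left_commute)
    qed
    show ?thesis unfolding eq
      by (rule derivative_eq_intros D(2) refl)+
  qed
  ultimately show ?case by blast
next
  case (add k r p q)
  then obtain D E where D: "\<And>b. D b \<in> polys k"
    "\<And>x. (p has_derivative (\<lambda>v. \<Sum>b\<in>Basis. (v \<bullet> b) * D b x)) (at x)"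
    and E: "\<And>b. E b \<in> polys k"
    "\<And>x. (q has_derivative (\<lambda>v. \<Sum>b\<in>Basis. (v \<bullet> b) * E b x)) (at x)" by blast
  have "((\<lambda>x. r * p x + q x) has_derivative
     (\<lambda>v. \<Sum>b\<in>Basis. (v \<bullet> b) * (r * D b x + E b x))) (at x)" for x
  proof -
    have eq: "(\<Sum>b\<in>Basis. (v \<bullet> b) * (r * D b x + E b x))
        = r * (\<Sum>b\<in>Basis. (v \<bullet> b) * D b x) + (\<Sum>b\<in>Basis. (v \<bullet> b) * E b x)" for v
      by (simp add: algebra_simps sum.distrib sum_distrib_left)
    show ?thesis unfolding eq by (rule derivative_eq_intros D(2) E(2) refl)+
  qed
  then show ?case using D(1) E(1) by (intro exI[of _ "\<lambda>b x. r * D b x + E b x"] conjI allI polys_add polys_cmult)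
qed

lemma polys_continuous: "p \<in> polys k \<Longrightarrow> continuous_on S p"
proof -
  assume "p \<in> polys k"
  then obtain D where D: "\<And>b. D b \<in> polys k"
      "\<And>x. (p has_derivative (\<lambda>v. \<Sum>b\<in>Basis. (v \<bullet> b) * D b x)) (at x)"
    using polys_has_derivative by blast
  show ?thesis
    by (rule continuous_at_imp_continuous_on) (use has_derivative_continuous[OF D(2)] in blast)
qed

lemma polys_borel: "p \<in> polys k \<Longrightarrow> p \<in> borel_measurable borel"
  by (simp add: borel_measurable_continuous_onI polys_continuous)

section \<open>Polynomials determined by their values on lattices and on open sets\<close>

lemma polys_periodic_const:
  fixes u :: "'a::euclidean_space"
  assumes p: "p \<in> polys k" and per: "\<And>n::nat. p (x + real n *\<^sub>R u) = p x"
  shows "p (x + t *\<^sub>R u) = p x"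
proof -
  obtain q where q: "\<And>t. p (x + t *\<^sub>R u) = poly q t"
    using polys_along_line[OF p] by blast
  have "range real \<subseteq> {t. poly (q - [:p x:]) t = 0}"
    using per by (auto simp: q[symmetric])
  moreover have "infinite (range real)"
    by (simp add: finite_image_iff inj_on_def)
  ultimately have "q - [:p x:] = 0"
    using poly_roots_finite finite_subset by blast
  then have "q = [:p x:]" by simp
  then show ?thesis by (simp add: q)
qed

text \<open>The unisolvence of the principal lattice.  The difference \<open>p (x + u) - p x\<close> along a lattice
  direction has smaller degree and vanishes on a smaller lattice; so by induction it vanishes
  altogether, and a periodic polynomial is constant.\<close>

lemma polys_zero_on_lattice:
  fixes U :: "'a::euclidean_space set"
  assumes "finite U" "p \<in> polys k"
    and "\<And>t::'a \<Rightarrow> nat. (\<Sum>u\<in>U. t u) \<le> k \<Longrightarrow> p (x0 + (\<Sum>u\<in>U. real (t u) *\<^sub>R u)) = 0"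
  shows "p (x0 + (\<Sum>u\<in>U. c u *\<^sub>R u)) = 0"
  using assms(2,3)
proof (induction k arbitrary: p c)
  case 0
  obtain d where "p = (\<lambda>_. d)" using polys_0_const[OF 0(1)] .
  then show ?case using 0(2)[of "\<lambda>_. 0"] by simp
next
  case (Suc k)
  note p = Suc.prems(1)
  have shift: "p (x0 + (\<Sum>u\<in>U. c u *\<^sub>R u) + w) = p (x0 + (\<Sum>u\<in>U. c u *\<^sub>R u))" if w: "w \<in> U" for w c
  proof -
    define q where "q = (\<lambda>x. p (x + w) - p x)"
    have "q (x0 + (\<Sum>u\<in>U. c u *\<^sub>R u)) = 0"
    proof (rule Suc.IH)
      show "q \<in> polys k" unfolding q_def by (rule polys_difference[OF p])
      fix t :: "'a \<Rightarrow> nat" assume t: "sum t U \<le> k"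
      let ?t = "t(w := Suc (t w))"
      have 1: "sum ?t U \<le> Suc k" using t w assms(1) by (simp add: sum.remove[of U w])
      have 2: "(\<Sum>u\<in>U. real (?t u) *\<^sub>R u) = (\<Sum>u\<in>U. real (t u) *\<^sub>R u) + w"
        using w assms(1) by (simp add: sum.remove[of U w] algebra_simps)
      show "q (x0 + (\<Sum>u\<in>U. real (t u) *\<^sub>R u)) = 0"
        using Suc.prems(2)[OF 1] Suc.prems(2)[of t] t unfolding 2 q_def by (simp add: add.assoc)
    qed
    then show ?thesis by (simp add: q_def)
  qed
  have upd: "(\<Sum>u\<in>U. (c(w := d)) u *\<^sub>R u) = (\<Sum>u\<in>U. c u *\<^sub>R u) + (d - c w) *\<^sub>R w"
    if "w \<in> U" for w d and c :: "'a \<Rightarrow> real"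
    using that assms(1) by (simp add: sum.remove[of U w] algebra_simps)
  \<comment> \<open>A step along \<open>w\<close> only changes the coefficient of \<open>w\<close>,
    so \<open>shift\<close>, which holds for every \<open>c\<close>, can be iterated; this is the
    periodicity that \<open>polys_periodic_const\<close> asks for.\<close>
  have const: "p (x0 + (\<Sum>u\<in>U. c u *\<^sub>R u) + t *\<^sub>R w) = p (x0 + (\<Sum>u\<in>U. c u *\<^sub>R u))" if w: "w \<in> U" for w c t
  proof (rule polys_periodic_const[OF p])
    fix n
    show "p (x0 + (\<Sum>u\<in>U. c u *\<^sub>R u) + real n *\<^sub>R w) = p (x0 + (\<Sum>u\<in>U. c u *\<^sub>R u))"
    proof (induction n)
      case (Suc n)
      have "p (x0 + (\<Sum>u\<in>U. c u *\<^sub>R u) + real (Suc n) *\<^sub>R w)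
          = p (x0 + (\<Sum>u\<in>U. (c(w := c w + real n)) u *\<^sub>R u) + w)"
        by (subst upd[OF w]) (simp add: algebra_simps)
      also have "\<dots> = p (x0 + (\<Sum>u\<in>U. (c(w := c w + real n)) u *\<^sub>R u))"
        by (rule shift[OF w])
      also have "\<dots> = p (x0 + (\<Sum>u\<in>U. c u *\<^sub>R u) + real n *\<^sub>R w)"
        by (subst upd[OF w]) (simp add: algebra_simps)
      finally show ?case using Suc by simp
    qed simp
  qed
  have "p (x0 + (\<Sum>u\<in>U. c u *\<^sub>R u)) = p x0"
  proof -
    \<comment> \<open>The coefficients are switched on one direction at a time, starting from
      \<open>x0\<close>.\<close>
    have "p (x0 + (\<Sum>u\<in>U. (if u \<in> A then c u else 0) *\<^sub>R u)) = p x0" if "finite A" "A \<subseteq> U" for A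
      using that
    proof (induction A)
      case empty then show ?case by (simp add: sum.neutral)
    next
      case (insert w A)
      let ?c = "\<lambda>u. if u \<in> A then c u else 0"
      have "(\<Sum>u\<in>U. (if u \<in> insert w A then c u else 0) *\<^sub>R u)
          = (\<Sum>u\<in>U. (?c(w := c w)) u *\<^sub>R u)"
        by (intro sum.cong) auto
      also have "\<dots> = (\<Sum>u\<in>U. ?c u *\<^sub>R u) + c w *\<^sub>R w"
        using upd[of w ?c "c w"] insert by simp
      finally have "(\<Sum>u\<in>U. (if u \<in> insert w A then c u else 0) *\<^sub>R u)
          = (\<Sum>u\<in>U. ?c u *\<^sub>R u) + c w *\<^sub>R w" .
      then show ?case
        using const[of w ?c "c w"] insert by (simp add: add.assoc)
    qed
    from this[OF assms(1) order_refl] show ?thesis by (simp cong: sum.cong)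
  qed
  also have "\<dots> = 0" using Suc.prems(2)[of "\<lambda>_. 0"] by simp
  finally show ?case .
qed

lemma polys_zero_on_open:
  fixes p :: "'a::euclidean_space \<Rightarrow> real"
  assumes p: "p \<in> polys k" and "interior S \<noteq> {}" and z: "\<And>x. x \<in> S \<Longrightarrow> p x = 0"
  shows "p = (\<lambda>_. 0)"
proof
  fix y
  obtain x e where x: "e > 0" "cball x e \<subseteq> S"
  proof -
    obtain x where "x \<in> interior S" using assms(2) by blast
    then show ?thesis using that by (auto simp: mem_interior_cball)
  qed
  obtain q where q: "\<And>t. p (x + t *\<^sub>R (y - x)) = poly q t"
    using polys_along_line[OF p] by blast
  \<comment> \<open>Up to parameter \<open>d\<close> the segment from \<open>x\<close> towards
    \<open>y\<close> stays in the ball of radius \<open>e\<close>. Adding 1 to the denominator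
    covers \<open>y = x\<close>.\<close>
  define d where "d = e / (norm (y - x) + 1)"
  have "norm (y - x) + 1 > 0" using norm_ge_zero[of "y - x"] by linarith
  then have d: "d > 0" using x(1) by (simp add: d_def)
  have "poly q t = 0" if "t \<in> {0..d}" for t
  proof -
    have "norm (t *\<^sub>R (y - x)) \<le> d * norm (y - x)" using that by (auto intro: mult_right_mono)
    also have "\<dots> = e * (norm (y - x) / (norm (y - x) + 1))" by (simp add: d_def)
    also have "\<dots> \<le> e * 1"
      using x(1) \<open>norm (y - x) + 1 > 0\<close> by (intro mult_left_mono) (simp_all add: divide_le_eq_1)
    finally show ?thesis unfolding q[symmetric] by (intro z) (use x(2) in \<open>auto simp: dist_norm subset_iff\<close>)
  qed
  then have "{0..d} \<subseteq> {t. poly q t = 0}" by blast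
  moreover have "infinite {0..d}" using d by (simp add: infinite_Icc)
  ultimately have "q = 0" using poly_roots_finite finite_subset by blast
  then show "p y = 0" using q[of 1] by simp
qed

section \<open>Square-integrable functions and projections\<close>

definition sq_int :: "'b measure \<Rightarrow> ('b \<Rightarrow> real) set" where
  "sq_int M = {f \<in> borel_measurable M. integrable M (\<lambda>x. (f x)\<^sup>2)}"

text \<open>A form on functions rather than on classes, so \<open>ip M f f = 0\<close> only means
  that \<open>f\<close> vanishes almost everywhere. The measure is general because projections live
  on \<open>lebesgue_on T\<close>, while \<open>sq_int\<close> also serves convolution integrands
  over \<open>lborel\<close>.\<close>

definition ip :: "'b measure \<Rightarrow> ('b \<Rightarrow> real) \<Rightarrow> ('b \<Rightarrow> real) \<Rightarrow> real" where
  "ip M f g = (LINT x|M. f x * g x)"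

lemma sq_intD: "f \<in> sq_int M \<Longrightarrow> f \<in> borel_measurable M" "f \<in> sq_int M \<Longrightarrow> integrable M (\<lambda>x. (f x)\<^sup>2)"
  by (auto simp: sq_int_def)

lemma sq_int_mult_integrable:
  assumes "f \<in> sq_int M" "g \<in> sq_int M" shows "integrable M (\<lambda>x. f x * g x)"
proof (rule Bochner_Integration.integrable_bound)
  show "integrable M (\<lambda>x. (f x)\<^sup>2 + (g x)\<^sup>2)"
    using assms by (intro Bochner_Integration.integrable_add sq_intD)
  show "(\<lambda>x. f x * g x) \<in> borel_measurable M"
    using assms by (intro borel_measurable_times) (auto dest: sq_intD)
  have le: "\<bar>a * b\<bar> \<le> a\<^sup>2 + b\<^sup>2" for a b :: real
  proof -
    have "2 * (\<bar>a\<bar> * \<bar>b\<bar>) \<le> a\<^sup>2 + b\<^sup>2" using sum_squares_bound[of "\<bar>a\<bar>" "\<bar>b\<bar>"] by (simp add: mult.assoc)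
    moreover have "0 \<le> \<bar>a\<bar> * \<bar>b\<bar>" by simp
    ultimately show ?thesis unfolding abs_mult by linarith
  qed
  show "AE x in M. norm (f x * g x) \<le> norm ((f x)\<^sup>2 + (g x)\<^sup>2)"
  proof (rule AE_I2)
    fix x
    show "norm (f x * g x) \<le> norm ((f x)\<^sup>2 + (g x)\<^sup>2)"
      using le[of "f x" "g x"] unfolding real_norm_def by linarith
  qed
qed

lemma sq_int_cmult: "f \<in> sq_int M \<Longrightarrow> (\<lambda>x. c * f x) \<in> sq_int M"
  by (auto simp: sq_int_def power_mult_distrib)

lemma sq_int_add: assumes "f \<in> sq_int M" "g \<in> sq_int M" shows "(\<lambda>x. f x + g x) \<in> sq_int M"
proof -
  have "integrable M (\<lambda>x. (f x)\<^sup>2 + (g x)\<^sup>2 + 2 * (f x * g x))"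
    by (intro Bochner_Integration.integrable_add integrable_mult_right sq_intD
        sq_int_mult_integrable assms)
  then show ?thesis using assms by (auto simp: sq_int_def power2_sum mult.assoc)
qed

lemma sq_int_diff: "f \<in> sq_int M \<Longrightarrow> g \<in> sq_int M \<Longrightarrow> (\<lambda>x. f x - g x) \<in> sq_int M"
  using sq_int_add[of f M "\<lambda>x. (-1) * g x"] sq_int_cmult[of g M "-1"] by simp

lemma sq_int_zero: "(\<lambda>x. 0) \<in> sq_int M" by (simp add: sq_int_def)

lemma sq_int_sum: "(\<And>i. i \<in> I \<Longrightarrow> e i \<in> sq_int M) \<Longrightarrow> (\<lambda>x. \<Sum>i\<in>I. e i x) \<in> sq_int M"
  by (induction I rule: infinite_finite_induct) (auto intro: sq_int_add sq_int_zero)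

lemma ip_sym: "ip M f g = ip M g f"
  by (simp add: ip_def mult.commute)

lemma ip_nonneg: "0 \<le> ip M f f"
  by (simp add: ip_def integral_nonneg_AE)

lemma ip_add_left:
  assumes "f \<in> sq_int M" "g \<in> sq_int M" "u \<in> sq_int M"
  shows "ip M (\<lambda>x. f x + g x) u = ip M f u + ip M g u"
  using assms by (simp add: ip_def distrib_right sq_int_mult_integrable)

lemma ip_cmult_left: "ip M (\<lambda>x. c * f x) u = c * ip M f u"
  by (simp add: ip_def mult.assoc)

lemma ip_diff_left:
  assumes "f \<in> sq_int M" "g \<in> sq_int M" "u \<in> sq_int M"
  shows "ip M (\<lambda>x. f x - g x) u = ip M f u - ip M g u"
  using assms by (simp add: ip_def left_diff_distrib sq_int_mult_integrable)

lemma ip_sum_left: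
  assumes "\<And>i. i \<in> I \<Longrightarrow> e i \<in> sq_int M" "u \<in> sq_int M"
  shows "ip M (\<lambda>x. \<Sum>i\<in>I. c i * e i x) u = (\<Sum>i\<in>I. c i * ip M (e i) u)"
  using assms(1)
proof (induction I rule: infinite_finite_induct)
  case (insert i I)
  then show ?case using assms(2)
    by (simp add: ip_add_left ip_cmult_left sq_int_cmult sq_int_sum)
qed (simp_all add: ip_def)

lemma ip_Cauchy_Schwarz:
  assumes f: "f \<in> sq_int M" and g: "g \<in> sq_int M"
  shows "(ip M f g)\<^sup>2 \<le> ip M f f * ip M g g"
proof -
  have quad: "0 \<le> ip M f f - 2 * t * ip M f g + t\<^sup>2 * ip M g g" for t
  proof -
    let ?u = "\<lambda>x. f x - t * g x"
    have u: "?u \<in> sq_int M" "(\<lambda>x. t * g x) \<in> sq_int M" by (intro sq_int_diff sq_int_cmult f g)+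
    have "ip M ?u ?u = ip M f ?u - t * ip M g ?u"
      using ip_diff_left[OF f u(2) u(1)] by (simp add: ip_cmult_left)
    also have "ip M f ?u = ip M f f - t * ip M f g"
      using ip_diff_left[OF f u(2) f] by (simp add: ip_sym[of M f ?u] ip_sym[of M f g] ip_cmult_left)
    also have "ip M g ?u = ip M f g - t * ip M g g"
      using ip_diff_left[OF f u(2) g] by (simp add: ip_sym[of M g ?u] ip_cmult_left)
    finally show ?thesis using ip_nonneg[of M ?u] by (simp add: algebra_simps power2_eq_square)
  qed
  show ?thesis
  proof (cases "ip M g g = 0")
    case True
    have "ip M f g = 0"
    proof (rule ccontr)
      assume "ip M f g \<noteq> 0"
      \<comment> \<open>When \<open>g\<close> has norm zero the quadratic is affine in
        \<open>t\<close>, and at the chosen \<open>t\<close> it equals -1.\<close>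
      then show False
        using quad[of "(ip M f f + 1) / (2 * ip M f g)"] True by (simp add: field_simps)
    qed
    then show ?thesis by (simp add: True)
  next
    case False
    then have pos: "ip M g g > 0" using ip_nonneg[of M g] by linarith
    have "0 \<le> (ip M f f - 2 * (ip M f g / ip M g g) * ip M f g + (ip M f g / ip M g g)\<^sup>2 * ip M g g) * ip M g g"
      using quad[of "ip M f g / ip M g g"] pos by simp
    also have "\<dots> = ip M f f * ip M g g - (ip M f g)\<^sup>2"
      using pos by (simp add: field_simps power2_eq_square)
    finally show ?thesis by simp
  qed
qed

text \<open>One step of Gram-Schmidt per function: \<open>g\<close> is the part of the new function
  \<open>e n\<close> orthogonal to the old ones, and a multiple of it is removed from the old
  residual \<open>u\<close>. Linearly dependent families are covered as well.\<close>

lemma projection_exists: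
  assumes "finite I" "\<And>i. i \<in> I \<Longrightarrow> e i \<in> sq_int M" "w \<in> sq_int M"
  shows "\<exists>c. \<forall>j\<in>I. ip M (\<lambda>x. w x - (\<Sum>i\<in>I. c i * e i x)) (e j) = 0"
  using assms
proof (induction I arbitrary: w)
  case (insert n I)
  have e: "e i \<in> sq_int M" if "i \<in> insert n I" for i using insert.prems that by blast
  obtain c where c: "ip M (\<lambda>x. w x - (\<Sum>i\<in>I. c i * e i x)) (e j) = 0" if "j \<in> I" for j
    using insert.IH[OF e insert.prems(2)] by auto
  obtain d where d: "ip M (\<lambda>x. e n x - (\<Sum>i\<in>I. d i * e i x)) (e j) = 0" if "j \<in> I" for j
    using insert.IH[OF e e[of n]] by auto
  define u where "u = (\<lambda>x. w x - (\<Sum>i\<in>I. c i * e i x))"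
  define g where "g = (\<lambda>x. e n x - (\<Sum>i\<in>I. d i * e i x))"
  have S: "(\<lambda>x. \<Sum>i\<in>I. a i * e i x) \<in> sq_int M" for a
    by (intro sq_int_sum sq_int_cmult e) auto
  have ug: "u \<in> sq_int M" "g \<in> sq_int M"
    unfolding u_def g_def by (intro sq_int_diff S insert.prems(2) e; simp)+
  have u0: "ip M u (e j) = 0" and g0: "ip M g (e j) = 0" if "j \<in> I" for j
    using c d that by (auto simp: u_def g_def)
  have en: "ip M f (e n) = ip M f g + (\<Sum>i\<in>I. d i * ip M f (e i))" if "f \<in> sq_int M" for f
  proof -
    have "ip M f (e n) = ip M (\<lambda>x. g x + (\<Sum>i\<in>I. d i * e i x)) f"
      by (simp add: g_def ip_sym[of M f "e n"])
    also have "\<dots> = ip M g f + ip M (\<lambda>x. \<Sum>i\<in>I. d i * e i x) f"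
      by (rule ip_add_left[OF ug(2) S that])
    also have "ip M (\<lambda>x. \<Sum>i\<in>I. d i * e i x) f = (\<Sum>i\<in>I. d i * ip M (e i) f)"
      by (rule ip_sum_left) (use e that in auto)
    finally show ?thesis by (simp only: ip_sym[of M _ f])
  qed
  \<comment> \<open>If \<open>g\<close> has norm zero there is nothing to divide by; then
    \<open>ip M u g = 0\<close> by Cauchy-Schwarz, and \<open>t = 0\<close> satisfies
    \<open>tg\<close> as well.\<close>
  define t where "t = (if ip M g g = 0 then 0 else ip M u g / ip M g g)"
  have tg: "ip M u g = t * ip M g g"
    using ip_Cauchy_Schwarz[OF ug] by (auto simp: t_def)
  define a where "a i = (if i = n then t else c i - t * d i)" for i
  have eq: "w x - (\<Sum>i\<in>insert n I. a i * e i x) = u x - t * g x" for x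
  proof -
    have "(\<Sum>i\<in>insert n I. a i * e i x) = t * e n x + (\<Sum>i\<in>I. (c i - t * d i) * e i x)"
      using insert.hyps by (auto simp: a_def intro!: sum.cong)
    then show ?thesis
      by (simp add: u_def g_def algebra_simps sum_subtractf sum_distrib_left)
  qed
  have orth: "ip M (\<lambda>x. u x - t * g x) f = ip M u f - t * ip M g f" if "f \<in> sq_int M" for f
    using ip_diff_left[OF ug(1) sq_int_cmult[OF ug(2)] that] by (simp add: ip_cmult_left)
  have "ip M (\<lambda>x. w x - (\<Sum>i\<in>insert n I. a i * e i x)) (e j) = 0" if j: "j \<in> insert n I" for j
  proof -
    have "ip M u (e j) - t * ip M g (e j) = 0"
    proof (cases "j \<in> I")
      case True then show ?thesis by (simp add: u0 g0)
    next
      case False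
      then have "j = n" using j by simp
      then show ?thesis using en[OF ug(1)] en[OF ug(2)] tg by (simp add: u0 g0)
    qed
    then show ?thesis unfolding eq orth[OF e[OF j]] .
  qed
  then show ?case by blast
qed auto

text \<open>A coefficient is read off by pairing with the part \<open>g\<close> of
  \<open>e i\<close> that is orthogonal to all other functions: the result is
  \<open>c i * ip M g g\<close>, and Cauchy-Schwarz bounds it. This gives the equivalence of norms
  on a finite-dimensional space with an explicit constant.\<close>

lemma coefficients_bounded:
  assumes "finite I" and e: "\<And>i. i \<in> I \<Longrightarrow> e i \<in> sq_int M"
    and indep: "\<And>c. ip M (\<lambda>x. \<Sum>i\<in>I. c i * e i x) (\<lambda>x. \<Sum>i\<in>I. c i * e i x) = 0 \<Longrightarrow> \<forall>i\<in>I. c i = 0"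
  shows "\<exists>K\<ge>0. \<forall>c. \<forall>i\<in>I. (c i)\<^sup>2 \<le> K * ip M (\<lambda>x. \<Sum>i\<in>I. c i * e i x) (\<lambda>x. \<Sum>i\<in>I. c i * e i x)"
proof -
  have S: "(\<lambda>x. \<Sum>i\<in>J. a i * e i x) \<in> sq_int M" if "J \<subseteq> I" for a J
    using that by (intro sq_int_sum sq_int_cmult e) auto
  have "\<exists>K\<ge>0. \<forall>c. (c i)\<^sup>2 \<le> K * ip M (\<lambda>x. \<Sum>i\<in>I. c i * e i x) (\<lambda>x. \<Sum>i\<in>I. c i * e i x)"
    if i: "i \<in> I" for i
  proof -
    let ?J = "I - {i}"
    obtain d where d: "\<forall>j\<in>?J. ip M (\<lambda>x. e i x - (\<Sum>j\<in>?J. d j * e j x)) (e j) = 0"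
      using projection_exists[of ?J e M "e i"] assms(1) e i by auto
    define g where "g = (\<lambda>x. e i x - (\<Sum>j\<in>?J. d j * e j x))"
    have g: "g \<in> sq_int M" unfolding g_def by (intro sq_int_diff e i S) auto
    have geq: "g = (\<lambda>x. \<Sum>j\<in>I. (if j = i then 1 else - d j) * e j x)"
    proof
      fix x
      have "(\<Sum>j\<in>I. (if j = i then 1 else - d j) * e j x)
          = e i x + (\<Sum>j\<in>?J. (if j = i then 1 else - d j) * e j x)"
        using assms(1) i by (subst sum.remove[of I i]) auto
      also have "(\<Sum>j\<in>?J. (if j = i then 1 else - d j) * e j x) = (\<Sum>j\<in>?J. - (d j * e j x))"
        by (intro sum.cong) auto
      finally show "g x = (\<Sum>j\<in>I. (if j = i then 1 else - d j) * e j x)"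
        by (simp add: g_def sum_negf)
    qed
    \<comment> \<open>In \<open>g\<close> the function \<open>e i\<close> has coefficient 1, so a
      vanishing norm would contradict independence.\<close>
    have g0: "ip M g g \<noteq> 0"
    proof
      assume "ip M g g = 0"
      then have "\<forall>j\<in>I. (if j = i then 1 else - d j) = 0"
        by (intro indep) (simp only: geq[symmetric])
      then show False using i by auto
    qed
    have ge: "ip M g (e j) = 0" if "j \<in> ?J" for j using d that by (auto simp: g_def)
    have "ip M g g = ip M (e i) g - ip M (\<lambda>x. \<Sum>j\<in>?J. d j * e j x) g"
      unfolding g_def by (rule ip_diff_left) (use g e i S in \<open>auto simp: g_def\<close>)
    also have "ip M (\<lambda>x. \<Sum>j\<in>?J. d j * e j x) g = 0"
      by (subst ip_sum_left) (use e g ge ip_sym[of M g] in \<open>auto intro!: sum.neutral\<close>)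
    finally have gei: "ip M (e i) g = ip M g g" by simp
    have "(c i)\<^sup>2 \<le> inverse (ip M g g) * ip M (\<lambda>x. \<Sum>i\<in>I. c i * e i x) (\<lambda>x. \<Sum>i\<in>I. c i * e i x)" for c
    proof -
      let ?p = "\<lambda>x. \<Sum>i\<in>I. c i * e i x"
      have "ip M ?p g = (\<Sum>j\<in>I. c j * ip M (e j) g)"
        by (rule ip_sum_left) (use e g in auto)
      also have "\<dots> = c i * ip M g g + (\<Sum>j\<in>?J. c j * ip M (e j) g)"
        using assms(1) i by (simp add: sum.remove[of I i] gei)
      also have "(\<Sum>j\<in>?J. c j * ip M (e j) g) = 0"
        using ge ip_sym[of M g] by (intro sum.neutral) auto
      finally have "(c i * ip M g g)\<^sup>2 \<le> ip M ?p ?p * ip M g g"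
        using ip_Cauchy_Schwarz[OF S[OF order_refl, of c] g] by simp
      then have "((c i)\<^sup>2 * ip M g g) * ip M g g \<le> ip M ?p ?p * ip M g g"
        by (simp add: power2_eq_square algebra_simps)
      moreover have pos: "ip M g g > 0" using g0 ip_nonneg[of M g] by linarith
      ultimately have "(c i)\<^sup>2 * ip M g g \<le> ip M ?p ?p" by simp
      then show ?thesis using pos by (simp add: field_simps)
    qed
    then show ?thesis using ip_nonneg[of M g] by (intro exI[of _ "inverse (ip M g g)"]) simp
  qed
  then have "\<forall>i\<in>I. \<exists>K\<ge>0. \<forall>c. (c i)\<^sup>2 \<le> K * ip M (\<lambda>x. \<Sum>i\<in>I. c i * e i x) (\<lambda>x. \<Sum>i\<in>I. c i * e i x)"
    by simp
  from bchoice[OF this] obtain K where K: "\<And>i. i \<in> I \<Longrightarrow> K i \<ge> 0"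
    "\<And>i c. i \<in> I \<Longrightarrow> (c i)\<^sup>2 \<le> K i * ip M (\<lambda>x. \<Sum>i\<in>I. c i * e i x) (\<lambda>x. \<Sum>i\<in>I. c i * e i x)"
    by auto
  show ?thesis
  proof (intro exI conjI allI ballI)
    show "0 \<le> sum K I" by (intro sum_nonneg K)
    fix c i assume i: "i \<in> I"
    have "(c i)\<^sup>2 \<le> K i * ip M (\<lambda>x. \<Sum>i\<in>I. c i * e i x) (\<lambda>x. \<Sum>i\<in>I. c i * e i x)" by (rule K(2)[OF i])
    also have "\<dots> \<le> sum K I * ip M (\<lambda>x. \<Sum>i\<in>I. c i * e i x) (\<lambda>x. \<Sum>i\<in>I. c i * e i x)"
      using i assms(1) K(1) by (intro mult_right_mono ip_nonneg member_le_sum) auto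
    finally show "(c i)\<^sup>2 \<le> sum K I * ip M (\<lambda>x. \<Sum>i\<in>I. c i * e i x) (\<lambda>x. \<Sum>i\<in>I. c i * e i x)" .
  qed
qed

section \<open>Lebesgue spaces on bounded sets and the L2 projection onto polynomials\<close>

lemma L2_eq_sq_int: "T \<in> sets lebesgue \<Longrightarrow> L2 T = sq_int (lebesgue_on T)"
  by (auto simp: L2_def sq_int_def set_borel_measurable_def set_integrable_def
      borel_measurable_restrict_space_iff integrable_restrict_space)

lemma set_LINT_eq: "T \<in> sets lebesgue \<Longrightarrow> (LINT x:T|lebesgue. f x) = (LINT x|lebesgue_on T. (f x :: real))"
  by (simp add: set_lebesgue_integral_def integral_restrict_space)

lemma L2_norm_sq: "T \<in> sets lebesgue \<Longrightarrow> (L2_norm T (f :: _ \<Rightarrow> real))\<^sup>2 = ip (lebesgue_on T) f f"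
  by (simp add: L2_norm_def set_LINT_eq ip_def power2_eq_square integral_nonneg_AE)

lemma L2_norm_nonneg: "0 \<le> L2_norm T f"
  unfolding L2_norm_def set_lebesgue_integral_def
  by (rule real_sqrt_ge_zero, rule Bochner_Integration.integral_nonneg) (simp add: indicator_def)

lemma continuous_sq_int:
  fixes f :: "'a::euclidean_space \<Rightarrow> real"
  assumes "continuous_on UNIV f" "bounded T" "T \<in> sets lebesgue"
  shows "f \<in> sq_int (lebesgue_on T)"
proof -
  obtain R where R: "T \<subseteq> cball 0 R"
  proof -
    obtain e where "\<forall>y\<in>T. dist 0 y \<le> e" using assms(2) bounded_any_center[of T 0] by blast
    then have "T \<subseteq> cball 0 e" by auto
    then show ?thesis by (rule that)
  qed
  have fb [measurable]: "f \<in> borel_measurable borel"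
    by (rule borel_measurable_continuous_onI[OF assms(1)])
  have "integrable lborel (\<lambda>x. indicator (cball 0 R) x *\<^sub>R (f x)\<^sup>2)"
    by (rule borel_integrable_compact)
      (auto intro!: continuous_intros continuous_on_subset[OF assms(1)])
  then have "set_integrable lebesgue (cball 0 R) (\<lambda>x. (f x)\<^sup>2)"
    unfolding set_integrable_def
    using integrable_completion[OF borel_measurable_integrable] by blast
  then have "set_integrable lebesgue T (\<lambda>x. (f x)\<^sup>2)"
    by (rule set_integrable_subset) (use R assms in auto)
  moreover have "f \<in> borel_measurable (lebesgue_on T)"
    by (intro measurable_restrict_space1 measurable_completion) simp
  ultimately show ?thesis
    by (simp add: sq_int_def set_integrable_def integrable_restrict_space assms)
qed

lemma polys_sq_int:
  "p \<in> polys k \<Longrightarrow> bounded T \<Longrightarrow> T \<in> sets lebesgue \<Longrightarrow> p \<in> sq_int (lebesgue_on T)"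
  by (intro continuous_sq_int polys_continuous)

text \<open>The polynomial vanishes almost everywhere on \<open>T\<close>; inside \<open>T\<close>
  its nonzero set is open and null, hence empty, and a polynomial that vanishes on an open set is
  zero.\<close>

lemma polys_ip_0:
  fixes p :: "'a::euclidean_space \<Rightarrow> real"
  assumes p: "p \<in> polys k" and T: "bounded T" "T \<in> sets lebesgue" "interior T \<noteq> {}"
    and 0: "ip (lebesgue_on T) p p = 0"
  shows "p = (\<lambda>_. 0)"
proof -
  have "integrable (lebesgue_on T) (\<lambda>x. p x * p x)"
    by (intro sq_int_mult_integrable polys_sq_int[OF p] T)
  then have "AE x in lebesgue_on T. p x * p x = 0"
    using 0 unfolding ip_def by (subst (asm) integral_nonneg_eq_0_iff_AE) auto
  then have "AE x in lebesgue. x \<in> T \<longrightarrow> p x = 0"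
    using T by (subst (asm) AE_restrict_space_iff) auto
  then have "AE x in lborel. x \<in> T \<longrightarrow> p x = 0"
    by (simp add: AE_completion_iff)
  then have "AE x in lborel. \<not> (x \<in> interior T \<and> p x \<noteq> 0)"
    by eventually_elim (use interior_subset in blast)
  moreover have op: "open (interior T \<inter> p -` (- {0}))"
    by (intro continuous_open_preimage polys_continuous[OF p]) auto
  ultimately have "interior T \<inter> p -` (- {0}) \<in> null_sets lborel"
    by (subst AE_iff_null_sets) auto
  then have "interior T \<inter> p -` (- {0}) = {}"
    using op open_not_negligible negligible_iff_null_sets null_sets_completionI by blast
  then have "p x = 0" if "x \<in> interior T" for x using that by auto
  then show ?thesis using polys_zero_on_open[OF p, of "interior T"] T(3) by simp
qed

lemma polys_span: "p \<in> polys k \<longleftrightarrow> (\<exists>c. p = (\<lambda>x. \<Sum>a\<in>multi_indices k. c a * monomial a x))"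
  by (auto simp: polys_altdef)

text \<open>Justifies the definite description in \<open>L2_proj\<close>: existence by
  \<open>projection_exists\<close> applied to the monomials, uniqueness by
  \<open>polys_ip_0\<close>.\<close>

lemma L2_proj_properties:
  fixes w :: "'a::euclidean_space \<Rightarrow> real"
  assumes T: "bounded T" "T \<in> sets lebesgue" "interior T \<noteq> {}" and w: "w \<in> L2 T"
  shows "L2_proj k T w \<in> polys k"
    and "\<And>q. q \<in> polys k \<Longrightarrow> ip (lebesgue_on T) (\<lambda>x. w x - L2_proj k T w x) q = 0"
proof -
  let ?M = "lebesgue_on T"
  let ?P = "\<lambda>p. p \<in> polys k \<and> (\<forall>q\<in>polys k. ip ?M (\<lambda>x. w x - p x) q = 0)"
  have w: "w \<in> sq_int ?M" using w L2_eq_sq_int[OF T(2)] by simp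
  have m: "monomial a \<in> sq_int ?M" if "a \<in> multi_indices k" for a :: "'a \<Rightarrow> nat"
    using that by (intro polys_sq_int[OF monomial_in_polys] T)
  from projection_exists[OF finite_multi_indices, of k monomial ?M w] m w
  obtain c where c: "\<And>a. a \<in> multi_indices k \<Longrightarrow>
      ip ?M (\<lambda>x. w x - (\<Sum>a\<in>multi_indices k. c a * monomial a x)) (monomial a) = 0" by blast
  define p where "p = (\<lambda>x. \<Sum>a\<in>multi_indices k. c a * monomial a x)"
  have p: "p \<in> polys k" unfolding p_def by (intro polys_sum polys_cmult monomial_in_polys)
  have wp: "(\<lambda>x. w x - p x) \<in> sq_int ?M"
    by (intro sq_int_diff w polys_sq_int[OF p] T)
  have "ip ?M (\<lambda>x. w x - p x) q = 0" if q: "q \<in> polys k" for q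
  proof -
    obtain d where d: "q = (\<lambda>x. \<Sum>a\<in>multi_indices k. d a * monomial a x)"
      using q by (auto simp: polys_span)
    have "ip ?M q (\<lambda>x. w x - p x) = (\<Sum>a\<in>multi_indices k. d a * ip ?M (monomial a) (\<lambda>x. w x - p x))"
      unfolding d by (rule ip_sum_left[OF m wp])
    also have "\<dots> = 0"
      using c ip_sym[of ?M "\<lambda>x. w x - p x"] by (intro sum.neutral) (simp add: p_def)
    finally show ?thesis by (simp add: ip_sym[of ?M q])
  qed
  then have P: "?P p" using p by blast
  \<comment> \<open>The difference of two candidates is a polynomial orthogonal to every polynomial,
    in particular to itself.\<close>
  moreover have "p' = p" if "?P p'" for p'
  proof -
    let ?q = "\<lambda>x. p' x - p x"
    have q: "?q \<in> polys k" using that p by (intro polys_diff) auto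
    have wp': "(\<lambda>x. w x - p' x) \<in> sq_int ?M"
      using that by (intro sq_int_diff w polys_sq_int T) auto
    have "ip ?M (\<lambda>x. (w x - p x) - (w x - p' x)) ?q = 0"
      using ip_diff_left[OF wp wp' polys_sq_int[OF q T(1,2)]] P that q by simp
    then have "?q = (\<lambda>_. 0)" by (intro polys_ip_0[OF q T]) simp
    then show ?thesis by (auto simp: fun_eq_iff)
  qed
  ultimately have "?P (THE p. ?P p)" by (rule theI)
  moreover have "L2_proj k T w = (THE p. ?P p)"
    by (simp add: L2_proj_def set_LINT_eq[OF T(2)] ip_def)
  ultimately show "L2_proj k T w \<in> polys k"
    and "\<And>q. q \<in> polys k \<Longrightarrow> ip ?M (\<lambda>x. w x - L2_proj k T w x) q = 0" by auto
qed

text \<open>Pythagoras for \<open>w - p\<close>, split into the projection error and a polynomial.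
  The first bound is the local stability used for interpolation, already with an arbitrary
  polynomial subtracted; the second is the best-approximation property used in the Bramble-Hilbert
  estimate.\<close>

lemma L2_proj_bounds:
  fixes w :: "'a::euclidean_space \<Rightarrow> real"
  assumes T: "bounded T" "T \<in> sets lebesgue" "interior T \<noteq> {}" and w: "w \<in> L2 T" and p: "p \<in> polys k"
  shows "(L2_norm T (\<lambda>x. L2_proj k T w x - p x))\<^sup>2 \<le> (L2_norm T (\<lambda>x. w x - p x))\<^sup>2"
    and "(L2_norm T (\<lambda>x. w x - L2_proj k T w x))\<^sup>2 \<le> (L2_norm T (\<lambda>x. w x - p x))\<^sup>2"
proof -
  let ?M = "lebesgue_on T" let ?P = "L2_proj k T w"
  let ?q = "\<lambda>x. ?P x - p x" and ?u = "\<lambda>x. w x - ?P x"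
  note P = L2_proj_properties[OF T w, where k = k]
  have w: "w \<in> sq_int ?M" using w L2_eq_sq_int[OF T(2)] by simp
  have q: "?q \<in> polys k" by (intro polys_diff P p)
  have sq: "?q \<in> sq_int ?M" "?u \<in> sq_int ?M"
    by (intro sq_int_diff w polys_sq_int[OF q] polys_sq_int[OF P(1)] T)+
  have uq: "ip ?M ?u ?q = 0" by (rule P(2)[OF q])
  let ?s = "\<lambda>x. ?u x + ?q x"
  have s: "?s \<in> sq_int ?M" by (intro sq_int_add sq)
  have "ip ?M ?s ?s = ip ?M ?u ?s + ip ?M ?q ?s" by (rule ip_add_left[OF sq(2,1) s])
  also have "ip ?M ?u ?s = ip ?M ?s ?u" by (rule ip_sym)
  also have "ip ?M ?s ?u = ip ?M ?u ?u + ip ?M ?q ?u" by (rule ip_add_left[OF sq(2,1,2)])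
  also have "ip ?M ?q ?s = ip ?M ?s ?q" by (rule ip_sym)
  also have "ip ?M ?s ?q = ip ?M ?u ?q + ip ?M ?q ?q" by (rule ip_add_left[OF sq(2,1,1)])
  also have "ip ?M ?q ?u = ip ?M ?u ?q" by (rule ip_sym)
  finally have "ip ?M (\<lambda>x. w x - p x) (\<lambda>x. w x - p x) = ip ?M ?u ?u + ip ?M ?q ?q"
    by (simp add: uq)
  then show "(L2_norm T ?q)\<^sup>2 \<le> (L2_norm T (\<lambda>x. w x - p x))\<^sup>2"
    "(L2_norm T ?u)\<^sup>2 \<le> (L2_norm T (\<lambda>x. w x - p x))\<^sup>2"
    using ip_nonneg[of ?M ?u] ip_nonneg[of ?M ?q] by (simp_all add: L2_norm_sq[OF T(2)])
qed

section \<open>Norm equivalence for polynomials, scaling, and inverse estimates\<close>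

definition pderiv_at :: "'a::euclidean_space \<Rightarrow> ('a \<Rightarrow> real) \<Rightarrow> 'a \<Rightarrow> real" where
  "pderiv_at b p x = frechet_derivative p (at x) b"

lemma has_derivative_pderiv_at:
  assumes "p \<in> polys k"
  shows "(p has_derivative (\<lambda>v. \<Sum>b\<in>Basis. (v \<bullet> b) * pderiv_at b p x)) (at x)"
    and "b \<in> Basis \<Longrightarrow> pderiv_at b p \<in> polys k"
proof -
  obtain D where D: "\<And>b. D b \<in> polys k"
      "\<And>x. (p has_derivative (\<lambda>v. \<Sum>b\<in>Basis. (v \<bullet> b) * D b x)) (at x)"
    using polys_has_derivative[OF assms] by blast
  have eq: "pderiv_at b p x = D b x" if "b \<in> Basis" for b x
  proof -
    have "frechet_derivative p (at x) = (\<lambda>v. \<Sum>b\<in>Basis. (v \<bullet> b) * D b x)"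
      using frechet_derivative_at[OF D(2)[of x]] by simp
    then show ?thesis using that
      by (simp add: pderiv_at_def inner_Basis mult_if_delta)
  qed
  show "(p has_derivative (\<lambda>v. \<Sum>b\<in>Basis. (v \<bullet> b) * pderiv_at b p x)) (at x)"
    using D(2)[of x] by (simp add: eq)
  show "b \<in> Basis \<Longrightarrow> pderiv_at b p \<in> polys k"
    using D(1)[of b] eq[of b] by (metis ext)
qed

lemma pderiv_at_lincomb:
  assumes "finite I" "\<And>i. i \<in> I \<Longrightarrow> e i \<in> polys k"
  shows "pderiv_at b (\<lambda>x. \<Sum>i\<in>I. c i * e i x) x = (\<Sum>i\<in>I. c i * pderiv_at b (e i) x)"
proof -
  have "((\<lambda>x. \<Sum>i\<in>I. c i * e i x) has_derivative (\<lambda>v. \<Sum>i\<in>I. c i * frechet_derivative (e i) (at x) v)) (at x)"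
  proof (intro has_derivative_sum has_derivative_mult_right)
    fix i assume "i \<in> I"
    then have "e i differentiable (at x)"
      using has_derivative_pderiv_at(1)[OF assms(2)] differentiable_def by blast
    then show "(e i has_derivative frechet_derivative (e i) (at x)) (at x)"
      using frechet_derivative_works by blast
  qed
  from frechet_derivative_at[OF this] show ?thesis
    by (simp add: pderiv_at_def fun_eq_iff)
qed

text \<open>A minimal spanning set of monomials is a basis, which spares us the linear independence of all
  monomials.\<close>

lemma monomial_basis_exists:
  "\<exists>I \<subseteq> multi_indices k.
     (\<forall>p::'a::euclidean_space \<Rightarrow> real. p \<in> polys k \<longrightarrow> (\<exists>c. p = (\<lambda>x. \<Sum>a\<in>I. c a * monomial a x))) \<and>
     (\<forall>c. (\<lambda>x::'a. \<Sum>a\<in>I. c a * monomial a x) = (\<lambda>_. 0) \<longrightarrow> (\<forall>a\<in>I. c a = 0))"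
proof -
  define P where "P I \<longleftrightarrow> I \<subseteq> multi_indices k \<and>
      (\<forall>p::'a \<Rightarrow> real. p \<in> polys k \<longrightarrow> (\<exists>c. p = (\<lambda>x. \<Sum>a\<in>I. c a * monomial a x)))" for I
  have "P (multi_indices k)" by (auto simp: P_def polys_span)
  then obtain I where I: "P I" and min: "\<And>J. P J \<Longrightarrow> card I \<le> card J"
    using ex_has_least_nat[of P _ card] by blast
  have fin: "finite I" using I finite_multi_indices finite_subset by (auto simp: P_def)
  have "c b = 0" if c: "(\<lambda>x::'a. \<Sum>a\<in>I. c a * monomial a x) = (\<lambda>_. 0)" and b: "b \<in> I" for c b
  proof (rule ccontr)
    assume nz: "c b \<noteq> 0"
    have mb: "monomial b x = (\<Sum>a\<in>I - {b}. - (c a / c b) * monomial a x)" for x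
    proof -
      have "c b * monomial b x + (\<Sum>a\<in>I - {b}. c a * monomial a x) = 0"
        using fun_cong[OF c, of x] fin b by (simp add: sum.remove[of I b])
      then have "monomial b x = - (\<Sum>a\<in>I - {b}. c a * monomial a x) / c b"
        using nz by (simp add: field_simps eq_neg_iff_add_eq_0)
      then show ?thesis by (simp add: sum_divide_distrib sum_negf)
    qed
    have "P (I - {b})"
      unfolding P_def
    proof (intro conjI allI impI)
      show "I - {b} \<subseteq> multi_indices k" using I by (auto simp: P_def)
      fix p :: "'a \<Rightarrow> real" assume "p \<in> polys k"
      then obtain d where d: "p = (\<lambda>x. \<Sum>a\<in>I. d a * monomial a x)" using I by (auto simp: P_def)
      have "p x = (\<Sum>a\<in>I - {b}. (d a - d b * (c a / c b)) * monomial a x)" for x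
      proof -
        have "p x = d b * monomial b x + (\<Sum>a\<in>I - {b}. d a * monomial a x)"
          unfolding d using fin b by (simp add: sum.remove[of I b])
        also have "\<dots> = (\<Sum>a\<in>I - {b}. (d a - d b * (c a / c b)) * monomial a x)"
          unfolding mb by (simp add: sum_distrib_left sum.distrib[symmetric] algebra_simps)
        finally show ?thesis .
      qed
      then show "\<exists>c. p = (\<lambda>x. \<Sum>a\<in>I - {b}. c a * monomial a x)"
        by (intro exI[of _ "\<lambda>a. d a - d b * (c a / c b)"] ext)
    qed
    from min[OF this] show False using fin b card_Diff1_less[of I b] by simp
  qed
  then show ?thesis using I by (auto simp: P_def)
qed

text \<open>The radius \<open>R\<close> is unrelated to \<open>r\<close> and is later the larger
  one: a polynomial is controlled far outside the ball on which its norm is taken. This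
  extrapolation is what lets an element control a polynomial on another element nearby.\<close>

lemma polys_norm_equivalence:
  fixes R r :: real
  assumes "0 < r"
  shows "\<exists>K\<ge>0. \<forall>p\<in>polys k. \<forall>x\<in>cball (0::'a::euclidean_space) R.
      (p x)\<^sup>2 \<le> K * (L2_norm (ball 0 r) p)\<^sup>2 \<and>
      (\<forall>b\<in>Basis. (pderiv_at b p x)\<^sup>2 \<le> K * (L2_norm (ball 0 r) p)\<^sup>2)"
proof -
  let ?T = "ball (0::'a) r"
  have T: "bounded ?T" "?T \<in> sets lebesgue" "interior ?T \<noteq> {}" using assms by auto
  let ?M = "lebesgue_on ?T"
  obtain I where I': "I \<subseteq> multi_indices k \<and>
     (\<forall>p::'a \<Rightarrow> real. p \<in> polys k \<longrightarrow> (\<exists>c. p = (\<lambda>x. \<Sum>a\<in>I. c a * monomial a x))) \<and>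
     (\<forall>c. (\<lambda>x::'a. \<Sum>a\<in>I. c a * monomial a x) = (\<lambda>_. 0) \<longrightarrow> (\<forall>a\<in>I. c a = 0))"
    using monomial_basis_exists by (rule exE)
  have I: "I \<subseteq> multi_indices k" using I' by simp
  have span: "\<exists>c. p = (\<lambda>x. \<Sum>a\<in>I. c a * monomial a x)" if "p \<in> polys k" for p :: "'a \<Rightarrow> real"
    using I' that by auto
  have indepI: "\<forall>a\<in>I. c a = 0" if "(\<lambda>x::'a. \<Sum>a\<in>I. c a * monomial a x) = (\<lambda>_. 0)" for c
    using I' that by simp
  have fin: "finite I" using I finite_multi_indices finite_subset by blast
  note mon = monomial_in_polys[OF subsetD[OF I]]
  have indep: "\<forall>a\<in>I. c a = 0"
    if "ip ?M (\<lambda>x. \<Sum>a\<in>I. c a * monomial a x) (\<lambda>x. \<Sum>a\<in>I. c a * monomial a x) = 0" for c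
    by (rule indepI, rule polys_ip_0[where k = k, OF _ T that]) (intro polys_sum polys_cmult mon)
  have "\<exists>K\<ge>0. \<forall>c. \<forall>a\<in>I. (c a)\<^sup>2
      \<le> K * ip ?M (\<lambda>x. \<Sum>a\<in>I. c a * monomial a x) (\<lambda>x. \<Sum>a\<in>I. c a * monomial a x)"
    by (rule coefficients_bounded[OF fin]) (use polys_sq_int[OF mon T(1,2)] indep in auto)
  then obtain K0 where K0: "K0 \<ge> 0" "\<And>c a. a \<in> I \<Longrightarrow>
      (c a)\<^sup>2 \<le> K0 * ip ?M (\<lambda>x. \<Sum>a\<in>I. c a * monomial a x) (\<lambda>x. \<Sum>a\<in>I. c a * monomial a x)"
    by auto
  have "\<exists>B. \<forall>x\<in>cball 0 R. \<bar>f x\<bar> \<le> B" if "f \<in> polys k" for f :: "'a \<Rightarrow> real"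
  proof -
    have "bounded (f ` cball 0 R)"
      by (intro compact_imp_bounded compact_continuous_image polys_continuous[OF that] compact_cball)
    then show ?thesis by (auto simp: bounded_iff)
  qed
  then have "\<forall>f\<in>polys k. \<exists>B. \<forall>x\<in>cball (0::'a) R. \<bar>f x\<bar> \<le> B" by blast
  then obtain B where "\<forall>f\<in>polys k. \<forall>x\<in>cball (0::'a) R. \<bar>f x\<bar> \<le> B f"
    by (rule bchoice[THEN exE])
  then have B: "\<bar>f x\<bar> \<le> B f" if "f \<in> polys k" "x \<in> cball (0::'a) R" for f x
    using that by blast
  \<comment> \<open>Cauchy-Schwarz for the sum over \<open>I\<close>: the squared coefficients
    contribute \<open>card I * K0\<close>, the squared values of the family at most the sum of the
    \<open>B (F a)\<close> squared. The family \<open>F\<close> is first the monomials and then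
    their partial derivatives.\<close>
  define C where "C F = real (card I) * K0 * (\<Sum>a\<in>I. (B (F a))\<^sup>2)" for F
  have main: "(\<Sum>a\<in>I. c a * F a x)\<^sup>2
      \<le> C F * ip ?M (\<lambda>x. \<Sum>a\<in>I. c a * monomial a x) (\<lambda>x. \<Sum>a\<in>I. c a * monomial a x)"
    if F: "\<And>a. a \<in> I \<Longrightarrow> F a \<in> polys k" and x: "x \<in> cball 0 R" for F c x
  proof -
    let ?q = "ip ?M (\<lambda>x. \<Sum>a\<in>I. c a * monomial a x) (\<lambda>x. \<Sum>a\<in>I. c a * monomial a x)"
    have "(\<Sum>a\<in>I. c a * F a x)\<^sup>2 \<le> (\<Sum>a\<in>I. (c a)\<^sup>2) * (\<Sum>a\<in>I. (F a x)\<^sup>2)"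
      by (rule Cauchy_Schwarz_ineq_sum)
    also have "\<dots> \<le> (\<Sum>a\<in>I. K0 * ?q) * (\<Sum>a\<in>I. (B (F a))\<^sup>2)"
    proof (intro mult_mono sum_mono sum_nonneg)
      fix a assume a: "a \<in> I"
      show "(c a)\<^sup>2 \<le> K0 * ?q" by (rule K0(2)[OF a])
      show "(F a x)\<^sup>2 \<le> (B (F a))\<^sup>2" using B[OF F[OF a] x] by (simp add: abs_le_square_iff[symmetric])
    qed (auto simp: K0 ip_nonneg)
    also have "\<dots> = C F * ?q" by (simp add: C_def algebra_simps)
    finally show ?thesis .
  qed
  let ?K = "C monomial + (\<Sum>b\<in>Basis. C (\<lambda>a. pderiv_at b (monomial a)))"
  have C0: "C F \<ge> 0" for F unfolding C_def using K0(1) by (intro mult_nonneg_nonneg sum_nonneg) auto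
  show ?thesis
  proof (intro exI[of _ ?K] conjI ballI)
    show "?K \<ge> 0" by (intro add_nonneg_nonneg sum_nonneg C0)
    fix p :: "'a \<Rightarrow> real" and x assume p: "p \<in> polys k" and x: "x \<in> cball (0::'a) R"
    obtain c where c: "p = (\<lambda>x. \<Sum>a\<in>I. c a * monomial a x)"
      using span[OF p] by (rule exE)
    let ?q = "ip ?M p p"
    have "(p x)\<^sup>2 \<le> C monomial * ?q"
      unfolding c by (rule main[OF mon x])
    also have "\<dots> \<le> ?K * ?q" by (intro mult_right_mono ip_nonneg) (simp add: C0 sum_nonneg)
    finally show "(p x)\<^sup>2 \<le> ?K * (L2_norm ?T p)\<^sup>2" by (simp add: L2_norm_sq[OF T(2)])
    fix b :: 'a assume b: "b \<in> Basis"
    have "(pderiv_at b p x)\<^sup>2 \<le> C (\<lambda>a. pderiv_at b (monomial a)) * ?q"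
      unfolding c using main[of "\<lambda>a. pderiv_at b (monomial a)", OF has_derivative_pderiv_at(2)[OF mon b] x]
      by (simp add: pderiv_at_lincomb[OF fin mon])
    also have "\<dots> \<le> ?K * ?q"
      using member_le_sum[of b Basis "\<lambda>b. C (\<lambda>a. pderiv_at b (monomial a))"] C0 b
      by (intro mult_right_mono ip_nonneg) (simp add: C0 add_increasing)
    finally show "(pderiv_at b p x)\<^sup>2 \<le> ?K * (L2_norm ?T p)\<^sup>2" by (simp add: L2_norm_sq[OF T(2)])
  qed
qed

lemma nn_integral_affine:
  fixes z :: "'a::euclidean_space"
  assumes f: "f \<in> borel_measurable borel" and c: "c \<noteq> 0"
  shows "(\<integral>\<^sup>+x. f x \<partial>lborel) = ennreal (\<bar>c\<bar> ^ DIM('a)) * (\<integral>\<^sup>+x. f (z + c *\<^sub>R x) \<partial>lborel)"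
proof -
  have "(\<integral>\<^sup>+x. f x \<partial>lborel)
      = (\<integral>\<^sup>+x. f x \<partial>density (distr lborel borel (\<lambda>x. z + c *\<^sub>R x)) (\<lambda>_. \<bar>c\<bar> ^ DIM('a)))"
    using lborel_affine[OF c, of z] by simp
  also have "\<dots> = ennreal (\<bar>c\<bar> ^ DIM('a)) * (\<integral>\<^sup>+x. f (z + c *\<^sub>R x) \<partial>lborel)"
    using f by (simp add: nn_integral_density nn_integral_distr nn_integral_cmult)
  finally show ?thesis .
qed

lemma LINT_ball_scale:
  fixes z :: "'a::euclidean_space" and f :: "'a \<Rightarrow> real"
  assumes f: "f \<in> borel_measurable borel" and h: "0 < h"
  shows "(LINT x:ball z (r * h)|lebesgue. f x) = h ^ DIM('a) * (LINT x:ball 0 r|lebesgue. f (z + h *\<^sub>R x))"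
proof -
  let ?F = "\<lambda>x. indicator (ball z (r * h)) x *\<^sub>R f x"
  have F: "?F \<in> borel_measurable borel"
    by (intro borel_measurable_scaleR borel_measurable_indicator f) simp
  have "(\<lambda>x. f (z + h *\<^sub>R x)) \<in> borel_measurable borel"
    by (intro measurable_compose[OF _ f] borel_measurable_continuous_onI continuous_intros)
  then have G: "(\<lambda>x. indicator (ball 0 r) x *\<^sub>R f (z + h *\<^sub>R x)) \<in> borel_measurable lborel"
    by (intro borel_measurable_scaleR borel_measurable_indicator) simp_all
  have ind: "indicator (ball z (r * h)) (z + h *\<^sub>R x) = (indicator (ball 0 r) x :: real)" for x
    using h by (simp add: indicator_def dist_norm algebra_simps)
  have "(LINT x:ball z (r * h)|lebesgue. f x) = (LINT x|lborel. ?F x)"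
    unfolding set_lebesgue_integral_def by (rule integral_completion) (use F in simp)
  also have "\<dots> = (LINT x|density (distr lborel borel (\<lambda>x. z + h *\<^sub>R x)) (\<lambda>_. ennreal (\<bar>h\<bar> ^ DIM('a))). ?F x)"
    using lborel_affine[of h z] h by simp
  also have "\<dots> = h ^ DIM('a) * (LINT x|lborel. ?F (z + h *\<^sub>R x))"
    using h F by (simp add: integral_density integral_distr)
  also have "(LINT x|lborel. ?F (z + h *\<^sub>R x)) = (LINT x|lborel. indicator (ball 0 r) x *\<^sub>R f (z + h *\<^sub>R x))"
    by (simp add: ind)
  also have "\<dots> = (LINT x:ball 0 r|lebesgue. f (z + h *\<^sub>R x))"
    unfolding set_lebesgue_integral_def by (rule integral_completion[symmetric, OF G])
  finally show ?thesis .
qed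

lemma pderiv_at_comp_affine:
  fixes z :: "'a::euclidean_space"
  assumes p: "p \<in> polys k" and "b \<in> Basis"
  shows "pderiv_at b (\<lambda>y. p (z + c *\<^sub>R y)) y = c * pderiv_at b p (z + c *\<^sub>R y)"
proof -
  have "((\<lambda>y. z + c *\<^sub>R y) has_derivative (\<lambda>v. c *\<^sub>R v)) (at y)"
    by (auto intro!: derivative_eq_intros)
  from has_derivative_compose[OF this has_derivative_pderiv_at(1)[OF p]]
  have "frechet_derivative (\<lambda>y. p (z + c *\<^sub>R y)) (at y)
      = (\<lambda>v. \<Sum>b\<in>Basis. ((c *\<^sub>R v) \<bullet> b) * pderiv_at b p (z + c *\<^sub>R y))"
    by (rule frechet_derivative_at[symmetric])
  then show ?thesis using assms(2)
    by (simp add: pderiv_at_def[of b "\<lambda>y. p (z + c *\<^sub>R y)"] inner_Basis mult_if_delta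
        sum_distrib_left[symmetric] mult.assoc)
qed

text \<open>Substitution of \<open>z + h y\<close> for \<open>x\<close>: the Jacobian gives the
  power \<open>DIM('a)\<close> of \<open>h\<close>, and each derivative one further factor, squared.
  The constant is that of the unit scale, so it is the same for all \<open>z\<close> and
  \<open>h\<close>.\<close>

lemma polys_scaled_bounds:
  fixes R r :: real
  assumes "0 < r"
  shows "\<exists>K\<ge>0. \<forall>p\<in>polys k. \<forall>(z::'a::euclidean_space) h. 0 < h \<longrightarrow> (\<forall>x\<in>cball z (R * h).
      h ^ DIM('a) * (p x)\<^sup>2 \<le> K * (L2_norm (ball z (r * h)) p)\<^sup>2 \<and>
      (\<forall>b\<in>Basis. h ^ (DIM('a) + 2) * (pderiv_at b p x)\<^sup>2 \<le> K * (L2_norm (ball z (r * h)) p)\<^sup>2))"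
proof -
  obtain K where "K \<ge> 0 \<and> (\<forall>p\<in>polys k. \<forall>x\<in>cball (0::'a) R.
      (p x)\<^sup>2 \<le> K * (L2_norm (ball 0 r) p)\<^sup>2 \<and>
      (\<forall>b\<in>Basis. (pderiv_at b p x)\<^sup>2 \<le> K * (L2_norm (ball 0 r) p)\<^sup>2))"
    using polys_norm_equivalence[OF assms] by (rule exE)
  then have K: "K \<ge> 0"
    and K1: "\<And>p x. p \<in> polys k \<Longrightarrow> x \<in> cball (0::'a) R \<Longrightarrow> (p x)\<^sup>2 \<le> K * (L2_norm (ball 0 r) p)\<^sup>2"
    and K2: "\<And>p x b. p \<in> polys k \<Longrightarrow> x \<in> cball (0::'a) R \<Longrightarrow> b \<in> Basis \<Longrightarrow>
      (pderiv_at b p x)\<^sup>2 \<le> K * (L2_norm (ball 0 r) p)\<^sup>2"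
    by auto
  show ?thesis
  proof (intro exI[of _ K] conjI K ballI allI impI)
    fix p :: "'a \<Rightarrow> real" and z :: 'a and h x assume p: "p \<in> polys k" and h: "(0::real) < h" and x: "x \<in> cball z (R * h)"
    define q where "q = (\<lambda>y. p (z + h *\<^sub>R y))"
    have q: "q \<in> polys k" unfolding q_def by (rule polys_comp_affine[OF p])
    define y where "y = (1 / h) *\<^sub>R (x - z)"
    have zy: "z + h *\<^sub>R y = x" using h by (simp add: y_def)
    have y: "y \<in> cball 0 R"
    proof -
      have "norm y = norm (x - z) / h" using h by (simp add: y_def)
      then show ?thesis using x h by (simp add: dist_norm norm_minus_commute pos_divide_le_eq)
    qed
    have "(\<lambda>x. p x * p x) \<in> borel_measurable borel"
      by (intro borel_measurable_times polys_borel[OF p])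
    from LINT_ball_scale[OF this h, of z r]
    have L: "(L2_norm (ball z (r * h)) p)\<^sup>2 = h ^ DIM('a) * (L2_norm (ball 0 r) q)\<^sup>2"
      by (simp add: L2_norm_sq ip_def set_LINT_eq q_def)
    show "h ^ DIM('a) * (p x)\<^sup>2 \<le> K * (L2_norm (ball z (r * h)) p)\<^sup>2"
      using mult_left_mono[OF K1[OF q y], of "h ^ DIM('a)"] h
      unfolding L q_def zy by (simp add: algebra_simps)
    fix b :: 'a assume b: "b \<in> Basis"
    have "pderiv_at b q y = h * pderiv_at b p x"
      unfolding q_def pderiv_at_comp_affine[OF p b] zy ..
    then show "h ^ (DIM('a) + 2) * (pderiv_at b p x)\<^sup>2 \<le> K * (L2_norm (ball z (r * h)) p)\<^sup>2"
      using mult_left_mono[OF K2[OF q y b], of "h ^ DIM('a)"] h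
      unfolding L by (simp add: algebra_simps power_mult_distrib power_add power2_eq_square)
  qed
qed

text \<open>The integrand of the squared \<open>nabla_norm m\<close>, so that both values of
  \<open>m\<close> share one treatment of integrability and overlap.\<close>

definition grad_density :: "nat \<Rightarrow> ('a::euclidean_space \<Rightarrow> real) \<Rightarrow> 'a \<Rightarrow> real" where
  "grad_density m v x = (if m = 0 then (v x)\<^sup>2 else (norm (grad v x))\<^sup>2)"

lemma grad_density_nonneg: "0 \<le> grad_density m v x"
  by (simp add: grad_density_def)

lemma nabla_norm_sq: "(nabla_norm m X v)\<^sup>2 = (LINT x:X|lebesgue. grad_density m v x)"
proof -
  have "0 \<le> (LINT x:X|lebesgue. grad_density m v x)"
    unfolding set_lebesgue_integral_def
    by (rule Bochner_Integration.integral_nonneg) (simp add: grad_density_nonneg)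
  then show ?thesis
    by (cases "m = 0") (simp_all add: nabla_norm_def L2_norm_def grad_density_def)
qed

lemma norm_sum_Basis_sq: "(norm (\<Sum>b\<in>Basis. c b *\<^sub>R b))\<^sup>2 = (\<Sum>b\<in>Basis. (c b)\<^sup>2)"
proof -
  have "(norm (\<Sum>b\<in>Basis. c b *\<^sub>R b))\<^sup>2
      = (\<Sum>b\<in>Basis. ((\<Sum>b\<in>Basis. c b *\<^sub>R b) \<bullet> b) * ((\<Sum>b\<in>Basis. c b *\<^sub>R b) \<bullet> b))"
    unfolding power2_norm_eq_inner by (rule euclidean_inner)
  then show ?thesis by (simp add: power2_eq_square)
qed

lemma grad_density_pderiv:
  "grad_density m p x = (if m = 0 then (p x)\<^sup>2 else (\<Sum>b\<in>Basis. (pderiv_at b p x)\<^sup>2))"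
  by (simp add: grad_density_def grad_def pderiv_at_def norm_sum_Basis_sq)

lemma grad_density_polys_continuous:
  assumes "p \<in> polys k" shows "continuous_on S (grad_density m p)"
proof -
  have "continuous_on S (\<lambda>x. if m = 0 then (p x)\<^sup>2 else (\<Sum>b\<in>Basis. (pderiv_at b p x)\<^sup>2))"
    by (cases "m = 0") (auto intro!: continuous_intros polys_continuous[OF assms]
        polys_continuous[OF has_derivative_pderiv_at(2)[OF assms]])
  then show ?thesis by (simp add: grad_density_pderiv[abs_def])
qed

lemma continuous_set_integrable:
  fixes f :: "'a::euclidean_space \<Rightarrow> real"
  assumes "continuous_on UNIV f" "bounded T" "T \<in> sets lebesgue"
  shows "set_integrable lebesgue T f"
proof -
  have "integrable (lebesgue_on T) (\<lambda>x. f x * 1)"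
    by (intro sq_int_mult_integrable continuous_sq_int assms continuous_intros)
  then show ?thesis
    by (simp add: set_integrable_def integrable_restrict_space assms)
qed

lemma set_LINT_le_bound:
  fixes f :: "'a::euclidean_space \<Rightarrow> real"
  assumes T: "T \<subseteq> cball z R" "T \<in> sets lebesgue" and "0 \<le> R" "0 \<le> A"
    and f: "set_integrable lebesgue T f" and le: "\<And>x. x \<in> T \<Longrightarrow> f x \<le> A"
  shows "(LINT x:T|lebesgue. f x) \<le> unit_ball_vol (real DIM('a)) * R ^ DIM('a) * A"
proof -
  have "(LINT x:T|lebesgue. f x) \<le> (LINT x:cball z R|lebesgue. A)"
    unfolding set_lebesgue_integral_def
  proof (rule integral_mono)
    show "integrable lebesgue (\<lambda>x. indicator T x *\<^sub>R f x)" using f by (simp add: set_integrable_def)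
    show "integrable lebesgue (\<lambda>x. indicator (cball z R) x *\<^sub>R A)"
      using continuous_set_integrable[of "\<lambda>_. A" "cball z R"] by (simp add: set_integrable_def)
    show "indicator T x *\<^sub>R f x \<le> indicator (cball z R) x *\<^sub>R A" for x
      using le[of x] T(1) assms(4) by (auto simp: indicator_def)
  qed
  also have "\<dots> = A * measure lebesgue (cball z R)"
    by (simp add: set_lebesgue_integral_def)
  also have "measure lebesgue (cball z R) = unit_ball_vol (real DIM('a)) * R ^ DIM('a)"
    using content_cball[OF assms(3), of z] by simp
  finally show ?thesis by (simp add: mult.commute)
qed

lemma set_LINT_mono_set:
  fixes f :: "'a::euclidean_space \<Rightarrow> real"
  assumes "S \<subseteq> T" "S \<in> sets lebesgue" "set_integrable lebesgue T f" "\<And>x. 0 \<le> f x"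
  shows "(LINT x:S|lebesgue. f x) \<le> (LINT x:T|lebesgue. f x)"
  unfolding set_lebesgue_integral_def
proof (rule integral_mono)
  show "integrable lebesgue (\<lambda>x. indicator S x *\<^sub>R f x)"
    using set_integrable_subset[OF assms(3,2,1)] by (simp add: set_integrable_def)
  show "integrable lebesgue (\<lambda>x. indicator T x *\<^sub>R f x)"
    using assms(3) by (simp add: set_integrable_def)
  show "indicator S x *\<^sub>R f x \<le> indicator T x *\<^sub>R f x" for x
    using assms(1,4) by (auto simp: indicator_def)
qed

lemma L2_norm_sq_LINT: "(L2_norm T p)\<^sup>2 = (LINT x:T|lebesgue. (p x)\<^sup>2)" for p :: "_ \<Rightarrow> real"
  using nabla_norm_sq[of 0 T p] by (simp add: nabla_norm_def grad_density_def)

text \<open>The three bounds have different customers: point values for nodal values of projections,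
  the inverse estimate for the interpolation error, and the comparison of seminorms for carrying a
  polynomial from \<open>Sh T\<close> to \<open>T\<close>. The sets enter only through a small ball
  inside \<open>T'\<close> and a concentric large ball around \<open>T\<close>.\<close>

lemma polys_inverse_estimates:
  fixes R r :: real
  assumes r: "0 < r" and R: "0 \<le> R" and m: "m \<in> {0, 1}"
  shows "\<exists>K\<ge>0. \<forall>p\<in>polys k. \<forall>(z::'a::euclidean_space) h T T'. 0 < h \<longrightarrow>
      T \<subseteq> cball z (R * h) \<longrightarrow> T \<in> sets lebesgue \<longrightarrow> ball z (r * h) \<subseteq> T' \<longrightarrow> bounded T' \<longrightarrow> T' \<in> sets lebesgue \<longrightarrow>
      (\<forall>x\<in>cball z (R * h). h ^ DIM('a) * (p x)\<^sup>2 \<le> K * (L2_norm T' p)\<^sup>2) \<and>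
      h ^ (2 * m) * (nabla_norm m T p)\<^sup>2 \<le> K * (L2_norm T' p)\<^sup>2 \<and>
      (nabla_norm m T p)\<^sup>2 \<le> K * (nabla_norm m T' p)\<^sup>2"
proof -
  obtain K where "K \<ge> 0 \<and> (\<forall>p\<in>polys k. \<forall>(z::'a::euclidean_space) h. 0 < h \<longrightarrow> (\<forall>x\<in>cball z (R * h).
      h ^ DIM('a) * (p x)\<^sup>2 \<le> K * (L2_norm (ball z (r * h)) p)\<^sup>2 \<and>
      (\<forall>b\<in>Basis. h ^ (DIM('a) + 2) * (pderiv_at b p x)\<^sup>2 \<le> K * (L2_norm (ball z (r * h)) p)\<^sup>2)))"
    using polys_scaled_bounds[OF r] by (rule exE)
  then have K: "K \<ge> 0"
    and K1: "\<And>p z h x. p \<in> polys k \<Longrightarrow> 0 < h \<Longrightarrow> x \<in> cball (z::'a) (R * h) \<Longrightarrow>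
      h ^ DIM('a) * (p x)\<^sup>2 \<le> K * (L2_norm (ball z (r * h)) p)\<^sup>2"
    and K2: "\<And>p z h x b. p \<in> polys k \<Longrightarrow> 0 < h \<Longrightarrow> x \<in> cball (z::'a) (R * h) \<Longrightarrow> b \<in> Basis \<Longrightarrow>
      h ^ (DIM('a) + 2) * (pderiv_at b p x)\<^sup>2 \<le> K * (L2_norm (ball z (r * h)) p)\<^sup>2"
    by auto
  define V where "V = unit_ball_vol (real DIM('a)) * R ^ DIM('a)"
  have V: "V \<ge> 0" unfolding V_def using R by (intro mult_nonneg_nonneg) auto
  \<comment> \<open>\<open>V\<close> times the dimension-th power of \<open>h\<close> is the volume
    of the ball of radius \<open>R * h\<close>. The sum dominates the three constants
    \<open>K\<close>, \<open>V * K\<close> and \<open>V * K * DIM('a)\<close> that occur below; the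
    dimension counts the partial derivatives.\<close>
  define K' where "K' = K + V * K * DIM('a)"
  have D1: "real DIM('a) \<ge> 1" by (simp add: Suc_leI)
  have K': "K \<le> K'" "V * K \<le> K'" "V * (K * DIM('a)) \<le> K'"
  proof -
    have VK: "0 \<le> V * K" using V K by simp
    moreover have "V * K * 1 \<le> V * K * DIM('a)" by (intro mult_left_mono D1 VK)
    ultimately show "K \<le> K'" "V * K \<le> K'" "V * (K * DIM('a)) \<le> K'"
      using K by (simp_all add: K'_def mult.assoc)
  qed
  show ?thesis
  proof (rule exI[of _ K'], intro conjI ballI allI impI)
    show "0 \<le> K'" using K K'(1) by linarith
    fix p :: "'a \<Rightarrow> real" and z :: 'a and h T T'
    assume p: "p \<in> polys k" and h: "(0::real) < h" and T: "T \<subseteq> cball z (R * h)" "T \<in> sets lebesgue"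
      and T': "ball z (r * h) \<subseteq> T'" "bounded T'" "T' \<in> sets lebesgue"
    have mono: "(L2_norm (ball z (r * h)) q)\<^sup>2 \<le> (L2_norm T' q)\<^sup>2" if "q \<in> polys k" for q
      unfolding L2_norm_sq_LINT
      by (rule set_LINT_mono_set[OF T'(1)], simp, rule continuous_set_integrable)
        (auto intro!: continuous_intros polys_continuous[OF that] T')
    have K1': "h ^ DIM('a) * (q x)\<^sup>2 \<le> K * (L2_norm T' q)\<^sup>2" if "q \<in> polys k" "x \<in> cball z (R * h)" for q x
      using K1[OF that(1) h that(2)] mult_left_mono[OF mono[OF that(1)] K] by linarith
    have K2': "h ^ (DIM('a) + 2) * (pderiv_at b p x)\<^sup>2 \<le> K * (L2_norm T' p)\<^sup>2"
      if "b \<in> Basis" "x \<in> cball z (R * h)" for b x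
      using K2[OF p h that(2) that(1)] mult_left_mono[OF mono[OF p] K] by linarith
    have int: "set_integrable lebesgue S (grad_density m p)" if "bounded S" "S \<in> sets lebesgue" for S
      by (rule continuous_set_integrable[OF grad_density_polys_continuous[OF p] that])
    have bT: "bounded T" using T(1) bounded_cball bounded_subset by blast
    have Rh: "0 \<le> R * h" using R h by simp
    have hd: "0 < h ^ DIM('a)" using h by simp
    \<comment> \<open>A pointwise bound on the large ball is integrated over \<open>T\<close>. The
      volume cancels the power of \<open>h\<close> in the pointwise bound, and \<open>n\<close> is
      \<open>2 * m\<close> for the inverse estimate and 0 for the comparison of seminorms.\<close>
    have bnd: "h ^ n * (nabla_norm m T p)\<^sup>2 \<le> V * B"
      if "\<And>x. x \<in> cball z (R * h) \<Longrightarrow> h ^ DIM('a) * (h ^ n * grad_density m p x) \<le> B" "0 \<le> B" for n B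
    proof -
      have "(nabla_norm m T p)\<^sup>2 \<le> unit_ball_vol (real DIM('a)) * (R * h) ^ DIM('a) * (B / (h ^ DIM('a) * h ^ n))"
        unfolding nabla_norm_sq
      proof (rule set_LINT_le_bound[OF T Rh _ int[OF bT T(2)]])
        show "0 \<le> B / (h ^ DIM('a) * h ^ n)" using that(2) h by simp
        fix x assume "x \<in> T"
        then have "h ^ DIM('a) * (h ^ n * grad_density m p x) \<le> B" using that(1) T(1) by blast
        then show "grad_density m p x \<le> B / (h ^ DIM('a) * h ^ n)"
          using h by (simp add: pos_le_divide_eq mult_ac)
      qed
      then have "h ^ n * (nabla_norm m T p)\<^sup>2
          \<le> h ^ n * (unit_ball_vol (real DIM('a)) * (R * h) ^ DIM('a) * (B / (h ^ DIM('a) * h ^ n)))"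
        using h by (intro mult_left_mono) auto
      also have "\<dots> = V * B" using h by (simp add: V_def power_mult_distrib)
      finally show ?thesis .
    qed
    show "h ^ DIM('a) * (p x)\<^sup>2 \<le> K' * (L2_norm T' p)\<^sup>2" if "x \<in> cball z (R * h)" for x
      using K1'[OF p that] mult_right_mono[OF K'(1), of "(L2_norm T' p)\<^sup>2"] by simp
    show "h ^ (2 * m) * (nabla_norm m T p)\<^sup>2 \<le> K' * (L2_norm T' p)\<^sup>2"
    proof -
      have "h ^ (2 * m) * (nabla_norm m T p)\<^sup>2 \<le> V * ((K * DIM('a)) * (L2_norm T' p)\<^sup>2)"
      proof (rule bnd)
        show "0 \<le> K * DIM('a) * (L2_norm T' p)\<^sup>2" using K by simp
        fix x assume x: "x \<in> cball z (R * h)"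
        show "h ^ DIM('a) * (h ^ (2 * m) * grad_density m p x) \<le> K * DIM('a) * (L2_norm T' p)\<^sup>2"
        proof (cases "m = 0")
          case True
          have "K * (L2_norm T' p)\<^sup>2 * 1 \<le> K * (L2_norm T' p)\<^sup>2 * DIM('a)"
            using D1 K by (intro mult_left_mono) auto
          then show ?thesis using True K1'[OF p x] by (simp add: grad_density_def mult_ac)
        next
          case False
          then have m1: "m = 1" using m by simp
          have "h ^ DIM('a) * (h ^ (2 * m) * grad_density m p x)
              = (\<Sum>b\<in>Basis. h ^ (DIM('a) + 2) * (pderiv_at b p x)\<^sup>2)"
            by (simp add: grad_density_pderiv m1 sum_distrib_left power_add power2_eq_square mult_ac)
          also have "\<dots> \<le> (\<Sum>b\<in>(Basis::'a set). K * (L2_norm T' p)\<^sup>2)"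
            by (intro sum_mono K2' x)
          finally show ?thesis by (simp add: mult_ac)
        qed
      qed
      also have "\<dots> = (V * (K * DIM('a))) * (L2_norm T' p)\<^sup>2" by simp
      also have "\<dots> \<le> K' * (L2_norm T' p)\<^sup>2" by (intro mult_right_mono K') simp
      finally show ?thesis .
    qed
    show "(nabla_norm m T p)\<^sup>2 \<le> K' * (nabla_norm m T' p)\<^sup>2"
    proof -
      have "h ^ 0 * (nabla_norm m T p)\<^sup>2 \<le> V * (K * (nabla_norm m T' p)\<^sup>2)"
      proof (rule bnd)
        show "0 \<le> K * (nabla_norm m T' p)\<^sup>2" using K by simp
        fix x assume x: "x \<in> cball z (R * h)"
        show "h ^ DIM('a) * (h ^ 0 * grad_density m p x) \<le> K * (nabla_norm m T' p)\<^sup>2"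
        proof (cases "m = 0")
          case True
          then show ?thesis using K1'[OF p x] by (simp add: grad_density_def nabla_norm_def)
        next
          case False
          note pd = has_derivative_pderiv_at(2)[OF p]
          have "h ^ DIM('a) * (h ^ 0 * grad_density m p x) = (\<Sum>b\<in>Basis. h ^ DIM('a) * (pderiv_at b p x)\<^sup>2)"
            using False by (simp add: grad_density_pderiv sum_distrib_left)
          \<comment> \<open>The estimate for values is applied to each partial derivative, again an
            element of \<open>polys k\<close>; so the gradient on \<open>T'\<close>, and not the
            polynomial itself, appears on the right.\<close>
          also have "\<dots> \<le> (\<Sum>b\<in>Basis. K * (L2_norm T' (pderiv_at b p))\<^sup>2)"
            by (intro sum_mono K1' x pd)
          also have "\<dots> = K * (LINT x:T'|lebesgue. (\<Sum>b\<in>Basis. (pderiv_at b p x)\<^sup>2))"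
          proof -
            have "set_integrable lebesgue T' (\<lambda>x. (pderiv_at b p x)\<^sup>2)" if "b \<in> Basis" for b
              by (intro continuous_set_integrable T' continuous_intros polys_continuous[OF pd[OF that]])
            then show ?thesis
              unfolding L2_norm_sq_LINT set_lebesgue_integral_def set_integrable_def
              by (simp add: sum_distrib_left[symmetric] scaleR_sum_right[symmetric] Bochner_Integration.integral_sum[symmetric])
          qed
          also have "\<dots> = K * (nabla_norm m T' p)\<^sup>2"
            unfolding nabla_norm_sq using False by (simp add: grad_density_pderiv[abs_def])
          finally show ?thesis .
        qed
      qed
      also have "\<dots> = (V * K) * (nabla_norm m T' p)\<^sup>2" by simp
      also have "\<dots> \<le> K' * (nabla_norm m T' p)\<^sup>2" by (intro mult_right_mono K') simp
      finally show ?thesis by simp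
    qed
  qed
qed

section \<open>Mollifiers and the Bramble--Hilbert lemma\<close>

text \<open>The classical flat function \<open>exp (- 1 / t)\<close>, together with its quotients by
  powers of \<open>t\<close>. With these quotients the derivative of a member is a combination of
  members, so smoothness needs only one differentiation rule.\<close>

definition flat :: "nat \<Rightarrow> real \<Rightarrow> real" where
  "flat j t = (if t \<le> 0 then 0 else exp (- 1 / t) / t ^ j)"

lemma power_le_fact_exp: "0 \<le> x \<Longrightarrow> x ^ n \<le> fact n * exp (x::real)"
proof -
  assume x: "0 \<le> x"
  have "(\<Sum>i\<in>{n}. x ^ i /\<^sub>R fact i) \<le> (\<Sum>i. x ^ i /\<^sub>R fact i)"
    using x by (intro sum_le_suminf summable_exp_generic) auto
  then show ?thesis by (simp add: exp_def field_simps)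
qed

text \<open>One term of the exponential series at \<open>1 / t\<close> already beats the power
  \<open>j + 2\<close>. The bound is quadratic in \<open>t\<close>, so the difference quotient of
  \<open>flat j\<close> at 0 tends to 0.\<close>

lemma flat_bound: "\<bar>flat j t\<bar> \<le> fact (j + 2) * t\<^sup>2"
proof (cases "t \<le> 0")
  case False
  then have t: "t > 0" by simp
  have "(1 / t) ^ (j + 2) \<le> fact (j + 2) * exp (1 / t)"
    using t by (intro power_le_fact_exp) simp
  then have "exp (- 1 / t) * (1 / t) ^ (j + 2) \<le> exp (- 1 / t) * (fact (j + 2) * exp (1 / t))"
    by (intro mult_left_mono) auto
  also have "\<dots> = fact (j + 2)" by (simp add: exp_minus)
  finally have "flat j t / t\<^sup>2 \<le> fact (j + 2)"
    using t by (simp add: flat_def power_divide power_add divide_divide_eq_left power2_eq_square mult_ac)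
  then show ?thesis using t by (simp add: flat_def pos_divide_le_eq mult_ac)
qed (simp add: flat_def)

lemma flat_has_derivative:
  "(flat j has_real_derivative (flat (j + 2) t - j * flat (j + 1) t)) (at t)"
proof -
  consider "t < 0" | "t = 0" | "t > 0" by linarith
  then show ?thesis
  proof cases
    case 1
    have "((\<lambda>_. 0) has_real_derivative 0) (at t)" by simp
    then have "(flat j has_real_derivative 0) (at t)"
      by (rule has_field_derivative_transform_within_open[of _ _ _ "{..<0}"]) (use 1 in \<open>auto simp: flat_def\<close>)
    then show ?thesis using 1 by (simp add: flat_def)
  next
    case 2
    have "((\<lambda>h. flat j h / h) \<longlongrightarrow> 0) (at 0)"
    proof (rule Lim_null_comparison)
      show "eventually (\<lambda>h. norm (flat j h / h) \<le> fact (j + 2) * \<bar>h\<bar>) (at 0)"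
      proof (rule eventually_mono[OF eventually_at_ball'[of 1 0 UNIV]])
        fix h :: real assume h: "h \<in> ball 0 1 \<and> h \<noteq> 0 \<and> h \<in> UNIV"
        have "\<bar>flat j h\<bar> \<le> (fact (j + 2) * \<bar>h\<bar>) * \<bar>h\<bar>"
          using flat_bound[of j h] by (simp add: power2_eq_square mult.assoc abs_mult[symmetric])
        then show "norm (flat j h / h) \<le> fact (j + 2) * \<bar>h\<bar>" using h by (simp add: pos_divide_le_eq)
      qed simp
      show "((\<lambda>h. fact (j + 2) * \<bar>h\<bar>) \<longlongrightarrow> 0) (at (0::real))"
        by (auto intro!: tendsto_eq_intros)
    qed
    then have "(flat j has_real_derivative 0) (at 0)"
      by (simp add: DERIV_def flat_def[of j 0])
    then show ?thesis using 2 by (simp add: flat_def)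
  next
    case 3
    have "((\<lambda>t. exp (- 1 / t) / t ^ j) has_real_derivative
        (exp (- 1 / t) / t ^ (j + 2) - j * (exp (- 1 / t) / t ^ (j + 1)))) (at t)"
      using 3
      apply (auto intro!: derivative_eq_intros)
      apply (cases j; simp add: field_simps power2_eq_square)
      done
    then have "(flat j has_real_derivative
        (exp (- 1 / t) / t ^ (j + 2) - j * (exp (- 1 / t) / t ^ (j + 1)))) (at t)"
      by (rule has_field_derivative_transform_within_open[of _ _ _ "{0<..}"]) (use 3 in \<open>auto simp: flat_def\<close>)
    then show ?thesis using 3 by (simp add: flat_def)
  qed
qed

definition smooth :: "('a::euclidean_space \<Rightarrow> real) \<Rightarrow> bool" where
  "smooth f \<longleftrightarrow> (\<forall>bs. set bs \<subseteq> Basis \<longrightarrow> (\<forall>x. partials bs f differentiable (at x)))"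

lemma partials_append: "partials (as @ bs) f = partials as (partials bs f)"
  by (induction as) auto

text \<open>A class of differentiable functions that is closed under partial derivatives consists of
  smooth functions; iterated derivatives then need no separate induction.\<close>

lemma smooth_coinduct:
  assumes "P f"
    and "\<And>f x. P f \<Longrightarrow> f differentiable (at x)"
    and "\<And>f b. P f \<Longrightarrow> b \<in> Basis \<Longrightarrow> P (\<lambda>x. frechet_derivative f (at x) b)"
  shows "smooth f"
proof -
  have "P (partials bs f)" if "set bs \<subseteq> Basis" for bs
    using that by (induction bs) (auto intro: assms)
  then show ?thesis using assms(2) by (auto simp: smooth_def)
qed

text \<open>Needed for two values of \<open>c\<close>: \<open>1 / e\<close> shrinks the support of
  the mollifier, and -1 reflects it into the test function of a convolution.\<close>

lemma partials_comp_affine: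
  fixes z :: "'a::euclidean_space"
  assumes "smooth f" "set bs \<subseteq> Basis"
  shows "partials bs (\<lambda>x. f (z + c *\<^sub>R x)) = (\<lambda>x. c ^ length bs * partials bs f (z + c *\<^sub>R x))"
  using assms(2)
proof (induction bs)
  case (Cons b bs)
  let ?g = "partials bs f"
  have "(?g has_derivative frechet_derivative ?g (at (z + c *\<^sub>R x))) (at (z + c *\<^sub>R x))" for x
    using assms(1) Cons.prems frechet_derivative_works by (auto simp: smooth_def)
  moreover have "((\<lambda>y. z + c *\<^sub>R y) has_derivative (\<lambda>v. c *\<^sub>R v)) (at x)" for x :: 'a
    by (auto intro!: derivative_eq_intros)
  ultimately have D: "((\<lambda>x. ?g (z + c *\<^sub>R x)) has_derivative (\<lambda>v. frechet_derivative ?g (at (z + c *\<^sub>R x)) (c *\<^sub>R v))) (at x)" for x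
    by (rule has_derivative_compose[rotated])
  have "((\<lambda>x. c ^ length bs * ?g (z + c *\<^sub>R x)) has_derivative
      (\<lambda>v. c ^ length bs * frechet_derivative ?g (at (z + c *\<^sub>R x)) (c *\<^sub>R v))) (at x)" for x
    by (rule has_derivative_mult_right[OF D])
  from frechet_derivative_at[OF this]
  have "frechet_derivative (\<lambda>x. c ^ length bs * ?g (z + c *\<^sub>R x)) (at x) b
      = c ^ length bs * frechet_derivative ?g (at (z + c *\<^sub>R x)) (c *\<^sub>R b)" for x
    by (simp add: fun_eq_iff)
  moreover have "linear (frechet_derivative ?g (at (z + c *\<^sub>R x)))" for x
    using assms(1) Cons.prems linear_frechet_derivative by (auto simp: smooth_def)
  ultimately have "frechet_derivative (\<lambda>x. c ^ length bs * ?g (z + c *\<^sub>R x)) (at x) b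
      = c ^ length (b # bs) * partials (b # bs) f (z + c *\<^sub>R x)" for x
    by (simp add: linear_cmul)
  moreover have "partials bs (\<lambda>x. f (z + c *\<^sub>R x)) = (\<lambda>x. c ^ length bs * ?g (z + c *\<^sub>R x))"
    using Cons by simp
  ultimately show ?case by (simp only: partials.simps)
qed simp

lemma smooth_comp_affine:
  assumes "smooth f" shows "smooth (\<lambda>x. f (z + c *\<^sub>R x))"
  unfolding smooth_def
proof (intro allI impI)
  fix bs :: "'a list" and x :: 'a assume bs: "set bs \<subseteq> Basis"
  have "(\<lambda>x. z + c *\<^sub>R x) differentiable (at x)" by simp
  moreover have "partials bs f differentiable (at (z + c *\<^sub>R x))"
    using assms bs by (auto simp: smooth_def)
  ultimately have "(\<lambda>x. partials bs f (z + c *\<^sub>R x)) differentiable (at x)"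
    by (rule differentiable_compose[rotated])
  then show "partials bs (\<lambda>x. f (z + c *\<^sub>R x)) differentiable (at x)"
    unfolding partials_comp_affine[OF assms bs] by simp
qed

lemma smooth_cmult:
  assumes "smooth f" shows "smooth (\<lambda>x. c * f x)"
    and "set bs \<subseteq> Basis \<Longrightarrow> partials bs (\<lambda>x. c * f x) = (\<lambda>x. c * partials bs f x)"
proof -
  have *: "partials bs (\<lambda>x. c * f x) = (\<lambda>x. c * partials bs f x)" if "set bs \<subseteq> Basis" for bs
    using that
  proof (induction bs)
    case (Cons b bs)
    have "((\<lambda>x. c * partials bs f x) has_derivative (\<lambda>v. c * frechet_derivative (partials bs f) (at x) v)) (at x)" for x
      using assms Cons.prems frechet_derivative_works
      by (intro has_derivative_mult_right) (auto simp: smooth_def)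
    from frechet_derivative_at[OF this]
    have "frechet_derivative (\<lambda>x. c * partials bs f x) (at x) b = c * partials (b # bs) f x" for x
      by (simp add: fun_eq_iff)
    moreover have "partials bs (\<lambda>x. c * f x) = (\<lambda>x. c * partials bs f x)"
      using Cons by simp
    ultimately show ?case by (simp only: partials.simps)
  qed simp
  show "set bs \<subseteq> Basis \<Longrightarrow> partials bs (\<lambda>x. c * f x) = (\<lambda>x. c * partials bs f x)" by (rule *)
  show "smooth (\<lambda>x. c * f x)"
    using assms by (auto simp: smooth_def *)
qed

lemma smooth_partials: "smooth f \<Longrightarrow> set bs \<subseteq> Basis \<Longrightarrow> smooth (partials bs f)"
  by (auto simp: smooth_def partials_append[symmetric])

lemma smooth_continuous: "smooth f \<Longrightarrow> continuous_on S f"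
proof (rule continuous_at_imp_continuous_on, rule ballI)
  fix x assume "smooth f"
  then have "f differentiable (at x)" unfolding smooth_def by (elim allE[of _ "[]"]) simp
  then show "isCont f x" by (rule differentiable_imp_continuous_within)
qed

lemma partials_continuous: "smooth f \<Longrightarrow> set bs \<subseteq> Basis \<Longrightarrow> continuous_on S (partials bs f)"
  by (intro smooth_continuous smooth_partials)

text \<open>A class that contains \<open>bump\<close> and is closed under partial derivatives.\<close>

inductive bump_class :: "('a::euclidean_space \<Rightarrow> real) \<Rightarrow> bool" where
  base: "p \<in> polys k \<Longrightarrow> bump_class (\<lambda>x. p x * flat j (1 - x \<bullet> x))"
| add: "bump_class f \<Longrightarrow> bump_class g \<Longrightarrow> bump_class (\<lambda>x. f x + g x)"

lemma bump_class_derivative: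
  assumes "bump_class f"
  shows "\<exists>D. (\<forall>b\<in>Basis. bump_class (D b)) \<and> (\<forall>x. (f has_derivative (\<lambda>v. \<Sum>b\<in>Basis. (v \<bullet> b) * D b x)) (at x))"
  using assms
proof induction
  case (base p k j)
  obtain E where E: "(\<forall>b. E b \<in> polys k) \<and> (\<forall>x. (p has_derivative (\<lambda>v. \<Sum>b\<in>Basis. (v \<bullet> b) * E b x)) (at x))"
    using polys_has_derivative[OF base] by (rule exE)
  let ?r = "\<lambda>x::'a. 1 - x \<bullet> x"
  \<comment> \<open>Product rule, with inner derivative \<open>- 2 * (x \<bullet> b)\<close> and the
    two terms of \<open>flat_has_derivative\<close>.\<close>
  define D where "D b x = E b x * flat j (?r x) + ((- 2 * ((x \<bullet> b) * p x)) * flat (j + 2) (?r x)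
      + (2 * j * ((x \<bullet> b) * p x)) * flat (j + 1) (?r x))" for b x
  have "bump_class (D b)" if b: "b \<in> Basis" for b
    unfolding D_def
    using E polys_coord_mult[OF base b]
    by (intro bump_class.add bump_class.base polys_cmult) auto
  moreover have "((\<lambda>x. p x * flat j (?r x)) has_derivative (\<lambda>v. \<Sum>b\<in>Basis. (v \<bullet> b) * D b x)) (at x)" for x
  proof -
    let ?f' = "flat (j + 2) (?r x) - j * flat (j + 1) (?r x)"
    have r: "(?r has_derivative (\<lambda>v. - 2 * (v \<bullet> x))) (at x)"
      by (auto intro!: derivative_eq_intros simp: inner_commute)
    have "(flat j has_derivative (*) ?f') (at (?r x))"
      using flat_has_derivative[of j "?r x"] by (simp only: has_field_derivative_def)
    from has_derivative_compose[OF r this]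
    have "((\<lambda>x. flat j (?r x)) has_derivative (\<lambda>v. ?f' * (- 2 * (v \<bullet> x)))) (at x)" .
    from has_derivative_mult[OF conjunct2[OF E, rule_format, of x] this]
    have "((\<lambda>x. p x * flat j (?r x)) has_derivative
       (\<lambda>v. p x * (?f' * (- 2 * (v \<bullet> x))) + (\<Sum>b\<in>Basis. (v \<bullet> b) * E b x) * flat j (?r x))) (at x)" .
    moreover have "p x * (?f' * (- 2 * (v \<bullet> x))) + (\<Sum>b\<in>Basis. (v \<bullet> b) * E b x) * flat j (?r x)
        = (\<Sum>b\<in>Basis. (v \<bullet> b) * D b x)" for v
    proof -
      have "p x * (?f' * (- 2 * (v \<bullet> x))) = (\<Sum>b\<in>Basis. (v \<bullet> b) * (- 2 * (x \<bullet> b) * p x * ?f'))"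
      proof -
        have "p x * (?f' * (- 2 * (v \<bullet> x))) = (- 2 * p x * ?f') * (\<Sum>b\<in>Basis. (v \<bullet> b) * (x \<bullet> b))"
          by (subst euclidean_inner[of v x]) (simp only: mult_ac)
        also have "\<dots> = (\<Sum>b\<in>Basis. (- 2 * p x * ?f') * ((v \<bullet> b) * (x \<bullet> b)))"
          by (rule sum_distrib_left)
        finally show ?thesis by (simp only: mult_ac)
      qed
      moreover have "(\<Sum>b\<in>Basis. (v \<bullet> b) * D b x)
          = (\<Sum>b\<in>Basis. (v \<bullet> b) * (- 2 * (x \<bullet> b) * p x * ?f')) + (\<Sum>b\<in>Basis. (v \<bullet> b) * E b x * flat j (?r x))"
        unfolding sum.distrib[symmetric] by (intro sum.cong) (simp_all add: D_def algebra_simps)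
      ultimately show ?thesis by (simp add: sum_distrib_right)
    qed
    ultimately show ?thesis by simp
  qed
  ultimately show ?case by (intro exI[of _ D]) simp
next
  case (add f g)
  obtain D where D: "(\<forall>b\<in>Basis. bump_class (D b)) \<and> (\<forall>x. (f has_derivative (\<lambda>v. \<Sum>b\<in>Basis. (v \<bullet> b) * D b x)) (at x))"
    using add.IH(1) by (rule exE)
  obtain E where E: "(\<forall>b\<in>Basis. bump_class (E b)) \<and> (\<forall>x. (g has_derivative (\<lambda>v. \<Sum>b\<in>Basis. (v \<bullet> b) * E b x)) (at x))"
    using add.IH(2) by (rule exE)
  show ?case
  proof (intro exI[of _ "\<lambda>b x. D b x + E b x"] conjI ballI allI)
    show "bump_class (\<lambda>x. D b x + E b x)" if "b \<in> Basis" for b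
      using D E that by (intro bump_class.add) auto
    show "((\<lambda>x. f x + g x) has_derivative (\<lambda>v. \<Sum>b\<in>Basis. (v \<bullet> b) * (D b x + E b x))) (at x)" for x
      using has_derivative_add[OF conjunct2[OF D, rule_format, of x] conjunct2[OF E, rule_format, of x]]
      by (simp add: distrib_left sum.distrib)
  qed
qed

lemma bump_class_smooth: assumes "bump_class f" shows "smooth f"
proof (rule smooth_coinduct[where P = bump_class, OF assms])
  fix f :: "'a \<Rightarrow> real" assume f: "bump_class f"
  obtain D where D: "(\<forall>b\<in>Basis. bump_class (D b)) \<and> (\<forall>x. (f has_derivative (\<lambda>v. \<Sum>b\<in>Basis. (v \<bullet> b) * D b x)) (at x))"
    using bump_class_derivative[OF f] by (rule exE)
  show "f differentiable (at x)" for x using D differentiableI by blast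
  fix b :: 'a assume b: "b \<in> Basis"
  have "frechet_derivative f (at x) = (\<lambda>v. \<Sum>b\<in>Basis. (v \<bullet> b) * D b x)" for x
    using frechet_derivative_at[OF conjunct2[OF D, rule_format, of x]] by (rule sym)
  then have "(\<lambda>x. frechet_derivative f (at x) b) = D b"
    using b by (simp add: inner_Basis mult_if_delta)
  then show "bump_class (\<lambda>x. frechet_derivative f (at x) b)" using D b by simp
qed

definition bump :: "'a::euclidean_space \<Rightarrow> real" where
  "bump x = flat 0 (1 - x \<bullet> x)"

lemma bump_smooth: "smooth bump"
proof -
  have "bump_class (\<lambda>x::'a. 1 * flat 0 (1 - x \<bullet> x))" by (rule bump_class.base[of _ 0]) simp
  then show ?thesis using bump_class_smooth[of bump] by (simp add: bump_def[abs_def])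
qed

lemma bump_nonneg: "0 \<le> bump x" by (simp add: bump_def flat_def)

lemma bump_eq_0: "1 \<le> norm x \<Longrightarrow> bump x = 0"
proof -
  assume "1 \<le> norm x"
  then have "1 \<le> (norm x)\<^sup>2" by simp
  then show ?thesis by (simp add: bump_def flat_def power2_norm_eq_inner)
qed

lemma bump_pos: "bump (0::'a::euclidean_space) > 0" by (simp add: bump_def flat_def)

lemma mollifier_exists:
  fixes e :: real
  assumes e: "0 < e"
  obtains \<phi> :: "'a::euclidean_space \<Rightarrow> real" where "smooth \<phi>" "\<And>x. 0 \<le> \<phi> x" "\<And>x. e \<le> norm x \<Longrightarrow> \<phi> x = 0"
    "(\<integral>\<^sup>+x. ennreal (\<phi> x) \<partial>lborel) = 1"
proof -
  define f where "f = (\<lambda>x::'a. bump (0 + (1 / e) *\<^sub>R x))"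
  have sm: "smooth f" unfolding f_def by (rule smooth_comp_affine[OF bump_smooth])
  have f0: "f x = 0" if "e \<le> norm x" for x
    using that e by (simp add: f_def bump_eq_0)
  have nn: "0 \<le> f x" for x by (simp add: f_def bump_nonneg)
  have fb: "f \<in> borel_measurable borel" by (rule borel_measurable_continuous_onI[OF smooth_continuous[OF sm]])
  let ?I = "\<integral>\<^sup>+x. ennreal (f x) \<partial>lborel"
  have "integrable lborel (\<lambda>x. indicator (cball 0 e) x *\<^sub>R f x)"
    by (rule borel_integrable_compact[OF compact_cball smooth_continuous[OF sm]])
  moreover have "(\<lambda>x. indicator (cball 0 e) x *\<^sub>R f x) = f"
    using f0 by (auto simp: indicator_def fun_eq_iff)
  ultimately have int: "integrable lborel f" by simp
  have fin: "?I = ennreal (integral\<^sup>L lborel f)" by (rule nn_integral_eq_integral[OF int]) (simp add: nn)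
  \<comment> \<open>Otherwise the nonzero set of the continuous function \<open>f\<close> would be
    open and null, hence empty, although \<open>f\<close> is positive at 0.\<close>
  have "?I \<noteq> 0"
  proof
    assume "?I = 0"
    then have "AE x in lborel. ennreal (f x) = 0"
      using fb by (subst (asm) nn_integral_0_iff_AE) auto
    then have "AE x in lborel. \<not> (f x \<noteq> 0)"
      by eventually_elim (use nn in \<open>simp add: ennreal_eq_0_iff antisym\<close>)
    moreover have op: "open (f -` (- {0}))"
      by (rule open_vimage[OF _ smooth_continuous[OF sm]]) auto
    ultimately have "f -` (- {0}) \<in> null_sets lborel"
      by (subst AE_iff_null_sets) auto
    then have "f -` (- {0}) = {}"
      using op open_not_negligible negligible_iff_null_sets null_sets_completionI by blast
    then have "f 0 = 0" by auto
    then show False using bump_pos[where 'a = 'a] by (simp add: f_def)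
  qed
  then have pos: "integral\<^sup>L lborel f > 0" using fin by (simp add: ennreal_eq_0_iff not_le)
  define \<phi> where "\<phi> = (\<lambda>x. (1 / integral\<^sup>L lborel f) * f x)"
  show ?thesis
  proof (rule that[of \<phi>])
    show "smooth \<phi>" unfolding \<phi>_def by (rule smooth_cmult[OF sm])
    show "0 \<le> \<phi> x" for x using pos nn by (simp add: \<phi>_def)
    show "e \<le> norm x \<Longrightarrow> \<phi> x = 0" for x using f0 by (simp add: \<phi>_def)
    have "(\<integral>\<^sup>+x. ennreal (\<phi> x) \<partial>lborel) = (\<integral>\<^sup>+x. ennreal (1 / integral\<^sup>L lborel f) * ennreal (f x) \<partial>lborel)"
      unfolding \<phi>_def using pos nn by (intro nn_integral_cong) (simp add: ennreal_mult[symmetric])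
    also have "\<dots> = ennreal (1 / integral\<^sup>L lborel f) * ?I"
      using fb by (intro nn_integral_cmult) simp
    also have "\<dots> = 1" using pos by (simp add: fin ennreal_mult[symmetric])
    finally show "(\<integral>\<^sup>+x. ennreal (\<phi> x) \<partial>lborel) = 1" .
  qed
qed

section \<open>Taylor's formula along a segment\<close>

definition dirs :: "nat \<Rightarrow> 'a::euclidean_space list set" where
  "dirs j = {bs. set bs \<subseteq> Basis \<and> length bs = j}"

lemma dirs_0: "dirs 0 = {[]}"
  by (auto simp: dirs_def)

definition dcoef :: "'a::euclidean_space \<Rightarrow> 'a list \<Rightarrow> real" where
  "dcoef v bs = prod_list (map (\<lambda>b. v \<bullet> b) bs)"

lemma sum_dirs_Suc:
  fixes F :: "'a::euclidean_space list \<Rightarrow> real"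
  shows "(\<Sum>bs\<in>dirs (Suc j). F bs) = (\<Sum>bs\<in>dirs j. \<Sum>b\<in>Basis. F (b # bs))"
proof -
  have "(dirs (Suc j) :: 'a list set) = (\<lambda>(bs, b). b # bs) ` (dirs j \<times> Basis)"
    unfolding dirs_def by (rule lists_length_Suc_eq)
  then have "(\<Sum>bs\<in>dirs (Suc j). F bs) = (\<Sum>bs\<in>(\<lambda>(bs, b). b # bs) ` (dirs j \<times> Basis). F bs)"
    by (simp only:)
  also have "\<dots> = (\<Sum>(bs, b)\<in>dirs j \<times> Basis. F (b # bs))"
    by (subst sum.reindex) (auto simp: inj_on_def intro!: sum.cong)
  finally have "(\<Sum>bs\<in>dirs (Suc j). F bs) = (\<Sum>(bs, b)\<in>dirs j \<times> Basis. F (b # bs))" .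
  then show ?thesis by (simp add: sum.cartesian_product)
qed

lemma dcoef_bound: "bs \<in> dirs j \<Longrightarrow> \<bar>dcoef v bs\<bar> \<le> norm v ^ j"
proof (induction j arbitrary: bs)
  case 0 then show ?case by (simp add: dirs_def dcoef_def)
next
  case (Suc j)
  then obtain b cs where "bs = b # cs" "b \<in> Basis" "cs \<in> dirs j"
    by (cases bs) (auto simp: dirs_def)
  then show ?case using Suc.IH[of cs] Basis_le_norm[of b v]
    by (auto simp: dcoef_def abs_mult intro!: mult_mono)
qed

text \<open>The \<open>j\<close>-th derivative of \<open>f\<close> evaluated at \<open>j\<close>
  copies of \<open>v\<close>. Summing over ordered lists of directions makes the multinomial
  coefficients disappear and matches the lists in \<open>sobolev_norm\<close>.\<close>

definition dir_deriv :: "('a::euclidean_space \<Rightarrow> real) \<Rightarrow> 'a \<Rightarrow> nat \<Rightarrow> 'a \<Rightarrow> real" where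
  "dir_deriv f v j x = (\<Sum>bs\<in>dirs j. dcoef v bs * partials bs f x)"

text \<open>Differentiating along \<open>v\<close> puts one more direction in front of each list,
  which is the decomposition in \<open>sum_dirs_Suc\<close>.\<close>

lemma dir_deriv_has_vector_derivative:
  assumes "smooth f"
  shows "((\<lambda>s. dir_deriv f v j (a + s *\<^sub>R v)) has_vector_derivative dir_deriv f v (Suc j) (a + s *\<^sub>R v)) (at s within S)"
proof -
  have D: "((\<lambda>s. partials bs f (a + s *\<^sub>R v)) has_vector_derivative
      (\<Sum>b\<in>Basis. (v \<bullet> b) * partials (b # bs) f (a + s *\<^sub>R v))) (at s within S)"
    if "bs \<in> dirs j" for bs
  proof -
    let ?g = "partials bs f" and ?x = "a + s *\<^sub>R v"
    let ?G = "frechet_derivative ?g (at ?x)"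
    have df: "?g differentiable (at ?x)" using assms that by (auto simp: smooth_def dirs_def)
    then have "(?g has_derivative ?G) (at ?x)" by (simp add: frechet_derivative_works)
    then have 1: "(?g has_derivative ?G) (at ?x within (\<lambda>s. a + s *\<^sub>R v) ` S)"
      by (rule has_derivative_at_withinI)
    have lin: "linear ?G" using linear_frechet_derivative[OF df] .
    have "((\<lambda>s. a + s *\<^sub>R v) has_vector_derivative v) (at s within S)"
      by (auto intro!: derivative_eq_intros)
    from vector_derivative_diff_chain_within[OF this 1]
    have "((\<lambda>s. ?g (a + s *\<^sub>R v)) has_vector_derivative ?G v) (at s within S)" by (simp add: o_def)
    moreover have "?G v = ?G (\<Sum>b\<in>Basis. (v \<bullet> b) *\<^sub>R b)" by (simp add: euclidean_representation)
    moreover have "\<dots> = (\<Sum>b\<in>Basis. (v \<bullet> b) * ?G b)"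
      by (simp add: linear_sum[OF lin] linear_cmul[OF lin])
    ultimately show ?thesis by simp
  qed
  have "((\<lambda>s. dir_deriv f v j (a + s *\<^sub>R v)) has_vector_derivative
     (\<Sum>bs\<in>dirs j. dcoef v bs * (\<Sum>b\<in>Basis. (v \<bullet> b) * partials (b # bs) f (a + s *\<^sub>R v)))) (at s within S)"
    unfolding dir_deriv_def
    by (intro has_vector_derivative_sum has_vector_derivative_mult_right D)
  then show ?thesis
    by (simp add: dir_deriv_def sum_dirs_Suc sum_distrib_left dcoef_def mult_ac)
qed

lemma taylor_smooth:
  assumes f: "smooth f"
  shows "f (a + v) = (\<Sum>j<Suc k. dir_deriv f v j a / fact j)
      + (LINT s:{0..1}|lborel. (1 - s) ^ k / fact k * dir_deriv f v (Suc k) (a + s *\<^sub>R v))"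
proof -
  let ?D = "\<lambda>j s. dir_deriv f v j (a + s *\<^sub>R v)"
  let ?i = "\<lambda>s. ((1 - s) ^ (Suc k - 1) / fact (Suc k - 1)) *\<^sub>R ?D (Suc k) s"
  have D0: "?D 0 = (\<lambda>s. f (a + s *\<^sub>R v))" by (simp add: dir_deriv_def dirs_0 dcoef_def)
  have "(?i has_integral f (a + 1 *\<^sub>R v) - (\<Sum>i<Suc k. ((1-0) ^ i / fact i) *\<^sub>R ?D i 0)) {0..1}"
    by (rule Taylor_has_integral[where Df = ?D and f = "\<lambda>s. f (a + s *\<^sub>R v)", OF _ D0])
      (auto intro: dir_deriv_has_vector_derivative[OF f])
  moreover have "set_integrable lborel {0..1} ?i"
  proof -
    have "continuous_on {0..1} (?D (Suc k))"
      unfolding continuous_on_eq_continuous_within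
      using dir_deriv_has_vector_derivative[OF f, of v "Suc k" a _ "{0..1}"]
      by (auto intro: has_vector_derivative_continuous)
    then show ?thesis
      by (intro borel_integrable_atLeastAtMost' continuous_intros) auto
  qed
  then have "(?i has_integral (LINT s:{0..1}|lborel. ?i s)) {0..1}"
    by (simp only: set_borel_integral_eq_integral has_integral_integral[symmetric])
  ultimately have "f (a + 1 *\<^sub>R v) - (\<Sum>i<Suc k. ((1-0) ^ i / fact i) *\<^sub>R ?D i 0) = (LINT s:{0..1}|lborel. ?i s)"
    by (rule has_integral_unique)
  then show ?thesis by simp
qed

section \<open>Convolution estimates\<close>

definition conv :: "('a::euclidean_space \<Rightarrow> real) \<Rightarrow> ('a \<Rightarrow> real) \<Rightarrow> 'a \<Rightarrow> real" where
  "conv w f u = (LINT z|lborel. w z * f (u - z))"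

text \<open>The strict inequality makes the region open, so all derivatives vanish there along with
  \<open>f\<close>.\<close>

lemma partials_support:
  assumes "\<And>x. e < norm x \<Longrightarrow> f x = 0"
  shows "e < norm x \<Longrightarrow> partials bs f x = 0"
proof (induction bs arbitrary: x)
  case (Cons b bs)
  have op: "open {x::'a. e < norm x}" by (intro open_Collect_less continuous_intros)
  have "((\<lambda>_. 0) has_derivative (\<lambda>_. 0)) (at x)" by simp
  then have "(partials bs f has_derivative (\<lambda>_. 0)) (at x)"
    by (rule has_derivative_transform_within_open[OF _ op]) (use Cons in auto)
  from frechet_derivative_at[OF this] show ?case by (simp add: fun_eq_iff)
qed (use assms in simp)

lemma compact_support_integrable:
  fixes f :: "'a::euclidean_space \<Rightarrow> real"
  assumes "continuous_on UNIV f" "\<And>x. e < norm x \<Longrightarrow> f x = 0"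
  shows "integrable lborel f"
proof -
  have "integrable lborel (\<lambda>x. indicator (cball 0 e) x *\<^sub>R f x)"
    by (rule borel_integrable_compact[OF compact_cball continuous_on_subset[OF assms(1)]]) simp
  moreover have "(\<lambda>x. indicator (cball 0 e) x *\<^sub>R f x) = f"
    using assms(2) by (auto simp: indicator_def fun_eq_iff not_le)
  ultimately show ?thesis by simp
qed

lemma conv_integrable:
  fixes f :: "'a::euclidean_space \<Rightarrow> real"
  assumes w: "w \<in> sq_int lborel" and f: "continuous_on UNIV f" "\<And>x. e < norm x \<Longrightarrow> f x = 0"
  shows "integrable lborel (\<lambda>z. w z * f (u - z))"
proof -
  have c: "continuous_on UNIV (\<lambda>z. f (u - z))"
    by (rule continuous_on_compose2[OF f(1)]) (auto intro!: continuous_intros)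
  have s: "f (u - z) = 0" if "e + norm u < norm z" for z
    using that norm_triangle_ineq2[of z u] by (intro f(2)) (simp add: norm_minus_commute)
  have "integrable lborel (\<lambda>z. (f (u - z))\<^sup>2)"
    using s by (intro compact_support_integrable[of _ "e + norm u"] continuous_intros c) simp
  then have "(\<lambda>z. f (u - z)) \<in> sq_int lborel"
    using borel_measurable_continuous_onI[OF c] by (simp add: sq_int_def)
  then show ?thesis using w by (rule sq_int_mult_integrable[rotated])
qed

text \<open>For a function that is not integrable the left-hand side is 0 by convention, so the
  estimates for \<open>conv\<close> hold for merely measurable functions.\<close>

lemma LINT_sq_le:
  fixes f :: "'b \<Rightarrow> real"
  shows "ennreal ((LINT x|M. f x)\<^sup>2) \<le> (\<integral>\<^sup>+x. ennreal \<bar>f x\<bar> \<partial>M)\<^sup>2"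
proof (cases "integrable M f")
  case True
  have "ennreal ((LINT x|M. f x)\<^sup>2) = (ennreal \<bar>LINT x|M. f x\<bar>)\<^sup>2"
    by (simp add: ennreal_power)
  also have "\<dots> \<le> (\<integral>\<^sup>+x. ennreal \<bar>f x\<bar> \<partial>M)\<^sup>2"
    using integral_norm_bound_ennreal[OF True] by (intro power_mono) auto
  finally show ?thesis .
qed (simp add: not_integrable_integral_eq)

text \<open>Jensen's inequality for the probability density \<open>f (u - z)\<close>, obtained from
  Cauchy-Schwarz by splitting the density into two square roots.\<close>

lemma conv_sq_le:
  fixes f :: "'a::euclidean_space \<Rightarrow> real"
  assumes w: "w \<in> borel_measurable borel" and f: "f \<in> borel_measurable borel" "\<And>x. 0 \<le> f x"
    "(\<integral>\<^sup>+x. ennreal (f x) \<partial>lborel) = 1"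
  shows "ennreal ((conv w f u)\<^sup>2) \<le> (\<integral>\<^sup>+z. ennreal ((w z)\<^sup>2 * f (u - z)) \<partial>lborel)"
proof -
  note [measurable] = w f(1)
  have "(\<integral>\<^sup>+x. ennreal (f x) \<partial>lborel) = (\<integral>\<^sup>+z. ennreal (f (u + (-1) *\<^sub>R z)) \<partial>lborel)"
    by (subst nn_integral_affine[of _ "-1" u]) auto
  then have one: "(\<integral>\<^sup>+z. ennreal (f (u - z)) \<partial>lborel) = 1" using f(3) by simp
  have "ennreal ((conv w f u)\<^sup>2) \<le> (\<integral>\<^sup>+z. ennreal \<bar>w z * f (u - z)\<bar> \<partial>lborel)\<^sup>2"
    unfolding conv_def by (rule LINT_sq_le)
  also have "(\<integral>\<^sup>+z. ennreal \<bar>w z * f (u - z)\<bar> \<partial>lborel)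
      = (\<integral>\<^sup>+z. ennreal (\<bar>w z\<bar> * sqrt (f (u - z))) * ennreal (sqrt (f (u - z))) \<partial>lborel)"
    using f(2) by (intro nn_integral_cong) (simp add: ennreal_mult[symmetric] abs_mult)
  also have "\<dots>\<^sup>2 \<le> (\<integral>\<^sup>+z. (ennreal (\<bar>w z\<bar> * sqrt (f (u - z))))\<^sup>2 \<partial>lborel)
      * (\<integral>\<^sup>+z. (ennreal (sqrt (f (u - z))))\<^sup>2 \<partial>lborel)"
    by (rule Cauchy_Schwarz_nn_integral) measurable
  also have "\<dots> = (\<integral>\<^sup>+z. ennreal ((w z)\<^sup>2 * f (u - z)) \<partial>lborel)"
    using f(2) one by (simp add: ennreal_power power_mult_distrib)
  finally show ?thesis .
qed

text \<open>A local form of Young's inequality: after exchanging the integrals the one over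
  \<open>u\<close> is 1, and only \<open>z\<close> within distance \<open>e\<close> of the ball
  contribute.\<close>

lemma conv_sq_integral_le:
  fixes f :: "'a::euclidean_space \<Rightarrow> real"
  assumes w: "w \<in> borel_measurable borel" and f: "f \<in> borel_measurable borel" "\<And>x. 0 \<le> f x"
    "(\<integral>\<^sup>+x. ennreal (f x) \<partial>lborel) = 1" and supp: "\<And>x. e \<le> norm x \<Longrightarrow> f x = 0"
  shows "(\<integral>\<^sup>+u. ennreal ((conv w f u)\<^sup>2) * indicator (ball c r) u \<partial>lborel)
      \<le> (\<integral>\<^sup>+z. ennreal ((w z)\<^sup>2) * indicator (ball c (r + e)) z \<partial>lborel)"
proof -
  note [measurable] = w f(1)
  have [measurable]: "ball c (r + e) \<in> sets borel" "ball c r \<in> sets borel" by simp_all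
  have one: "(\<integral>\<^sup>+u. ennreal (f (u - z)) \<partial>lborel) = 1" for z
  proof -
    have "(\<integral>\<^sup>+x. ennreal (f x) \<partial>lborel) = (\<integral>\<^sup>+u. ennreal (f (- z + 1 *\<^sub>R u)) \<partial>lborel)"
      by (subst nn_integral_affine[of _ 1 "- z"]) auto
    then show ?thesis using f(3) by simp
  qed
  have "(\<integral>\<^sup>+u. ennreal ((conv w f u)\<^sup>2) * indicator (ball c r) u \<partial>lborel)
      \<le> (\<integral>\<^sup>+u. (\<integral>\<^sup>+z. ennreal ((w z)\<^sup>2 * f (u - z)) \<partial>lborel) * indicator (ball c r) u \<partial>lborel)"
    by (intro nn_integral_mono mult_right_mono conv_sq_le w f) auto
  also have "\<dots> \<le> (\<integral>\<^sup>+u. \<integral>\<^sup>+z. ennreal ((w z)\<^sup>2) * indicator (ball c (r + e)) z * ennreal (f (u - z)) \<partial>lborel \<partial>lborel)"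
  proof (rule nn_integral_mono)
    fix u
    show "(\<integral>\<^sup>+z. ennreal ((w z)\<^sup>2 * f (u - z)) \<partial>lborel) * indicator (ball c r) u
        \<le> (\<integral>\<^sup>+z. ennreal ((w z)\<^sup>2) * indicator (ball c (r + e)) z * ennreal (f (u - z)) \<partial>lborel)"
    proof (cases "u \<in> ball c r")
      case True
      have "ennreal ((w z)\<^sup>2 * f (u - z)) = ennreal ((w z)\<^sup>2) * indicator (ball c (r + e)) z * ennreal (f (u - z))" for z
      proof (cases "z \<in> ball c (r + e)")
        case False
        have "e \<le> norm (u - z)"
          using False True dist_triangle[of c z u] by (simp add: dist_norm)
        then show ?thesis using supp by simp
      qed (simp add: ennreal_mult f)
      then show ?thesis using True by simp
    qed simp
  qed
  also have "\<dots> = (\<integral>\<^sup>+z. \<integral>\<^sup>+u. ennreal ((w z)\<^sup>2) * indicator (ball c (r + e)) z * ennreal (f (u - z)) \<partial>lborel \<partial>lborel)"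
    by (rule lborel_pair.Fubini'[symmetric]) measurable
  also have "\<dots> = (\<integral>\<^sup>+z. ennreal ((w z)\<^sup>2) * indicator (ball c (r + e)) z \<partial>lborel)"
    by (subst nn_integral_cmult) (auto simp: one)
  finally show ?thesis .
qed

lemma conv_measurable:
  fixes f :: "'a::euclidean_space \<Rightarrow> real"
  assumes w: "w \<in> borel_measurable borel" and f: "f \<in> borel_measurable borel"
  shows "conv w f \<in> borel_measurable borel"
proof -
  note [measurable] = w f
  have "(\<lambda>u. LINT z|lborel. w z * f (u - z)) \<in> borel_measurable lborel"
    by measurable
  then show ?thesis by (simp add: conv_def[abs_def])
qed

text \<open>For \<open>s \<le> 1/2\<close> the substitution \<open>y \<mapsto> y + s (x - y)\<close> has Jacobian \<open>(1 - s)^d \<ge> 2^-d\<close>;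
  otherwise one substitutes in \<open>x\<close>.\<close>

lemma segment_average_le:
  fixes f :: "'a::euclidean_space \<Rightarrow> ennreal" and c :: 'a and r :: real
  assumes f: "f \<in> borel_measurable borel" and s: "0 \<le> s" "s \<le> 1"
  defines "B \<equiv> ball c r"
  shows "(\<integral>\<^sup>+y. \<integral>\<^sup>+x. f (y + s *\<^sub>R (x - y)) * indicator B x * indicator B y \<partial>lborel \<partial>lborel)
      \<le> 2 ^ DIM('a) * emeasure lborel B * (\<integral>\<^sup>+x. f x * indicator B x \<partial>lborel)"
proof -
  note [measurable] = f
  have B[measurable]: "B \<in> sets borel" by (simp add: B_def)
  let ?I = "\<integral>\<^sup>+x. f x * indicator B x \<partial>lborel"
  have conv: "a + t *\<^sub>R (b - a) \<in> B" if "a \<in> B" "b \<in> B" "0 \<le> t" "t \<le> 1" for a b and t :: real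
    using convexD_alt[OF convex_ball that(1,2)[unfolded B_def] that(3,4)] by (simp add: B_def algebra_simps)
  \<comment> \<open>Stated for a general \<open>t\<close>, because it is used with
    \<open>t = s\<close> and, after \<open>x\<close> and \<open>y\<close> have changed places, with
    \<open>t = 1 - s\<close>. Convexity keeps the point of the segment in \<open>B\<close>, which
    permits the indicator on the right.\<close>
  have half: "(\<integral>\<^sup>+x. f (y + t *\<^sub>R (x - y)) * indicator B x * indicator B y \<partial>lborel)
      \<le> 2 ^ DIM('a) * ?I * indicator B y" if t: "1/2 \<le> t" "t \<le> 1" for y and t :: real
  proof (cases "y \<in> B")
    case True
    have "(\<integral>\<^sup>+x. f (y + t *\<^sub>R (x - y)) * indicator B x * indicator B y \<partial>lborel)
        \<le> (\<integral>\<^sup>+x. f ((y - t *\<^sub>R y) + t *\<^sub>R x) * indicator B ((y - t *\<^sub>R y) + t *\<^sub>R x) \<partial>lborel)"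
    proof (rule nn_integral_mono)
      fix x
      have "y + t *\<^sub>R (x - y) = (y - t *\<^sub>R y) + t *\<^sub>R x" by (simp add: algebra_simps)
      then show "f (y + t *\<^sub>R (x - y)) * indicator B x * indicator B y
          \<le> f ((y - t *\<^sub>R y) + t *\<^sub>R x) * indicator B ((y - t *\<^sub>R y) + t *\<^sub>R x)"
        using conv[OF True, of x t] t by (cases "x \<in> B") (simp_all only:, simp_all add: indicator_def)
    qed
    also have "\<dots> = ennreal ((1 / t) ^ DIM('a)) * (ennreal (\<bar>t\<bar> ^ DIM('a))
        * (\<integral>\<^sup>+x. f ((y - t *\<^sub>R y) + t *\<^sub>R x) * indicator B ((y - t *\<^sub>R y) + t *\<^sub>R x) \<partial>lborel))"
      using t by (simp add: mult.assoc[symmetric] ennreal_mult[symmetric] power_mult_distrib[symmetric])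
    also have "ennreal (\<bar>t\<bar> ^ DIM('a))
        * (\<integral>\<^sup>+x. f ((y - t *\<^sub>R y) + t *\<^sub>R x) * indicator B ((y - t *\<^sub>R y) + t *\<^sub>R x) \<partial>lborel) = ?I"
      using t by (intro nn_integral_affine[symmetric]) auto
    also have "ennreal ((1 / t) ^ DIM('a)) \<le> ennreal (2 ^ DIM('a))"
      using t by (intro ennreal_leI power_mono) (auto simp: divide_le_eq)
    also have "ennreal (2 ^ DIM('a)) = 2 ^ DIM('a)" by (simp add: ennreal_power[symmetric])
    finally show ?thesis using True by (simp add: mult_right_mono)
  qed simp
  have total: "(\<integral>\<^sup>+y. 2 ^ DIM('a) * ?I * indicator B y \<partial>lborel) = 2 ^ DIM('a) * emeasure lborel B * ?I"
    by (subst nn_integral_cmult_indicator) (auto simp: mult_ac)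
  show ?thesis
  proof (cases "1/2 \<le> s")
    case True
    have "(\<integral>\<^sup>+y. \<integral>\<^sup>+x. f (y + s *\<^sub>R (x - y)) * indicator B x * indicator B y \<partial>lborel \<partial>lborel)
        \<le> (\<integral>\<^sup>+y. 2 ^ DIM('a) * ?I * indicator B y \<partial>lborel)"
      by (intro nn_integral_mono half True s)
    then show ?thesis by (simp only: total)
  next
    case False
    have "(\<integral>\<^sup>+y. \<integral>\<^sup>+x. f (y + s *\<^sub>R (x - y)) * indicator B x * indicator B y \<partial>lborel \<partial>lborel)
        = (\<integral>\<^sup>+x. \<integral>\<^sup>+y. f (y + s *\<^sub>R (x - y)) * indicator B x * indicator B y \<partial>lborel \<partial>lborel)"
      by (rule lborel_pair.Fubini') measurable
    also have "\<dots> = (\<integral>\<^sup>+x. \<integral>\<^sup>+y. f (x + (1 - s) *\<^sub>R (y - x)) * indicator B y * indicator B x \<partial>lborel \<partial>lborel)"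
      by (simp add: algebra_simps)
    also have "\<dots> \<le> (\<integral>\<^sup>+y. 2 ^ DIM('a) * ?I * indicator B y \<partial>lborel)"
      using False s by (intro nn_integral_mono half) auto
    finally show ?thesis by (simp only: total)
  qed
qed

section \<open>Taylor's formula and the Bramble-Hilbert estimate for mollified functions\<close>

lemma dir_deriv_continuous: "smooth f \<Longrightarrow> continuous_on S (dir_deriv f v j)"
proof -
  assume f: "smooth f"
  have "continuous_on S (\<lambda>x. \<Sum>bs\<in>dirs j. dcoef v bs * partials bs f x)"
    by (intro continuous_on_sum continuous_on_mult_left partials_continuous[OF f]) (simp add: dirs_def)
  then show ?thesis by (simp add: dir_deriv_def[abs_def])
qed

lemma dir_deriv_support:
  assumes "\<And>x. e < norm x \<Longrightarrow> f x = 0"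
  shows "e < norm x \<Longrightarrow> dir_deriv f v j x = 0"
  using partials_support[where f = f, OF assms] by (simp add: dir_deriv_def)

lemma conv_dir_deriv:
  assumes w: "w \<in> sq_int lborel" and f: "smooth f" "\<And>x. e < norm x \<Longrightarrow> f x = 0"
  shows "conv w (dir_deriv f v j) u = (\<Sum>bs\<in>dirs j. dcoef v bs * conv w (partials bs f) u)"
proof -
  have "integrable lborel (\<lambda>z. dcoef v bs * (w z * partials bs f (u - z)))" if "bs \<in> dirs j" for bs
    by (intro integrable_mult_right conv_integrable[OF w] partials_continuous[OF f(1)]
        partials_support[where f = f and e = e]) (use that f in \<open>auto simp: dirs_def\<close>)
  then have "(LINT z|lborel. (\<Sum>bs\<in>dirs j. dcoef v bs * (w z * partials bs f (u - z))))
      = (\<Sum>bs\<in>dirs j. LINT z|lborel. dcoef v bs * (w z * partials bs f (u - z)))"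
    by (rule Bochner_Integration.integral_sum)
  moreover have "w z * dir_deriv f v j (u - z) = (\<Sum>bs\<in>dirs j. dcoef v bs * (w z * partials bs f (u - z)))" for z
    by (simp add: dir_deriv_def sum_distrib_left mult.left_commute)
  ultimately show ?thesis by (simp add: conv_def)
qed

text \<open>Taylor's formula for \<open>f\<close> at \<open>y - z\<close> with increment
  \<open>v\<close>, multiplied by \<open>w z\<close> and integrated over \<open>z\<close>; Fubini
  moves the integral over the segment parameter outside. All derivatives act on
  \<open>f\<close>.\<close>

lemma mollified_taylor:
  fixes w :: "'a::euclidean_space \<Rightarrow> real" and x y :: 'a
  assumes w: "w \<in> sq_int lborel" and f: "smooth f" "\<And>x. e < norm x \<Longrightarrow> f x = 0"
  defines "v \<equiv> x - y"
  shows "conv w f x = (\<Sum>j<Suc k. conv w (dir_deriv f v j) y / fact j)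
      + (LINT s:{0..1}|lborel. (1 - s) ^ k / fact k * conv w (dir_deriv f v (Suc k)) (y + s *\<^sub>R v))"
proof -
  let ?D = "dir_deriv f v"
  define F where "F z s = indicator {0..1} s * (w z * ((1 - s) ^ k / fact k * ?D (Suc k) (y - z + s *\<^sub>R v)))"
    for z and s :: real
  have wb[measurable]: "w \<in> borel_measurable borel" using w by (simp add: sq_int_def)
  have Db[measurable]: "?D j \<in> borel_measurable borel" for j
    by (rule borel_measurable_continuous_onI[OF dir_deriv_continuous[OF f(1)]])
  have Ds: "?D j u = 0" if "e < norm u" for j u
    by (rule dir_deriv_support[where f = f and e = e]) (use f that in auto)
  have Di: "integrable lborel (\<lambda>z. w z * ?D j (u - z))" for j u
    by (rule conv_integrable[OF w dir_deriv_continuous[OF f(1)] Ds])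
  have Fm: "(\<lambda>p. F (fst p) (snd p)) \<in> borel_measurable (lborel \<Otimes>\<^sub>M lborel)"
    unfolding F_def by measurable
  obtain C where C: "\<And>u. \<bar>?D (Suc k) u\<bar> \<le> C" "C \<ge> 0"
  proof -
    have "bounded (?D (Suc k) ` cball 0 e)"
      by (intro compact_imp_bounded compact_continuous_image dir_deriv_continuous[OF f(1)] compact_cball)
    then obtain C where C: "\<forall>u\<in>cball 0 e. \<bar>?D (Suc k) u\<bar> \<le> C" by (auto simp: bounded_iff)
    have "\<bar>?D (Suc k) u\<bar> \<le> max C 0" for u
      using C Ds[of u "Suc k"] by (cases "e < norm u") (auto simp: le_max_iff_disj)
    then show ?thesis by (rule that) simp
  qed
  \<comment> \<open>Beyond this radius every point \<open>y - z + s v\<close> of the segment lies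
    outside the support of \<open>f\<close>. So \<open>a\<close>, the function \<open>w\<close> cut
    off at \<open>R\<close> and multiplied by a bound for the derivatives of \<open>f\<close>,
    dominates the joint integrand.\<close>
  define R where "R = norm y + norm v + e"
  define a where "a z = (\<bar>w z\<bar> * C) * indicator (cball 0 R) z" for z
  have ai: "integrable lborel a"
  proof -
    have "(\<lambda>z::'a. indicator (cball 0 R) z :: real) \<in> sq_int lborel"
    proof -
      have "(\<lambda>z::'a. (indicator (cball 0 R) z :: real)\<^sup>2) = indicator (cball 0 R)"
        by (auto simp: indicator_def)
      moreover have "integrable lborel (indicator (cball (0::'a) R) :: 'a \<Rightarrow> real)"
        using emeasure_lborel_cball_finite[of "0::'a" R] by (intro integrable_real_indicator) auto
      ultimately show ?thesis
        unfolding sq_int_def mem_Collect_eq using borel_measurable_integrable by metis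
    qed
    moreover have "(\<lambda>z. \<bar>w z\<bar>) \<in> sq_int lborel" using w by (simp add: sq_int_def)
    ultimately have "integrable lborel (\<lambda>z. C * (\<bar>w z\<bar> * indicator (cball 0 R) z))"
      by (intro integrable_mult_right sq_int_mult_integrable)
    then show ?thesis by (simp add: a_def[abs_def] mult_ac)
  qed
  have le: "\<bar>F z s\<bar> \<le> a z * indicator {0..1} s" for z s
  proof (cases "s \<in> {0..1}")
    case True
    have 1: "\<bar>(1 - s) ^ k / fact k\<bar> \<le> 1"
    proof -
      have "\<bar>(1 - s) ^ k\<bar> \<le> 1" using True by (simp add: power_abs power_le_one)
      also have "1 \<le> (fact k :: real)" by (rule fact_ge_1)
      finally show ?thesis by simp
    qed
    show ?thesis
    proof (cases "z \<in> cball 0 R")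
      case z: True
      have "\<bar>w z\<bar> * (\<bar>(1 - s) ^ k / fact k\<bar> * \<bar>?D (Suc k) (y - z + s *\<^sub>R v)\<bar>) \<le> \<bar>w z\<bar> * (1 * C)"
        by (intro mult_left_mono mult_mono 1 C) auto
      then show ?thesis using True z by (simp add: F_def a_def abs_mult)
    next
      case False
      have "norm (s *\<^sub>R v) \<le> norm v" using True by (simp add: mult_left_le_one_le)
      then have "e < norm (y - z + s *\<^sub>R v)"
        using False norm_triangle_ineq2[of z "y + s *\<^sub>R v"] norm_triangle_ineq[of y "s *\<^sub>R v"]
        by (simp add: R_def norm_minus_commute algebra_simps)
      then show ?thesis using False by (simp add: F_def a_def Ds)
    qed
  qed (simp add: F_def)
  have am[measurable]: "a \<in> borel_measurable borel" using borel_measurable_integrable[OF ai] by simp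
  have ii: "integrable lborel (\<lambda>s::real. indicator {0..1} s :: real)"
    by (simp add: integrable_real_indicator)
  have "integrable (lborel \<Otimes>\<^sub>M lborel) (\<lambda>p. a (fst p) * indicator {0..1::real} (snd p))"
  proof (rule lborel_pair.Fubini_integrable)
    show "(\<lambda>p. a (fst p) * indicator {0..1::real} (snd p)) \<in> borel_measurable (lborel \<Otimes>\<^sub>M lborel)"
      by measurable
    show "integrable lborel (\<lambda>z. LINT s|lborel. norm (a (fst (z, s)) * indicator {0..1::real} (snd (z, s))))"
      using ai by (simp add: abs_mult)
    show "AE z in lborel. integrable lborel (\<lambda>s. a (fst (z, s)) * indicator {0..1::real} (snd (z, s)))"
      using ii by simp
  qed
  then have Fi: "integrable (lborel \<Otimes>\<^sub>M lborel) (\<lambda>p. F (fst p) (snd p))"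
    by (rule Bochner_Integration.integrable_bound[OF _ Fm])
      (use le in \<open>auto intro!: AE_I2 order_trans[OF _ abs_ge_self]\<close>)
  then have Fi': "integrable (lborel \<Otimes>\<^sub>M lborel) (case_prod F)" by (simp add: case_prod_beta')
  have pt: "w z * f (x - z) = (\<Sum>j<Suc k. w z * ?D j (y - z) / fact j) + (LINT s|lborel. F z s)" for z
  proof -
    have "f (x - z) = f ((y - z) + v)" by (simp add: v_def)
    also have "\<dots> = (\<Sum>j<Suc k. ?D j (y - z) / fact j)
        + (LINT s:{0..1}|lborel. (1 - s) ^ k / fact k * ?D (Suc k) (y - z + s *\<^sub>R v))"
      by (rule taylor_smooth[OF f(1)])
    finally have "w z * f (x - z) = (\<Sum>j<Suc k. w z * ?D j (y - z) / fact j)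
        + w z * (LINT s|lborel. indicator {0..1} s * ((1 - s) ^ k / fact k * ?D (Suc k) (y - z + s *\<^sub>R v)))"
      by (simp add: distrib_left sum_distrib_left set_lebesgue_integral_def)
    also have "w z * (LINT s|lborel. indicator {0..1} s * ((1 - s) ^ k / fact k * ?D (Suc k) (y - z + s *\<^sub>R v)))
        = (LINT s|lborel. F z s)"
      unfolding integral_mult_right_zero[symmetric] F_def by (simp only: mult_ac)
    finally show ?thesis .
  qed
  have "conv w f x = (LINT z|lborel. (\<Sum>j<Suc k. w z * ?D j (y - z) / fact j) + (LINT s|lborel. F z s))"
    unfolding conv_def pt ..
  also have "\<dots> = (LINT z|lborel. (\<Sum>j<Suc k. w z * ?D j (y - z) / fact j)) + (LINT z|lborel. LINT s|lborel. F z s)"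
    by (intro Bochner_Integration.integral_add Bochner_Integration.integrable_sum integrable_divide
        lborel_pair.integrable_fst[OF Fi'] Di)
  also have "(LINT z|lborel. (\<Sum>j<Suc k. w z * ?D j (y - z) / fact j)) = (\<Sum>j<Suc k. conv w (?D j) y / fact j)"
  proof -
    have "(LINT z|lborel. (\<Sum>j<Suc k. w z * ?D j (y - z) / fact j)) = (\<Sum>j<Suc k. LINT z|lborel. w z * ?D j (y - z) / fact j)"
      by (intro Bochner_Integration.integral_sum integrable_divide Di)
    then show ?thesis by (simp add: conv_def)
  qed
  also have "(LINT z|lborel. LINT s|lborel. F z s) = (LINT s|lborel. LINT z|lborel. F z s)"
    by (rule lborel_pair.Fubini_integral[OF Fi', symmetric])
  also have "\<dots> = (LINT s:{0..1}|lborel. (1 - s) ^ k / fact k * conv w (?D (Suc k)) (y + s *\<^sub>R v))"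
  proof -
    have "(LINT z|lborel. F z s) = indicator {0..1} s *\<^sub>R ((1 - s) ^ k / fact k * conv w (?D (Suc k)) (y + s *\<^sub>R v))" for s
    proof -
      have "F z s = (indicator {0..1} s * ((1 - s) ^ k / fact k)) * (w z * ?D (Suc k) (y + s *\<^sub>R v - z))" for z
        by (simp add: F_def algebra_simps)
      then have "(LINT z|lborel. F z s) = (indicator {0..1} s * ((1 - s) ^ k / fact k)) * conv w (?D (Suc k)) (y + s *\<^sub>R v)"
        unfolding conv_def by (simp only: integral_mult_right_zero)
      then show ?thesis by simp
    qed
    then show ?thesis by (simp add: set_lebesgue_integral_def)
  qed
  finally show ?thesis .
qed

lemma dcoef_shift_poly: "bs \<in> dirs j \<Longrightarrow> (\<lambda>x. dcoef (x - y) bs) \<in> polys j"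
proof -
  assume "bs \<in> dirs j"
  moreover have "dcoef (x - y) bs = prod_list (map (\<lambda>(v, c). x \<bullet> v + c) (map (\<lambda>b. (b, - (y \<bullet> b))) bs))" for x
    by (simp add: dcoef_def inner_diff_left o_def)
  ultimately show ?thesis
    using polys_prod_list[of "map (\<lambda>b. (b, - (y \<bullet> b))) bs"] by (simp add: dirs_def)
qed

text \<open>The Taylor part is a polynomial in \<open>x\<close>, since each
  \<open>dcoef (x - y) bs\<close> is a product of affine factors. In the remainder
  \<open>weak\<close> replaces the derivatives of \<open>f\<close> by the functions
  \<open>g bs\<close>; Cauchy-Schwarz in \<open>s\<close> and in the finite sum does the
  rest.\<close>

lemma mollified_taylor_estimate:
  fixes w :: "'a::euclidean_space \<Rightarrow> real"
  assumes w: "w \<in> sq_int lborel" and f: "smooth f" "\<And>x. e < norm x \<Longrightarrow> f x = 0"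
    and g: "\<And>bs. bs \<in> dirs (Suc k) \<Longrightarrow> g bs \<in> borel_measurable borel"
    and weak: "\<And>bs u. bs \<in> dirs (Suc k) \<Longrightarrow> conv w (partials bs f) u = conv (g bs) f u"
  shows "\<exists>P\<in>polys k. \<forall>x. ennreal ((conv w f x - P x)\<^sup>2)
    \<le> ennreal (card (dirs (Suc k) :: 'a list set) * norm (x - y) ^ (2 * Suc k))
      * (\<integral>\<^sup>+s. (\<Sum>bs\<in>dirs (Suc k). ennreal ((conv (g bs) f (y + s *\<^sub>R (x - y)))\<^sup>2)) * indicator {0..1} s \<partial>lborel)"
proof -
  define P where "P x = (\<Sum>j<Suc k. conv w (dir_deriv f (x - y) j) y / fact j)" for x
  have "(\<lambda>x. \<Sum>j<Suc k. \<Sum>bs\<in>dirs j. (conv w (partials bs f) y / fact j) * dcoef (x - y) bs) \<in> polys k"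
    by (intro polys_sum polys_cmult polys_le[OF dcoef_shift_poly]) auto
  moreover have "P = (\<lambda>x. \<Sum>j<Suc k. \<Sum>bs\<in>dirs j. (conv w (partials bs f) y / fact j) * dcoef (x - y) bs)"
    using conv_dir_deriv[OF w f(1), of e] f(2)
    by (simp add: P_def fun_eq_iff sum_divide_distrib mult.commute)
  ultimately have P: "P \<in> polys k" by simp
  have fb[measurable]: "f \<in> borel_measurable borel"
    by (rule borel_measurable_continuous_onI[OF smooth_continuous[OF f(1)]])
  have est: "ennreal ((conv w f x - P x)\<^sup>2)
    \<le> ennreal (card (dirs (Suc k) :: 'a list set) * norm (x - y) ^ (2 * Suc k))
      * (\<integral>\<^sup>+s. (\<Sum>bs\<in>dirs (Suc k). ennreal ((conv (g bs) f (y + s *\<^sub>R (x - y)))\<^sup>2)) * indicator {0..1} s \<partial>lborel)" for x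
  proof -
    let ?v = "x - y" and ?I = "dirs (Suc k) :: 'a list set"
    let ?N = "card ?I * norm ?v ^ (2 * Suc k)"
    let ?H = "\<lambda>u. \<Sum>bs\<in>?I. (conv (g bs) f u)\<^sup>2"
    define A where "A s = (1 - s) ^ k / fact k * (\<Sum>bs\<in>?I. dcoef ?v bs * conv (g bs) f (y + s *\<^sub>R ?v))" for s
    have gm[measurable]: "bs \<in> ?I \<Longrightarrow> conv (g bs) f \<in> borel_measurable borel" for bs
      by (rule conv_measurable[OF g fb])
    have Am[measurable]: "A \<in> borel_measurable borel" unfolding A_def
      by (intro borel_measurable_times borel_measurable_sum measurable_compose[OF _ gm]) measurable
    have "conv w f x - P x = (LINT s:{0..1}|lborel. A s)"
      using mollified_taylor[OF w f(1), where e = e and x = x and y = y and k = k] f(2) conv_dir_deriv[OF w f(1), of e ?v "Suc k"] weak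
      by (simp add: P_def A_def)
    then have "ennreal ((conv w f x - P x)\<^sup>2) \<le> (\<integral>\<^sup>+s. ennreal \<bar>indicator {0..1} s *\<^sub>R A s\<bar> \<partial>lborel)\<^sup>2"
      unfolding set_lebesgue_integral_def using LINT_sq_le[of lborel "\<lambda>s. indicator {0..1} s *\<^sub>R A s"] by simp
    \<comment> \<open>The indicator is doubled so that Cauchy-Schwarz can use it as one factor,
      whose squared integral is the length 1 of the interval.\<close>
    also have "(\<integral>\<^sup>+s. ennreal \<bar>indicator {0..1} s *\<^sub>R A s\<bar> \<partial>lborel)
        = (\<integral>\<^sup>+s. indicator {0..1} s * ennreal \<bar>indicator {0..1} s * A s\<bar> \<partial>lborel)"
      by (intro nn_integral_cong) (simp add: indicator_def)
    also have "\<dots>\<^sup>2 \<le> (\<integral>\<^sup>+s. (indicator {0..1::real} s)\<^sup>2 \<partial>lborel) * (\<integral>\<^sup>+s. (ennreal \<bar>indicator {0..1} s * A s\<bar>)\<^sup>2 \<partial>lborel)"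
      by (rule Cauchy_Schwarz_nn_integral) measurable
    also have "(\<integral>\<^sup>+s. (indicator {0..1::real} s)\<^sup>2 \<partial>lborel) = (1 :: ennreal)"
    proof -
      have "(\<integral>\<^sup>+s. (indicator {0..1::real} s)\<^sup>2 \<partial>lborel) = (\<integral>\<^sup>+s. indicator {0..1::real} s \<partial>lborel)"
        by (intro nn_integral_cong) (simp add: indicator_def)
      then show ?thesis by simp
    qed
    also have "(\<integral>\<^sup>+s. (ennreal \<bar>indicator {0..1} s * A s\<bar>)\<^sup>2 \<partial>lborel)
        \<le> (\<integral>\<^sup>+s. ennreal ?N * (ennreal (?H (y + s *\<^sub>R ?v)) * indicator {0..1} s) \<partial>lborel)"
    proof (rule nn_integral_mono)
      fix s :: real
      show "(ennreal \<bar>indicator {0..1} s * A s\<bar>)\<^sup>2 \<le> ennreal ?N * (ennreal (?H (y + s *\<^sub>R ?v)) * indicator {0..1} s)"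
      proof (cases "s \<in> {0..1}")
        case True
        have "\<bar>(1 - s) ^ k / fact k\<bar> \<le> 1"
        proof -
          have "\<bar>(1 - s) ^ k\<bar> \<le> 1" using True by (simp add: power_abs power_le_one)
          also have "1 \<le> (fact k :: real)" by (rule fact_ge_1)
          finally show ?thesis by simp
        qed
        then have "((1 - s) ^ k / fact k)\<^sup>2 \<le> 1" by (simp add: abs_square_le_1)
        then have "(A s)\<^sup>2 \<le> 1 * (\<Sum>bs\<in>?I. dcoef ?v bs * conv (g bs) f (y + s *\<^sub>R ?v))\<^sup>2"
          unfolding A_def power_mult_distrib by (intro mult_right_mono) auto
        also have "\<dots> \<le> (\<Sum>bs\<in>?I. (dcoef ?v bs)\<^sup>2) * ?H (y + s *\<^sub>R ?v)"
          unfolding mult_1 by (rule Cauchy_Schwarz_ineq_sum)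
        also have "\<dots> \<le> ?N * ?H (y + s *\<^sub>R ?v)"
        proof (intro mult_right_mono sum_nonneg)
          have "(dcoef ?v bs)\<^sup>2 \<le> norm ?v ^ (2 * Suc k)" if "bs \<in> ?I" for bs
          proof -
            have "\<bar>dcoef ?v bs\<bar>\<^sup>2 \<le> (norm ?v ^ Suc k)\<^sup>2"
              using dcoef_bound[OF that, of ?v] by (intro power_mono) auto
            then show ?thesis unfolding power2_abs by (simp only: power_mult[symmetric] mult.commute)
          qed
          then show "(\<Sum>bs\<in>?I. (dcoef ?v bs)\<^sup>2) \<le> ?N"
            using sum_bounded_above[of ?I "\<lambda>bs. (dcoef ?v bs)\<^sup>2" "norm ?v ^ (2 * Suc k)"] by simp
        qed auto
        finally have "ennreal ((A s)\<^sup>2) \<le> ennreal (?N * ?H (y + s *\<^sub>R ?v))" by (rule ennreal_leI)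
        then show ?thesis using True
          by (simp add: ennreal_power ennreal_mult sum_nonneg)
      qed simp
    qed
    also have "\<dots> = ennreal ?N * (\<integral>\<^sup>+s. ennreal (?H (y + s *\<^sub>R ?v)) * indicator {0..1} s \<partial>lborel)"
    proof (rule nn_integral_cmult)
      have "(\<lambda>s. ?H (y + s *\<^sub>R ?v)) \<in> borel_measurable lborel"
        by (intro borel_measurable_sum borel_measurable_power measurable_compose[OF _ gm]) measurable
      then show "(\<lambda>s. ennreal (?H (y + s *\<^sub>R ?v)) * indicator {0..1} s) \<in> borel_measurable lborel"
        by measurable
    qed
    finally show ?thesis by (simp add: sum_ennreal)
  qed
  show ?thesis using P est by blast
qed

text \<open>\<open>A\<close> stands for any lower bound of the squared distances from
  \<open>conv w f\<close> to polynomials of degree at most \<open>k\<close>. Every base point in the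
  ball yields an upper bound for the same \<open>A\<close>, so these bounds may be averaged. The
  support radius \<open>e \<le> r\<close> enlarges the ball to at most \<open>2 * r\<close>.\<close>

lemma mollified_bramble_hilbert:
  fixes w :: "'a::euclidean_space \<Rightarrow> real" and c :: 'a and r e :: real and A :: ennreal
  assumes w: "w \<in> sq_int lborel" and f: "smooth f" "\<And>x. e \<le> norm x \<Longrightarrow> f x = 0" "\<And>x. 0 \<le> f x"
      "(\<integral>\<^sup>+x. ennreal (f x) \<partial>lborel) = 1"
    and r: "0 < r" "e \<le> r"
    and g: "\<And>bs. bs \<in> dirs (Suc k) \<Longrightarrow> g bs \<in> borel_measurable borel"
    and weak: "\<And>bs u. bs \<in> dirs (Suc k) \<Longrightarrow> conv w (partials bs f) u = conv (g bs) f u"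
    and A: "\<And>P. P \<in> polys k \<Longrightarrow> A \<le> (\<integral>\<^sup>+x. ennreal ((conv w f x - P x)\<^sup>2) * indicator (ball c r) x \<partial>lborel)"
  shows "A \<le> ennreal (card (dirs (Suc k) :: 'a list set) * (2 * r) ^ (2 * Suc k)) * 2 ^ DIM('a)
      * (\<Sum>bs\<in>dirs (Suc k). \<integral>\<^sup>+z. ennreal ((g bs z)\<^sup>2) * indicator (ball c (2 * r)) z \<partial>lborel)"
proof -
  define B where "B = ball c r"
  have B[measurable]: "B \<in> sets borel" by (simp add: B_def)
  let ?I = "dirs (Suc k) :: 'a list set"
  define \<kappa> where "\<kappa> = ennreal (card ?I * (2 * r) ^ (2 * Suc k))"
  define H where "H u = (\<Sum>bs\<in>?I. ennreal ((conv (g bs) f u)\<^sup>2))" for u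
  define J where "J = (\<Sum>bs\<in>?I. \<integral>\<^sup>+z. ennreal ((g bs z)\<^sup>2) * indicator (ball c (2 * r)) z \<partial>lborel)"
  have fb[measurable]: "f \<in> borel_measurable borel"
    by (rule borel_measurable_continuous_onI[OF smooth_continuous[OF f(1)]])
  have gm[measurable]: "bs \<in> ?I \<Longrightarrow> conv (g bs) f \<in> borel_measurable borel" for bs
    by (rule conv_measurable[OF g fb])
  have Hm[measurable]: "H \<in> borel_measurable borel"
    unfolding H_def by (intro borel_measurable_sum measurable_compose[OF borel_measurable_power[OF gm]]) auto
  define \<Phi> where "\<Phi> y x s = H (y + s *\<^sub>R (x - y)) * indicator B x * indicator B y * indicator {0..1} s" for y x and s :: real
  have HJ: "(\<integral>\<^sup>+u. H u * indicator B u \<partial>lborel) \<le> J"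
  proof -
    have "(\<integral>\<^sup>+u. H u * indicator B u \<partial>lborel) = (\<Sum>bs\<in>?I. \<integral>\<^sup>+u. ennreal ((conv (g bs) f u)\<^sup>2) * indicator B u \<partial>lborel)"
      unfolding H_def sum_distrib_right using gm B by (intro nn_integral_sum) simp
    also have "\<dots> \<le> J"
      unfolding J_def
    proof (rule sum_mono)
      fix bs assume bs: "bs \<in> ?I"
      have "(\<integral>\<^sup>+u. ennreal ((conv (g bs) f u)\<^sup>2) * indicator B u \<partial>lborel)
          \<le> (\<integral>\<^sup>+z. ennreal ((g bs z)\<^sup>2) * indicator (ball c (r + e)) z \<partial>lborel)"
        unfolding B_def by (rule conv_sq_integral_le[OF g[OF bs] fb f(3) f(4) f(2)])
      also have "\<dots> \<le> (\<integral>\<^sup>+z. ennreal ((g bs z)\<^sup>2) * indicator (ball c (2 * r)) z \<partial>lborel)"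
        using r by (intro nn_integral_mono mult_left_mono) (auto simp: indicator_def)
      finally show "(\<integral>\<^sup>+u. ennreal ((conv (g bs) f u)\<^sup>2) * indicator B u \<partial>lborel)
          \<le> (\<integral>\<^sup>+z. ennreal ((g bs z)\<^sup>2) * indicator (ball c (2 * r)) z \<partial>lborel)" .
    qed
    finally show ?thesis .
  qed
  have f0: "f x = 0" if "e < norm x" for x using f(2)[of x] that by simp
  \<comment> \<open>Each \<open>y\<close> uses its own Taylor polynomial; this is legitimate because
    \<open>A\<close> lies below the distance to every polynomial.\<close>
  have one: "A * indicator B y \<le> \<kappa> * (\<integral>\<^sup>+x. \<integral>\<^sup>+s. \<Phi> y x s \<partial>lborel \<partial>lborel)" for y
  proof (cases "y \<in> B")
    case True
    obtain P where P: "P \<in> polys k" and le: "\<forall>x. ennreal ((conv w f x - P x)\<^sup>2)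
        \<le> ennreal (card ?I * norm (x - y) ^ (2 * Suc k))
          * (\<integral>\<^sup>+s. (\<Sum>bs\<in>?I. ennreal ((conv (g bs) f (y + s *\<^sub>R (x - y)))\<^sup>2)) * indicator {0..1} s \<partial>lborel)"
      using mollified_taylor_estimate[OF w f(1) f0 g weak, where y = y] by (rule bexE)
    have "A \<le> (\<integral>\<^sup>+x. ennreal ((conv w f x - P x)\<^sup>2) * indicator B x \<partial>lborel)"
      unfolding B_def by (rule A[OF P])
    also have "\<dots> \<le> (\<integral>\<^sup>+x. \<kappa> * (\<integral>\<^sup>+s. \<Phi> y x s \<partial>lborel) \<partial>lborel)"
    proof (rule nn_integral_mono)
      fix x
      show "ennreal ((conv w f x - P x)\<^sup>2) * indicator B x \<le> \<kappa> * (\<integral>\<^sup>+s. \<Phi> y x s \<partial>lborel)"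
      proof (cases "x \<in> B")
        case x: True
        have "norm (x - y) \<le> 2 * r"
          using x True dist_triangle2[of x y c] by (simp add: B_def dist_norm norm_minus_commute)
        then have "card ?I * norm (x - y) ^ (2 * Suc k) \<le> card ?I * (2 * r) ^ (2 * Suc k)"
          by (intro mult_left_mono power_mono) auto
        then have "ennreal (card ?I * norm (x - y) ^ (2 * Suc k)) \<le> \<kappa>"
          unfolding \<kappa>_def by (rule ennreal_leI)
        then have "ennreal ((conv w f x - P x)\<^sup>2) \<le> \<kappa> * (\<integral>\<^sup>+s. H (y + s *\<^sub>R (x - y)) * indicator {0..1} s \<partial>lborel)"
          using order_trans[OF le[rule_format, of x] mult_right_mono] unfolding H_def by simp
        then show ?thesis using x True by (simp add: \<Phi>_def)
      qed simp
    qed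
    also have "\<dots> = \<kappa> * (\<integral>\<^sup>+x. \<integral>\<^sup>+s. \<Phi> y x s \<partial>lborel \<partial>lborel)"
      unfolding \<Phi>_def by (rule nn_integral_cmult) measurable
    finally show ?thesis using True by simp
  qed simp
  have vol: "emeasure lborel B \<noteq> 0" "emeasure lborel B \<noteq> \<infinity>"
  proof -
    show "emeasure lborel B \<noteq> \<infinity>" using emeasure_lborel_ball_finite[of c r] by (simp add: B_def)
    show "emeasure lborel B \<noteq> 0"
    proof
      assume "emeasure lborel B = 0"
      then have "B \<in> null_sets lborel" by (intro null_setsI) auto
      then have "B = {}"
        using open_not_negligible[of B] negligible_iff_null_sets null_sets_completionI by (auto simp: B_def)
      then show False using r by (simp add: B_def)
    qed
  qed
  \<comment> \<open>The parameter \<open>s\<close> is moved to the outermost place, because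
    \<open>segment_average_le\<close> is an estimate for fixed \<open>s\<close>.\<close>
  have "(\<integral>\<^sup>+y. \<integral>\<^sup>+x. \<integral>\<^sup>+s. \<Phi> y x s \<partial>lborel \<partial>lborel \<partial>lborel) = (\<integral>\<^sup>+y. \<integral>\<^sup>+s. \<integral>\<^sup>+x. \<Phi> y x s \<partial>lborel \<partial>lborel \<partial>lborel)"
    by (intro nn_integral_cong lborel_pair.Fubini') (unfold \<Phi>_def, measurable)
  also have "\<dots> = (\<integral>\<^sup>+s. \<integral>\<^sup>+y. \<integral>\<^sup>+x. \<Phi> y x s \<partial>lborel \<partial>lborel \<partial>lborel)"
    by (rule lborel_pair.Fubini') (unfold \<Phi>_def, measurable)
  also have "\<dots> \<le> (\<integral>\<^sup>+s. (2 ^ DIM('a) * emeasure lborel B * J) * indicator {0..1::real} s \<partial>lborel)"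
  proof (rule nn_integral_mono)
    fix s :: real
    show "(\<integral>\<^sup>+y. \<integral>\<^sup>+x. \<Phi> y x s \<partial>lborel \<partial>lborel) \<le> (2 ^ DIM('a) * emeasure lborel B * J) * indicator {0..1} s"
    proof (cases "s \<in> {0..1}")
      case True
      then have "(\<integral>\<^sup>+y. \<integral>\<^sup>+x. \<Phi> y x s \<partial>lborel \<partial>lborel)
          \<le> 2 ^ DIM('a) * emeasure lborel B * (\<integral>\<^sup>+u. H u * indicator B u \<partial>lborel)"
        using segment_average_le[OF Hm, of s c r] by (simp add: \<Phi>_def B_def)
      also have "\<dots> \<le> 2 ^ DIM('a) * emeasure lborel B * J" by (intro mult_left_mono HJ) simp
      finally show ?thesis using True by simp
    qed (simp add: \<Phi>_def)
  qed
  also have "\<dots> = 2 ^ DIM('a) * emeasure lborel B * J"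
    by (subst nn_integral_cmult_indicator) auto
  finally have tot: "(\<integral>\<^sup>+y. \<integral>\<^sup>+x. \<integral>\<^sup>+s. \<Phi> y x s \<partial>lborel \<partial>lborel \<partial>lborel) \<le> 2 ^ DIM('a) * emeasure lborel B * J" .
  \<comment> \<open>Integrating the left-hand side over the base point produces the volume of
    \<open>B\<close>; the averaged remainder carries the same factor, which cancels.\<close>
  have "A * emeasure lborel B = (\<integral>\<^sup>+y. A * indicator B y \<partial>lborel)"
    by (rule nn_integral_cmult_indicator[symmetric]) simp
  also have "\<dots> \<le> (\<integral>\<^sup>+y. \<kappa> * (\<integral>\<^sup>+x. \<integral>\<^sup>+s. \<Phi> y x s \<partial>lborel \<partial>lborel) \<partial>lborel)"
    by (intro nn_integral_mono one)
  also have "\<dots> = \<kappa> * (\<integral>\<^sup>+y. \<integral>\<^sup>+x. \<integral>\<^sup>+s. \<Phi> y x s \<partial>lborel \<partial>lborel \<partial>lborel)"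
    unfolding \<Phi>_def by (rule nn_integral_cmult) measurable
  also have "\<dots> \<le> \<kappa> * (2 ^ DIM('a) * emeasure lborel B * J)" by (intro mult_left_mono tot) simp
  finally have "A * emeasure lborel B \<le> (\<kappa> * 2 ^ DIM('a) * J) * emeasure lborel B"
    by (simp add: mult_ac)
  then have "A \<le> \<kappa> * 2 ^ DIM('a) * J"
    using vol by (simp add: ennreal_mult_le_mult_iff mult.commute[of _ "emeasure lborel B"])
  then show ?thesis unfolding \<kappa>_def J_def .
qed

section \<open>Mollification converges in L2\<close>

definition clamp_real :: "real \<Rightarrow> real \<Rightarrow> real" where
  "clamp_real n t = max (- n) (min n t)"

text \<open>First \<open>w\<close> is truncated at height \<open>n\<close>, with its square as
  dominating function; then continuous functions converging to \<open>w\<close> almost everywhere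
  are truncated at the same height, which makes a constant on the ball dominate. Each error is below
  \<open>\<eta> / 4\<close>, as the square of a sum costs a factor 2 for each of the two
  terms.\<close>

lemma L2_approx_continuous:
  fixes w :: "'a::euclidean_space \<Rightarrow> real"
  assumes w: "w \<in> sq_int lborel" and "0 < \<eta>"
  shows "\<exists>g. continuous_on UNIV g \<and>
    (\<integral>\<^sup>+z. ennreal ((w z - g z)\<^sup>2) * indicator (ball c R) z \<partial>lborel) \<le> ennreal \<eta>"
proof -
  have wb[measurable]: "w \<in> borel_measurable borel" and wi: "integrable lborel (\<lambda>z. (w z)\<^sup>2)"
    using w by (auto simp: sq_int_def)
  have "(\<lambda>n. LINT z|lborel. (w z - clamp_real (real n) (w z))\<^sup>2) \<longlonglongrightarrow> (LINT z|(lborel :: 'a measure). (0::real))"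
  proof (rule integral_dominated_convergence[where w = "\<lambda>z. (w z)\<^sup>2"])
    show "AE z in lborel. (\<lambda>n. (w z - clamp_real (real n) (w z))\<^sup>2) \<longlonglongrightarrow> 0"
    proof (rule AE_I2)
      fix z
      obtain N :: nat where N: "\<bar>w z\<bar> \<le> N" using real_arch_simple by blast
      show "(\<lambda>n. (w z - clamp_real (real n) (w z))\<^sup>2) \<longlonglongrightarrow> 0"
      proof (rule tendsto_eventually, rule eventually_sequentiallyI)
        fix n assume "N \<le> n"
        then have "\<bar>w z\<bar> \<le> real n" using N by linarith
        then show "(w z - clamp_real (real n) (w z))\<^sup>2 = 0" by (simp add: clamp_real_def)
      qed
    qed
    show "AE z in lborel. norm ((w z - clamp_real (real n) (w z))\<^sup>2) \<le> (w z)\<^sup>2" for n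
    proof (rule AE_I2)
      fix z
      have "\<bar>w z - clamp_real (real n) (w z)\<bar> \<le> \<bar>w z\<bar>" by (auto simp: clamp_real_def)
      then show "norm ((w z - clamp_real (real n) (w z))\<^sup>2) \<le> (w z)\<^sup>2" by (simp add: abs_le_square_iff)
    qed
  qed (use wi in \<open>auto simp: clamp_real_def\<close>)
  then have "\<forall>\<^sub>F n in sequentially. (LINT z|lborel. (w z - clamp_real (real n) (w z))\<^sup>2) < \<eta> / 4"
    by (rule order_tendstoD) (use assms(2) in simp)
  then obtain n :: nat where n: "(LINT z|lborel. (w z - clamp_real (real n) (w z))\<^sup>2) < \<eta> / 4"
    by (auto simp: eventually_sequentially)
  have ni: "integrable lborel (\<lambda>z. (w z - clamp_real (real n) (w z))\<^sup>2)"
  proof (rule Bochner_Integration.integrable_bound[OF wi])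
    show "AE z in lborel. norm ((w z - clamp_real (real n) (w z))\<^sup>2) \<le> norm ((w z)\<^sup>2)"
    proof (rule AE_I2)
      fix z
      have "\<bar>w z - clamp_real (real n) (w z)\<bar> \<le> \<bar>w z\<bar>" by (auto simp: clamp_real_def)
      then show "norm ((w z - clamp_real (real n) (w z))\<^sup>2) \<le> norm ((w z)\<^sup>2)" by (simp add: abs_le_square_iff)
    qed
  qed (auto simp: clamp_real_def)
  have "w \<in> borel_measurable lebesgue" by (rule measurable_completion) (use wb in simp)
  then have "w measurable_on UNIV" by (intro lebesgue_measurable_imp_measurable_on_real) simp_all
  then obtain N g where N: "negligible N" and gc: "\<And>j. continuous_on UNIV (g j)"
    and gl: "\<And>x. x \<notin> N \<Longrightarrow> (\<lambda>j. g j x) \<longlonglongrightarrow> w x"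
    unfolding measurable_on_def by auto
  have gb[measurable]: "g j \<in> borel_measurable borel" for j by (rule borel_measurable_continuous_onI[OF gc])
  let ?b = "\<lambda>z. (2 * real n)\<^sup>2 * indicator (ball c R) z :: real"
  let ?d = "\<lambda>j z. (clamp_real n (w z) - clamp_real n (g j z))\<^sup>2 * indicator (ball c R) z"
  have Bm[measurable]: "ball c R \<in> sets borel" by simp
  have dle: "norm (?d j z) \<le> ?b z" for j z
  proof -
    have "\<bar>clamp_real n (w z) - clamp_real n (g j z)\<bar> \<le> \<bar>2 * real n\<bar>" by (auto simp: clamp_real_def)
    then have "(clamp_real n (w z) - clamp_real n (g j z))\<^sup>2 \<le> (2 * real n)\<^sup>2"
      unfolding abs_le_square_iff .
    then show ?thesis by (simp add: indicator_def)
  qed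
  have bi: "integrable lborel ?b"
    using emeasure_lborel_ball_finite[of c R]
    by (intro integrable_mult_right integrable_real_indicator) auto
  have dm: "?d j \<in> borel_measurable lborel" for j unfolding clamp_real_def by measurable
  have "(\<lambda>j. LINT z|lborel. ?d j z) \<longlonglongrightarrow> (LINT z|(lborel :: 'a measure). (0::real))"
  proof (rule integral_dominated_convergence[OF _ dm bi])
    have "AE z in lebesgue. z \<notin> N" using N by (simp add: AE_not_in negligible_iff_null_sets)
    then have "AE z in lborel. z \<notin> N" by (simp add: AE_completion_iff)
    then show "AE z in lborel. (\<lambda>j. ?d j z) \<longlonglongrightarrow> 0"
    proof eventually_elim
      case (elim z)
      have "(\<lambda>j. ?d j z) \<longlonglongrightarrow> (clamp_real n (w z) - clamp_real n (w z))\<^sup>2 * indicator (ball c R) z"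
        unfolding clamp_real_def by (intro tendsto_intros gl[OF elim])
      then show ?case by simp
    qed
    show "AE z in lborel. norm (?d j z) \<le> ?b z" for j by (rule AE_I2) (rule dle)
  qed simp
  then have "\<forall>\<^sub>F j in sequentially. (LINT z|lborel. ?d j z) < \<eta> / 4"
    by (rule order_tendstoD) (use assms(2) in simp)
  then obtain j :: nat where j: "(LINT z|lborel. ?d j z) < \<eta> / 4"
    by (auto simp: eventually_sequentially)
  have di: "integrable lborel (?d j)"
    by (rule Bochner_Integration.integrable_bound[OF bi dm], rule AE_I2)
      (rule order_trans[OF dle], simp)
  let ?G = "\<lambda>z. clamp_real n (g j z)"
  have "continuous_on UNIV ?G" unfolding clamp_real_def by (intro continuous_intros gc)
  moreover have "(\<integral>\<^sup>+z. ennreal ((w z - ?G z)\<^sup>2) * indicator (ball c R) z \<partial>lborel) \<le> ennreal \<eta>"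
  proof -
    have "(\<integral>\<^sup>+z. ennreal ((w z - ?G z)\<^sup>2) * indicator (ball c R) z \<partial>lborel)
        \<le> (\<integral>\<^sup>+z. ennreal (2 * (w z - clamp_real (real n) (w z))\<^sup>2 + 2 * ?d j z) \<partial>lborel)"
    proof (rule nn_integral_mono)
      fix z
      have "(w z - ?G z)\<^sup>2 \<le> 2 * (w z - clamp_real n (w z))\<^sup>2 + 2 * (clamp_real n (w z) - ?G z)\<^sup>2"
        using sum_squares_bound[of "w z - clamp_real n (w z)" "clamp_real n (w z) - ?G z"]
        by (simp add: power2_eq_square algebra_simps)
      then show "ennreal ((w z - ?G z)\<^sup>2) * indicator (ball c R) z
          \<le> ennreal (2 * (w z - clamp_real (real n) (w z))\<^sup>2 + 2 * ?d j z)"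
        by (simp add: indicator_def ennreal_leI del: ennreal_plus)
    qed
    also have "\<dots> = ennreal (LINT z|lborel. 2 * (w z - clamp_real (real n) (w z))\<^sup>2 + 2 * ?d j z)"
      by (rule nn_integral_eq_integral) (use ni di in auto)
    also have "\<dots> \<le> ennreal \<eta>"
      using n j ni di by (intro ennreal_leI) simp
    finally show ?thesis .
  qed
  ultimately show ?thesis by blast
qed

text \<open>Three errors, for a continuous \<open>g\<close> near \<open>w\<close>: that of
  \<open>g\<close> itself, the mollification error of \<open>g\<close>, small by uniform continuity,
  and the mollified difference, no larger than the first by \<open>conv_sq_integral_le\<close>. The
  square of the sum costs a factor 3, hence the tolerance \<open>\<eta> / 9\<close> for
  each.\<close>

lemma mollifier_approximates:
  fixes w :: "'a::euclidean_space \<Rightarrow> real"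
  assumes w: "w \<in> sq_int lborel" and r: "0 < r" and \<eta>: "0 < \<eta>"
  shows "\<exists>f e. smooth f \<and> 0 < e \<and> e \<le> r \<and> (\<forall>x. 0 \<le> f x) \<and> (\<forall>x. e \<le> norm x \<longrightarrow> f x = 0) \<and>
    (\<integral>\<^sup>+x. ennreal (f x) \<partial>lborel) = 1 \<and>
    (\<integral>\<^sup>+x. ennreal ((w x - conv w f x)\<^sup>2) * indicator (ball c r) x \<partial>lborel) \<le> ennreal \<eta>"
proof -
  have wb[measurable]: "w \<in> borel_measurable borel" using w by (auto simp: sq_int_def)
  obtain g where g: "continuous_on UNIV g \<and>
    (\<integral>\<^sup>+z. ennreal ((w z - g z)\<^sup>2) * indicator (ball c (2 * r)) z \<partial>lborel) \<le> ennreal (\<eta> / 9)"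
    using L2_approx_continuous[OF w, of "\<eta> / 9" c "2 * r"] \<eta> by auto
  then have gc: "continuous_on UNIV g" by simp
  have gb[measurable]: "g \<in> borel_measurable borel" by (rule borel_measurable_continuous_onI[OF gc])
  define V where "V = measure lborel (ball c r)"
  have V: "V \<ge> 0" by (simp add: V_def)
  \<comment> \<open>A pointwise squared error \<open>\<delta>\<close> contributes
    \<open>\<delta> * V\<close> on the ball, which is at most \<open>\<eta> / 9\<close>; the added 1
    guards against a vanishing denominator.\<close>
  define \<delta> where "\<delta> = \<eta> / (9 * (V + 1))"
  have \<delta>: "\<delta> > 0" using \<eta> V by (simp add: \<delta>_def)
  have "uniformly_continuous_on (cball c (2 * r)) g"
    by (intro compact_uniformly_continuous continuous_on_subset[OF gc] compact_cball) simp
  then obtain d where d: "d > 0" and ud: "\<And>x y. x \<in> cball c (2 * r) \<Longrightarrow> y \<in> cball c (2 * r) \<Longrightarrow> dist y x < d \<Longrightarrow> dist (g y) (g x) < sqrt \<delta>"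
    unfolding uniformly_continuous_on_def using \<delta> by (metis real_sqrt_gt_0_iff)
  \<comment> \<open>Distance \<open>d\<close> for uniform continuity, and \<open>r\<close> so that
    points near the ball stay in the ball of radius \<open>2 * r\<close> on which \<open>g\<close>
    is controlled.\<close>
  define e where "e = min d r"
  have e: "e > 0" "e \<le> r" using d r by (auto simp: e_def)
  obtain f :: "'a \<Rightarrow> real" where f: "smooth f" "\<And>x. 0 \<le> f x" "\<And>x. e \<le> norm x \<Longrightarrow> f x = 0"
    "(\<integral>\<^sup>+x. ennreal (f x) \<partial>lborel) = 1"
    using mollifier_exists[OF e(1)] by metis
  have fb[measurable]: "f \<in> borel_measurable borel"
    by (rule borel_measurable_continuous_onI[OF smooth_continuous[OF f(1)]])
  have Bm[measurable]: "ball c r \<in> sets borel" "ball c (2 * r) \<in> sets borel" by simp_all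
  have fu: "continuous_on UNIV (\<lambda>z. f (u - z))" for u
    by (rule continuous_on_compose2[OF smooth_continuous[OF f(1)]]) (auto intro!: continuous_intros)
  have fs: "f (u - z) = 0" if "e + norm u < norm z" for u z
    using that norm_triangle_ineq2[of z u] by (intro f(3)) (simp add: norm_minus_commute)
  have fi: "integrable lborel (\<lambda>z. h z * f (u - z))" if "continuous_on UNIV h" for h u
    by (rule compact_support_integrable[of _ "e + norm u"])
      (auto intro!: continuous_intros that fu simp: fs)
  have one: "(LINT z|lborel. f (u - z)) = 1" for u
  proof -
    have "(\<integral>\<^sup>+x. ennreal (f x) \<partial>lborel) = (\<integral>\<^sup>+z. ennreal (f (u + (-1) *\<^sub>R z)) \<partial>lborel)"
      by (subst nn_integral_affine[of _ "-1" u]) auto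
    then have "(\<integral>\<^sup>+z. ennreal (f (u - z)) \<partial>lborel) = 1" using f(4) by simp
    then show ?thesis
      using f(2) by (subst integral_eq_nn_integral) auto
  qed
  have wi: "integrable lborel (\<lambda>z. w z * f (u - z))" for u
    by (rule conv_integrable[OF w smooth_continuous[OF f(1)], of e]) (use f(3) in auto)
  have split: "w u - conv w f u = (w u - g u) + conv (\<lambda>z. g u - g z) f u - conv (\<lambda>z. w z - g z) f u" for u
  proof -
    have "conv (\<lambda>z. w z - g z) f u = conv w f u - conv g f u"
      using wi[of u] fi[OF gc, of u] by (simp add: conv_def left_diff_distrib)
    moreover have "conv (\<lambda>z. g u - g z) f u = g u - conv g f u"
      using fi[OF gc, of u] fi[of "\<lambda>_. g u" u] one[of u] by (simp add: conv_def left_diff_distrib)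
    ultimately show ?thesis by simp
  qed
  have mid: "ennreal ((conv (\<lambda>z. g u - g z) f u)\<^sup>2) \<le> ennreal \<delta>" if u: "u \<in> ball c r" for u
  proof -
    have "ennreal ((conv (\<lambda>z. g u - g z) f u)\<^sup>2) \<le> (\<integral>\<^sup>+z. ennreal ((g u - g z)\<^sup>2 * f (u - z)) \<partial>lborel)"
      by (rule conv_sq_le[OF _ fb f(2) f(4)]) measurable
    also have "\<dots> \<le> (\<integral>\<^sup>+z. ennreal (\<delta> * f (u - z)) \<partial>lborel)"
    proof (intro nn_integral_mono ennreal_leI)
      fix z
      show "(g u - g z)\<^sup>2 * f (u - z) \<le> \<delta> * f (u - z)"
      proof (cases "e \<le> norm (u - z)")
        case False
        have "z \<in> cball c (2 * r)" "u \<in> cball c (2 * r)"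
          using u False e(2) r dist_triangle[of c z u] by (auto simp: dist_norm)
        moreover have "dist u z < d" using False by (simp add: e_def dist_norm)
        ultimately have "dist (g u) (g z) < sqrt \<delta>" by (intro ud)
        then have "\<bar>g u - g z\<bar>\<^sup>2 \<le> (sqrt \<delta>)\<^sup>2" by (intro power_mono) (auto simp: dist_real_def)
        then show ?thesis using \<delta> f(2) by (intro mult_right_mono) auto
      qed (simp add: f(3))
    qed
    also have "\<dots> = ennreal (LINT z|lborel. \<delta> * f (u - z))"
      by (rule nn_integral_eq_integral) (use \<delta> f(2) fi[of "\<lambda>_. \<delta>" u] in auto)
    also have "\<dots> = ennreal \<delta>" by (simp add: one)
    finally show ?thesis .
  qed
  have cm[measurable]: "conv (\<lambda>z. w z - g z) f \<in> borel_measurable borel"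
    by (rule conv_measurable[OF _ fb]) measurable
  have "(\<integral>\<^sup>+x. ennreal ((w x - conv w f x)\<^sup>2) * indicator (ball c r) x \<partial>lborel)
    \<le> (\<integral>\<^sup>+x. 3 * (ennreal ((w x - g x)\<^sup>2) * indicator (ball c (2 * r)) x)
        + (3 * (ennreal \<delta> * indicator (ball c r) x)
        + 3 * (ennreal ((conv (\<lambda>z. w z - g z) f x)\<^sup>2) * indicator (ball c r) x)) \<partial>lborel)"
  proof (rule nn_integral_mono)
    fix x
    let ?a = "w x - g x" and ?b = "conv (\<lambda>z. g x - g z) f x" and ?d = "conv (\<lambda>z. w z - g z) f x"
    show "ennreal ((w x - conv w f x)\<^sup>2) * indicator (ball c r) x
      \<le> 3 * (ennreal (?a\<^sup>2) * indicator (ball c (2 * r)) x)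
        + (3 * (ennreal \<delta> * indicator (ball c r) x) + 3 * (ennreal (?d\<^sup>2) * indicator (ball c r) x))"
    proof (cases "x \<in> ball c r")
      case True
      have "(?a + ?b - ?d)\<^sup>2 \<le> 3 * ?a\<^sup>2 + (3 * ?b\<^sup>2 + 3 * ?d\<^sup>2)"
        using zero_le_power2[of "?a - ?b"] zero_le_power2[of "?a + ?d"] zero_le_power2[of "?b + ?d"]
        by (simp add: power2_eq_square algebra_simps)
      then have "(w x - conv w f x)\<^sup>2 \<le> 3 * ?a\<^sup>2 + (3 * ?b\<^sup>2 + 3 * ?d\<^sup>2)"
        unfolding split[of x] .
      then have "ennreal ((w x - conv w f x)\<^sup>2) \<le> ennreal (3 * ?a\<^sup>2 + (3 * ?b\<^sup>2 + 3 * ?d\<^sup>2))"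
        by (rule ennreal_leI)
      also have "\<dots> = 3 * ennreal (?a\<^sup>2) + (3 * ennreal (?b\<^sup>2) + 3 * ennreal (?d\<^sup>2))"
        by (simp add: ennreal_plus ennreal_mult)
      also have "\<dots> \<le> 3 * ennreal (?a\<^sup>2) + (3 * ennreal \<delta> + 3 * ennreal (?d\<^sup>2))"
        by (intro add_mono mult_left_mono mid True) auto
      finally show ?thesis using True r by (simp add: indicator_def)
    qed simp
  qed
  also have "\<dots> = 3 * (\<integral>\<^sup>+x. ennreal ((w x - g x)\<^sup>2) * indicator (ball c (2 * r)) x \<partial>lborel)
      + (3 * (\<integral>\<^sup>+x. ennreal \<delta> * indicator (ball c r) x \<partial>lborel)
      + 3 * (\<integral>\<^sup>+x. ennreal ((conv (\<lambda>z. w z - g z) f x)\<^sup>2) * indicator (ball c r) x \<partial>lborel))"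
    by (simp add: nn_integral_add nn_integral_cmult)
  also have "\<dots> \<le> 3 * ennreal (\<eta> / 9) + (3 * ennreal (\<eta> / 9) + 3 * ennreal (\<eta> / 9))"
  proof (intro add_mono mult_left_mono)
    show "(\<integral>\<^sup>+x. ennreal ((w x - g x)\<^sup>2) * indicator (ball c (2 * r)) x \<partial>lborel) \<le> ennreal (\<eta> / 9)"
      using g by simp
    have "(\<integral>\<^sup>+x. ennreal ((conv (\<lambda>z. w z - g z) f x)\<^sup>2) * indicator (ball c r) x \<partial>lborel)
      \<le> (\<integral>\<^sup>+z. ennreal ((w z - g z)\<^sup>2) * indicator (ball c (r + e)) z \<partial>lborel)"
      by (rule conv_sq_integral_le[OF _ fb f(2) f(4) f(3)]) measurable
    also have "\<dots> \<le> (\<integral>\<^sup>+z. ennreal ((w z - g z)\<^sup>2) * indicator (ball c (2 * r)) z \<partial>lborel)"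
      using e by (intro nn_integral_mono mult_left_mono) (auto simp: indicator_def)
    also have "\<dots> \<le> ennreal (\<eta> / 9)" using g by simp
    finally show "(\<integral>\<^sup>+x. ennreal ((conv (\<lambda>z. w z - g z) f x)\<^sup>2) * indicator (ball c r) x \<partial>lborel) \<le> ennreal (\<eta> / 9)" .
    have "(\<integral>\<^sup>+x. ennreal \<delta> * indicator (ball c r) x \<partial>lborel) = ennreal \<delta> * emeasure lborel (ball c r)"
      by (rule nn_integral_cmult_indicator) simp
    also have "emeasure lborel (ball c r) = ennreal V"
      unfolding V_def using emeasure_lborel_ball_finite[of c r] by (intro emeasure_eq_ennreal_measure) auto
    also have "ennreal \<delta> * ennreal V = ennreal (\<delta> * V)" using \<delta> V by (simp add: ennreal_mult)
    also have "\<dots> \<le> ennreal (\<eta> / 9)"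
      using V \<eta> by (intro ennreal_leI) (simp add: \<delta>_def field_simps)
    finally show "(\<integral>\<^sup>+x. ennreal \<delta> * indicator (ball c r) x \<partial>lborel) \<le> ennreal (\<eta> / 9)" .
  qed auto
  also have "\<dots> = ennreal \<eta>"
  proof -
    have "3 * ennreal (\<eta> / 9) = ennreal (3 * (\<eta> / 9))" using \<eta> by (subst ennreal_mult) auto
    then show ?thesis using \<eta> by (simp add: ennreal_plus[symmetric] del: ennreal_plus)
  qed
  finally show ?thesis using f e by (intro exI[of _ f] exI[of _ e]) auto
qed

section \<open>From Lebesgue functions and weak derivatives to Borel integrals\<close>

lemma L2_norm_sq_nn_integral:
  fixes v w :: "'a::euclidean_space \<Rightarrow> real"
  assumes v: "v \<in> L2 T" and T: "T \<in> sets borel" and w: "w \<in> borel_measurable borel"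
    and eq: "AE x in lborel. v x = w x"
  shows "ennreal ((L2_norm T v)\<^sup>2) = (\<integral>\<^sup>+x. ennreal ((w x)\<^sup>2) * indicator T x \<partial>lborel)"
proof -
  have int: "integrable lebesgue (\<lambda>x. indicator T x *\<^sub>R (v x)\<^sup>2)"
    using v by (simp add: L2_def set_integrable_def)
  have "ennreal ((L2_norm T v)\<^sup>2) = ennreal (LINT x|lebesgue. indicator T x *\<^sub>R (v x)\<^sup>2)"
    by (simp add: L2_norm_sq_LINT set_lebesgue_integral_def)
  also have "\<dots> = (\<integral>\<^sup>+x. ennreal (indicator T x *\<^sub>R (v x)\<^sup>2) \<partial>lebesgue)"
    by (rule nn_integral_eq_integral[OF int, symmetric], rule AE_I2) simp
  also have "\<dots> = (\<integral>\<^sup>+x. ennreal ((w x)\<^sup>2) * indicator T x \<partial>lebesgue)"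
  proof (rule nn_integral_cong_AE)
    have "AE x in lebesgue. v x = w x" using eq by (simp add: AE_completion_iff)
    then show "AE x in lebesgue. ennreal (indicator T x *\<^sub>R (v x)\<^sup>2) = ennreal ((w x)\<^sup>2) * indicator T x"
      by eventually_elim (simp add: indicator_def)
  qed
  also have "\<dots> = (\<integral>\<^sup>+x. ennreal ((w x)\<^sup>2) * indicator T x \<partial>lborel)"
    by (rule nn_integral_completion) (use w T in measurable)
  finally show ?thesis .
qed

lemma L2_subset: "v \<in> L2 T \<Longrightarrow> S \<subseteq> T \<Longrightarrow> S \<in> sets lebesgue \<Longrightarrow> v \<in> L2 S"
proof -
  assume v: "v \<in> L2 T" and ST: "S \<subseteq> T" "S \<in> sets lebesgue"
  have "set_borel_measurable lebesgue S v"
  proof -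
    have "(\<lambda>x. indicator S x *\<^sub>R (indicator T x *\<^sub>R v x)) \<in> borel_measurable lebesgue"
      by (rule borel_measurable_scaleR[OF borel_measurable_indicator[OF ST(2)]])
        (use v in \<open>simp add: L2_def set_borel_measurable_def\<close>)
    moreover have "(\<lambda>x. indicator S x *\<^sub>R (indicator T x *\<^sub>R v x)) = (\<lambda>x. indicator S x *\<^sub>R v x)"
      using ST(1) by (auto simp: indicator_def fun_eq_iff)
    ultimately show ?thesis by (simp add: set_borel_measurable_def)
  qed
  then show ?thesis using v set_integrable_subset[OF _ ST(2,1)] by (auto simp: L2_def)
qed

text \<open>Functions in \<open>L2\<close> are only Lebesgue measurable, whereas Fubini and
  substitution are applied over \<open>lborel\<close>, which calls for Borel functions.\<close>

lemma borel_representative: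
  fixes v :: "'a::euclidean_space \<Rightarrow> real"
  assumes "v \<in> L2 UNIV"
  obtains w where "w \<in> borel_measurable borel" "AE x in lborel. v x = w x" "w \<in> sq_int lborel"
proof -
  have vm: "v \<in> borel_measurable lebesgue" and vi: "integrable lebesgue (\<lambda>x. (v x)\<^sup>2)"
    using assms by (auto simp: L2_def set_borel_measurable_def set_integrable_def)
  obtain w where w: "w \<in> borel_measurable lborel" "AE x in lborel. v x = w x"
    using completion_ex_borel_measurable_real[OF vm] by (rule bexE)
  have wm: "(\<lambda>x. (w x)\<^sup>2) \<in> borel_measurable lborel" by (rule borel_measurable_power[OF w(1)])
  have "AE x in lebesgue. v x = w x" using w(2) by (simp add: AE_completion_iff)
  then have ae: "AE x in lebesgue. (v x)\<^sup>2 = (w x)\<^sup>2" by eventually_elim simp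
  have "integrable lebesgue (\<lambda>x. (w x)\<^sup>2)"
    by (rule integrable_cong_AE_imp[OF vi measurable_completion[OF wm] ae])
  then have "integrable lborel (\<lambda>x. (w x)\<^sup>2)" using integrable_completion[OF wm] by simp
  then show ?thesis using w by (intro that[of w]) (auto simp: sq_int_def)
qed

lemma LINT_lebesgue_representative:
  fixes v w f :: "'a::euclidean_space \<Rightarrow> real"
  assumes "AE x in lborel. v x = w x" "w \<in> borel_measurable borel" "v \<in> borel_measurable lebesgue"
    "f \<in> borel_measurable borel"
  shows "(LINT x:UNIV|lebesgue. v x * f x) = (LINT x|lborel. w x * f x)"
proof -
  have wf: "(\<lambda>x. w x * f x) \<in> borel_measurable lborel" using assms by simp
  have fl: "f \<in> borel_measurable lebesgue" by (rule measurable_completion) (use assms in simp)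
  have "AE x in lebesgue. v x = w x" using assms(1) by (simp add: AE_completion_iff)
  then have "AE x in lebesgue. v x * f x = w x * f x" by eventually_elim simp
  then have "(LINT x|lebesgue. v x * f x) = (LINT x|lebesgue. w x * f x)"
    using assms(3) fl measurable_completion[OF wf] by (intro integral_cong_AE) auto
  also have "\<dots> = (LINT x|lborel. w x * f x)" by (rule integral_completion[OF wf])
  finally show ?thesis by (simp add: set_lebesgue_integral_def)
qed

text \<open>The weak derivative is tested with the reflected and translated mollifier
  \<open>f (u - z)\<close>. Reflection gives one sign for each derivative, and these signs cancel
  those in the definition of the weak derivative.\<close>

lemma weak_deriv_conv:
  fixes v w g g' :: "'a::euclidean_space \<Rightarrow> real"
  assumes wd: "is_weak_deriv UNIV bs v g" and v: "v \<in> L2 UNIV" and bs: "set bs \<subseteq> Basis"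
    and w: "AE x in lborel. v x = w x" "w \<in> borel_measurable borel"
    and g': "AE x in lborel. g x = g' x" "g' \<in> borel_measurable borel"
    and f: "smooth f" "\<And>x. e < norm x \<Longrightarrow> f x = 0"
  shows "conv w (partials bs f) u = conv g' f u"
proof -
  define \<psi> where "\<psi> = (\<lambda>z. f (u + (-1) *\<^sub>R z))"
  have sm: "smooth \<psi>" unfolding \<psi>_def by (rule smooth_comp_affine[OF f(1)])
  have sub: "{z. \<psi> z \<noteq> 0} \<subseteq> cball u e"
    using f(2) by (force simp: \<psi>_def dist_norm not_less)
  have "closure {z. \<psi> z \<noteq> 0} \<subseteq> cball u e" by (rule closure_minimal[OF sub closed_cball])
  then have "bounded (closure {z. \<psi> z \<noteq> 0})" using bounded_cball bounded_subset by blast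
  then have test: "\<psi> \<in> test_functions UNIV"
    using sm by (simp add: test_functions_def smooth_def compact_eq_bounded_closed)
  have pb: "partials bs \<psi> = (\<lambda>z. (-1) ^ length bs * partials bs f (u - z))"
    unfolding \<psi>_def partials_comp_affine[OF f(1) bs] by simp
  have L2m: "h \<in> borel_measurable lebesgue" if "h \<in> L2 UNIV" for h :: "'a \<Rightarrow> real"
    using that by (simp add: L2_def set_borel_measurable_def)
  have gL: "g \<in> L2 UNIV" using wd by (simp add: is_weak_deriv_def)
  have "(LINT x:UNIV|lebesgue. v x * partials bs \<psi> x) = (-1) ^ length bs * (LINT x:UNIV|lebesgue. g x * \<psi> x)"
    using wd test by (simp add: is_weak_deriv_def)
  moreover have "(LINT x:UNIV|lebesgue. v x * partials bs \<psi> x) = (LINT x|lborel. w x * partials bs \<psi> x)"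
    by (intro LINT_lebesgue_representative w L2m v borel_measurable_continuous_onI partials_continuous sm bs)
  moreover have "(LINT x:UNIV|lebesgue. g x * \<psi> x) = (LINT x|lborel. g' x * \<psi> x)"
    by (intro LINT_lebesgue_representative g' L2m gL borel_measurable_continuous_onI smooth_continuous sm)
  moreover have "(LINT x|lborel. g' x * \<psi> x) = conv g' f u"
    by (simp add: conv_def \<psi>_def)
  moreover have "(LINT x|lborel. w x * partials bs \<psi> x) = (-1) ^ length bs * conv w (partials bs f) u"
  proof -
    have "(\<lambda>x. w x * partials bs \<psi> x) = (\<lambda>x. (-1) ^ length bs * (w x * partials bs f (u - x)))"
      by (simp add: pb mult.left_commute)
    then show ?thesis unfolding conv_def by (simp only: integral_mult_right_zero)
  qed
  ultimately have "(-1) ^ length bs * conv w (partials bs f) u = (-1) ^ length bs * conv g' f u" by simp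
  then show ?thesis by simp
qed

lemma sobolev_weak_deriv:
  assumes "v \<in> sobolev s U" "bs \<in> derivs s"
  shows "is_weak_deriv U bs v (weak_deriv U bs v)"
proof -
  have "\<exists>g. is_weak_deriv U bs v g" using assms by (simp add: sobolev_def)
  then show ?thesis unfolding weak_deriv_def by (rule someI_ex)
qed

text \<open>The projection error is at most the distance to any polynomial, so it can be compared
  with a mollified function whose mollifier depends on \<open>\<eta>\<close>. The bound for the
  mollified function does not depend on the mollifier, and \<open>\<eta>\<close> may tend to 0. The
  leading factor 2 is the price of squaring a sum of two errors.\<close>

theorem bramble_hilbert:
  fixes v :: "'a::euclidean_space \<Rightarrow> real" and c :: 'a and r :: real
  assumes v: "v \<in> sobolev (Suc k) UNIV" and r: "0 < r"
  shows "(L2_norm (ball c r) (\<lambda>x. v x - L2_proj k (ball c r) v x))\<^sup>2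
    \<le> 2 * (card (dirs (Suc k) :: 'a list set) * (2 * r) ^ (2 * Suc k) * 2 ^ DIM('a))
      * (\<Sum>bs\<in>dirs (Suc k). (L2_norm (ball c (2 * r)) (weak_deriv UNIV bs v))\<^sup>2)"
proof -
  let ?B = "ball c r" and ?I = "dirs (Suc k) :: 'a list set"
  have B: "bounded ?B" "?B \<in> sets lebesgue" "interior ?B \<noteq> {}" using r by auto
  define G where "G bs = weak_deriv UNIV bs v" for bs
  have wd: "is_weak_deriv UNIV bs v (G bs)" if "bs \<in> ?I" for bs
    unfolding G_def by (rule sobolev_weak_deriv[OF v]) (use that in \<open>auto simp: dirs_def derivs_def\<close>)
  have vL: "v \<in> L2 UNIV" using v by (simp add: sobolev_def)
  have GL: "G bs \<in> L2 UNIV" if "bs \<in> ?I" for bs using wd[OF that] by (simp add: is_weak_deriv_def)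
  obtain w where w: "w \<in> borel_measurable borel" "AE x in lborel. v x = w x" "w \<in> sq_int lborel"
    by (rule borel_representative[OF vL])
  have "\<forall>bs\<in>?I. \<exists>g'. g' \<in> borel_measurable borel \<and> (AE x in lborel. G bs x = g' x)"
  proof
    fix bs assume bs: "bs \<in> ?I"
    obtain g' where "g' \<in> borel_measurable borel" "AE x in lborel. G bs x = g' x" "g' \<in> sq_int lborel"
      by (rule borel_representative[OF GL[OF bs]])
    then show "\<exists>g'. g' \<in> borel_measurable borel \<and> (AE x in lborel. G bs x = g' x)" by (intro exI conjI)
  qed
  then obtain g where g: "\<forall>bs\<in>?I. g bs \<in> borel_measurable borel \<and> (AE x in lborel. G bs x = g bs x)"
    by (rule bchoice[THEN exE])
  define S where "S = (\<Sum>bs\<in>?I. (L2_norm (ball c (2 * r)) (G bs))\<^sup>2)"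
  define C where "C = card ?I * (2 * r) ^ (2 * Suc k) * 2 ^ DIM('a)"
  have C0: "C \<ge> 0" unfolding C_def using r by simp
  have S0: "S \<ge> 0" unfolding S_def by (simp add: sum_nonneg)
  define E where "E = (L2_norm ?B (\<lambda>x. v x - L2_proj k ?B v x))\<^sup>2"
  have E: "E \<le> 2 * \<eta> + 2 * (C * S)" if \<eta>: "0 < \<eta>" for \<eta> :: real
  proof -
    obtain f e where f: "smooth f \<and> 0 < e \<and> e \<le> r \<and> (\<forall>x. 0 \<le> f x) \<and> (\<forall>x. e \<le> norm x \<longrightarrow> f x = 0) \<and>
        (\<integral>\<^sup>+x. ennreal (f x) \<partial>lborel) = 1 \<and>
        (\<integral>\<^sup>+x. ennreal ((w x - conv w f x)\<^sup>2) * indicator ?B x \<partial>lborel) \<le> ennreal \<eta>"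
      using mollifier_approximates[OF w(3) r \<eta>, of c] by (elim exE)
    have fm: "f \<in> borel_measurable borel"
      using f by (intro borel_measurable_continuous_onI smooth_continuous) simp
    \<comment> \<open>This is \<open>E \<le> 2 * \<eta> + 2 * X\<close> solved for \<open>X\<close>,
      the form in which the estimate for mollified functions accepts a lower bound; a negative value
      becomes 0 under \<open>ennreal\<close>.\<close>
    have "ennreal ((E - 2 * \<eta>) / 2) \<le> ennreal (card ?I * (2 * r) ^ (2 * Suc k)) * 2 ^ DIM('a)
      * (\<Sum>bs\<in>?I. \<integral>\<^sup>+z. ennreal ((g bs z)\<^sup>2) * indicator (ball c (2 * r)) z \<partial>lborel)"
    proof (rule mollified_bramble_hilbert[OF w(3), where f = f and e = e])
      show "conv w (partials bs f) u = conv (g bs) f u" if "bs \<in> ?I" for bs u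
        by (rule weak_deriv_conv[OF wd[OF that] vL _ w(2,1), where e = e])
          (use that g f in \<open>auto simp: dirs_def\<close>)
      fix P :: "'a \<Rightarrow> real" assume P: "P \<in> polys k"
      let ?X = "\<integral>\<^sup>+x. ennreal ((conv w f x - P x)\<^sup>2) * indicator ?B x \<partial>lborel"
      have Pm: "P \<in> borel_measurable borel" by (rule polys_borel[OF P])
      have vP: "(\<lambda>x. v x - P x) \<in> L2 ?B"
        using L2_subset[OF vL subset_UNIV B(2)] polys_sq_int[OF P B(1,2)]
        by (simp add: L2_eq_sq_int[OF B(2)] sq_int_diff)
      have cm: "conv w f \<in> borel_measurable borel" by (rule conv_measurable[OF w(1) fm])
      have "E \<le> (L2_norm ?B (\<lambda>x. v x - P x))\<^sup>2"
        unfolding E_def by (rule L2_proj_bounds(2)[OF B L2_subset[OF vL subset_UNIV B(2)] P])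
      then have "ennreal E \<le> ennreal ((L2_norm ?B (\<lambda>x. v x - P x))\<^sup>2)" by (rule ennreal_leI)
      also have "\<dots> = (\<integral>\<^sup>+x. ennreal ((w x - P x)\<^sup>2) * indicator ?B x \<partial>lborel)"
        by (rule L2_norm_sq_nn_integral[OF vP]) (use w Pm in auto)
      also have "\<dots> \<le> (\<integral>\<^sup>+x. 2 * (ennreal ((w x - conv w f x)\<^sup>2) * indicator ?B x)
          + 2 * (ennreal ((conv w f x - P x)\<^sup>2) * indicator ?B x) \<partial>lborel)"
      proof (rule nn_integral_mono)
        fix x
        have "(w x - P x)\<^sup>2 \<le> 2 * (w x - conv w f x)\<^sup>2 + 2 * (conv w f x - P x)\<^sup>2"
          using sum_squares_bound[of "w x - conv w f x" "conv w f x - P x"]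
          by (simp add: power2_eq_square algebra_simps)
        then have "ennreal ((w x - P x)\<^sup>2) \<le> ennreal (2 * (w x - conv w f x)\<^sup>2 + 2 * (conv w f x - P x)\<^sup>2)"
          by (rule ennreal_leI)
        also have "\<dots> = 2 * ennreal ((w x - conv w f x)\<^sup>2) + 2 * ennreal ((conv w f x - P x)\<^sup>2)"
          by (simp add: ennreal_plus ennreal_mult)
        finally show "ennreal ((w x - P x)\<^sup>2) * indicator ?B x \<le> 2 * (ennreal ((w x - conv w f x)\<^sup>2) * indicator ?B x)
          + 2 * (ennreal ((conv w f x - P x)\<^sup>2) * indicator ?B x)"
          by (simp add: indicator_def)
      qed
      also have "\<dots> = 2 * (\<integral>\<^sup>+x. ennreal ((w x - conv w f x)\<^sup>2) * indicator ?B x \<partial>lborel) + 2 * ?X"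
      proof -
        note [measurable] = w(1) cm Pm
        have [measurable]: "?B \<in> sets borel" by simp
        show ?thesis by (simp add: nn_integral_add nn_integral_cmult)
      qed
      also have "\<dots> \<le> 2 * ennreal \<eta> + 2 * ?X"
        using f by (intro add_right_mono mult_left_mono) auto
      finally have le: "ennreal E \<le> 2 * ennreal \<eta> + 2 * ?X" .
      show "ennreal ((E - 2 * \<eta>) / 2) \<le> ?X"
      proof (cases "?X = top")
        case False
        then obtain x where x: "0 \<le> x" "?X = ennreal x" by (cases ?X) auto
        have "ennreal E \<le> ennreal (2 * \<eta> + 2 * x)"
          using le x \<eta> by (simp add: ennreal_plus ennreal_mult)
        then have "E \<le> 2 * \<eta> + 2 * x" using x(1) \<eta> by (subst (asm) ennreal_le_iff) auto
        then show ?thesis unfolding x(2) by (intro ennreal_leI) simp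
      qed (simp add: top_greatest)
    qed (use f g r in auto)
    also have "(\<Sum>bs\<in>?I. \<integral>\<^sup>+z. ennreal ((g bs z)\<^sup>2) * indicator (ball c (2 * r)) z \<partial>lborel) = ennreal S"
    proof -
      have "(\<integral>\<^sup>+z. ennreal ((g bs z)\<^sup>2) * indicator (ball c (2 * r)) z \<partial>lborel) = ennreal ((L2_norm (ball c (2 * r)) (G bs))\<^sup>2)"
        if "bs \<in> ?I" for bs
        using g that by (intro L2_norm_sq_nn_integral[symmetric] L2_subset[OF GL[OF that]]) auto
      then show ?thesis by (simp add: S_def sum_ennreal)
    qed
    also have "ennreal (card ?I * (2 * r) ^ (2 * Suc k)) * 2 ^ DIM('a) * ennreal S = ennreal (C * S)"
    proof -
      have "(2::ennreal) ^ DIM('a) = ennreal (2 ^ DIM('a))" by (simp add: ennreal_power[symmetric])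
      then show ?thesis using S0 r by (simp add: C_def ennreal_mult[symmetric] del: power_Suc mult_Suc_right)
    qed
    finally have "(E - 2 * \<eta>) / 2 \<le> C * S"
      using C0 S0 by (subst (asm) ennreal_le_iff) auto
    then show ?thesis by simp
  qed
  have "E \<le> 2 * (C * S)"
  proof (rule field_le_epsilon)
    fix \<epsilon> :: real assume "0 < \<epsilon>"
    then show "E \<le> 2 * (C * S) + \<epsilon>" using E[of "\<epsilon> / 2"] by simp
  qed
  then show ?thesis unfolding E_def S_def C_def G_def by (simp add: mult.assoc)
qed

section \<open>The Lagrange basis on simplicial meshes\<close>

text \<open>Takes a vertex set instead of a simplex, so that the lattice of a face is the lattice of
  a subset of the vertices.\<close>

definition principal_lattice :: "nat \<Rightarrow> 'a::euclidean_space set \<Rightarrow> 'a set" where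
  "principal_lattice k V = {\<Sum>a\<in>V. (real (n a) / real k) *\<^sub>R a | n :: 'a \<Rightarrow> nat. (\<Sum>a\<in>V. n a) = k}"

lemma element_nodes_lattice: "element_nodes k T = principal_lattice k {a. a extreme_point_of T}"
  by (simp add: element_nodes_def principal_lattice_def)

lemma principal_lattice_mono:
  assumes "finite V" "W \<subseteq> V" shows "principal_lattice k W \<subseteq> principal_lattice k V"
proof
  fix x assume "x \<in> principal_lattice k W"
  then obtain n where n: "x = (\<Sum>a\<in>W. (real (n a) / real k) *\<^sub>R a)" "(\<Sum>a\<in>W. n a) = k"
    by (auto simp: principal_lattice_def)
  let ?n = "\<lambda>a. if a \<in> W then n a else 0"
  have "(\<Sum>a\<in>V. (real (?n a) / real k) *\<^sub>R a) = x" unfolding n(1)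
    using assms by (intro sum.mono_neutral_cong_right) auto
  moreover have "(\<Sum>a\<in>V. ?n a) = (\<Sum>a\<in>W. n a)"
    using assms by (intro sum.mono_neutral_cong_right) auto
  ultimately show "x \<in> principal_lattice k V" using n(2) unfolding principal_lattice_def by (intro CollectI exI[of _ ?n]) simp
qed

lemma principal_lattice_subset_hull:
  assumes "finite V" "1 \<le> k" shows "principal_lattice k V \<subseteq> convex hull V"
proof
  fix x assume "x \<in> principal_lattice k V"
  then obtain n where n: "x = (\<Sum>a\<in>V. (real (n a) / real k) *\<^sub>R a)" "(\<Sum>a\<in>V. n a) = k"
    by (auto simp: principal_lattice_def)
  have "(\<Sum>a\<in>V. real (n a) / real k) = 1"
    using n(2) assms(2) by (simp add: sum_divide_distrib[symmetric] of_nat_sum[symmetric] del: of_nat_sum)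
  then show "x \<in> convex hull V"
    unfolding convex_hull_finite[OF assms(1)] n(1)
    by (intro CollectI exI[of _ "\<lambda>a. real (n a) / real k"]) auto
qed

lemma principal_lattice_finite_card:
  assumes "finite V" shows "finite (principal_lattice k V)" "card (principal_lattice k V) \<le> (k + 1) ^ card V"
proof -
  let ?f = "\<lambda>n. \<Sum>a\<in>V. (real (n a) / real k) *\<^sub>R a"
  let ?P = "PiE V (\<lambda>_. {..k})"
  have fin: "finite ?P" by (intro finite_PiE assms) simp
  have sub: "principal_lattice k V \<subseteq> ?f ` ?P"
  proof
    fix x assume "x \<in> principal_lattice k V"
    then obtain n where n: "x = ?f n" "(\<Sum>a\<in>V. n a) = k" by (auto simp: principal_lattice_def)
    have "n a \<le> k" if "a \<in> V" for a using member_le_sum[OF that, of n] assms n(2) by simp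
    then have "restrict n V \<in> ?P" by auto
    moreover have "x = ?f (restrict n V)" unfolding n(1) by (intro sum.cong) auto
    ultimately show "x \<in> ?f ` ?P" by (intro image_eqI[where x = "restrict n V"])
  qed
  then show "finite (principal_lattice k V)" using fin finite_surj by blast
  have "card (principal_lattice k V) \<le> card ?P" using sub fin surj_card_le by blast
  then show "card (principal_lattice k V) \<le> (k + 1) ^ card V" using assms by (simp add: card_PiE)
qed

text \<open>One vertex \<open>v\<close> serves as origin and the vectors \<open>(a - v) / k\<close>
  as steps; in these terms the principal lattice is the lattice of
  \<open>polys_zero_on_lattice\<close>, with step counts summing to at most
  \<open>k\<close>.\<close>

lemma polys_zero_on_hull:
  assumes p: "p \<in> polys k" and k: "1 \<le> k" and V: "finite V"
    and z: "\<And>x. x \<in> principal_lattice k V \<Longrightarrow> p x = 0" and x: "x \<in> convex hull V"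
  shows "p x = 0"
proof -
  obtain w where w: "\<forall>a\<in>V. 0 \<le> w a" "sum w V = 1" "(\<Sum>a\<in>V. w a *\<^sub>R a) = x"
    using x unfolding convex_hull_finite[OF V] by auto
  then have "V \<noteq> {}" by auto
  then obtain v where v: "v \<in> V" by auto
  define W where "W = V - {v}"
  have W: "finite W" "v \<notin> W" "V = insert v W" using V v by (auto simp: W_def)
  define m where "m a = (1 / real k) *\<^sub>R (a - v)" for a
  have inj: "inj_on m W" using k by (auto simp: inj_on_def m_def)
  have comb: "(\<Sum>a\<in>V. (c a / real k) *\<^sub>R a) = v + (\<Sum>a\<in>W. c a *\<^sub>R m a)" if "sum c V = real k" for c
  proof -
    have "(\<Sum>a\<in>V. (c a / real k) *\<^sub>R a) = (c v / real k) *\<^sub>R v + (\<Sum>a\<in>W. (c a / real k) *\<^sub>R a)"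
      using W by simp
    also have "c v = real k - sum c W" using that W by simp
    also have "((real k - sum c W) / real k) *\<^sub>R v = v - (\<Sum>a\<in>W. (c a / real k) *\<^sub>R v)"
      using k by (simp add: diff_divide_distrib scaleR_left_diff_distrib scaleR_sum_left[symmetric] sum_divide_distrib)
    finally show ?thesis
      by (simp add: m_def scaleR_right_diff_distrib sum_subtractf)
  qed
  have "p (v + (\<Sum>u\<in>m ` W. (k * w (the_inv_into W m u)) *\<^sub>R u)) = 0"
  proof (rule polys_zero_on_lattice[OF _ p])
    show "finite (m ` W)" using W by simp
    fix t :: "'a \<Rightarrow> nat" assume t: "sum t (m ` W) \<le> k"
    define n where "n a = (if a = v then k - sum t (m ` W) else t (m a))" for a
    have tW: "sum t (m ` W) = (\<Sum>a\<in>W. t (m a))" using inj by (simp add: sum.reindex)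
    have nW: "(\<Sum>a\<in>W. n a) = (\<Sum>a\<in>W. t (m a))"
      using W by (intro sum.cong) (auto simp: n_def)
    have nV: "sum n V = k" using W t nW tW by (simp add: n_def)
    then have "p (\<Sum>a\<in>V. (real (n a) / real k) *\<^sub>R a) = 0"
      by (intro z) (auto simp: principal_lattice_def)
    moreover have "(\<Sum>a\<in>V. real (n a)) = real k" using nV by (simp add: of_nat_sum[symmetric] del: of_nat_sum)
    moreover have "(\<Sum>a\<in>W. real (n a) *\<^sub>R m a) = (\<Sum>u\<in>m ` W. real (t u) *\<^sub>R u)"
      unfolding sum.reindex[OF inj] using W by (intro sum.cong) (auto simp: n_def)
    ultimately show "p (v + (\<Sum>u\<in>m ` W. real (t u) *\<^sub>R u)) = 0"
      using comb[of "\<lambda>a. real (n a)"] by simp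
  qed
  moreover have "(\<Sum>u\<in>m ` W. (k * w (the_inv_into W m u)) *\<^sub>R u) = (\<Sum>a\<in>W. (k * w a) *\<^sub>R m a)"
    unfolding sum.reindex[OF inj] using the_inv_into_f_f[OF inj] by (intro sum.cong) auto
  moreover have "(\<Sum>a\<in>V. real k * w a) = real k" using w(2) by (simp add: sum_distrib_left[symmetric])
  ultimately show ?thesis using comb[of "\<lambda>a. k * w a"] w(3) k by simp
qed

text \<open>The edge vectors at another vertex \<open>a0\<close> are independent, so there is a
  linear functional with value 1 on the edge to \<open>a\<close> and 0 on the others; the constant
  makes it vanish at \<open>a0\<close>.\<close>

lemma barycentric_coordinate:
  fixes V :: "'a::euclidean_space set"
  assumes V: "\<not> affine_dependent V" and a: "a \<in> V"
  shows "\<exists>g c. \<forall>b\<in>V. b \<bullet> g + c = (if b = a then 1 else (0::real))"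
proof (cases "V = {a}")
  case True
  then show ?thesis by (intro exI[of _ 0] exI[of _ 1]) simp
next
  case False
  then obtain a0 where a0: "a0 \<in> V" "a0 \<noteq> a" using a by auto
  let ?B = "(\<lambda>x. - a0 + x) ` (V - {a0})"
  have "independent ?B" using V affine_dependent_iff_dependent2[OF a0(1)] by simp
  from linear_independent_extend[OF this, of "\<lambda>x. if x = - a0 + a then 1 else (0::real)"]
  obtain l where l0: "linear l \<and> (\<forall>x\<in>?B. l x = (if x = - a0 + a then 1 else (0::real)))" by (rule exE)
  have l: "linear l" using l0 by (rule conjunct1)
  have l2: "l x = (if x = - a0 + a then 1 else (0::real))" if "x \<in> ?B" for x
    using conjunct2[OF l0] that by (rule bspec)
  define g where "g = (\<Sum>b\<in>Basis. l b *\<^sub>R b)"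
  have lg: "l x = x \<bullet> g" for x
  proof -
    have "l x = l (\<Sum>b\<in>Basis. (x \<bullet> b) *\<^sub>R b)" by (simp add: euclidean_representation)
    also have "\<dots> = (\<Sum>b\<in>Basis. (x \<bullet> b) * l b)" by (simp add: linear_sum[OF l] linear_cmul[OF l])
    finally show ?thesis by (simp add: g_def inner_sum_right mult.commute)
  qed
  have "b \<bullet> g + (- (a0 \<bullet> g)) = (if b = a then 1 else 0)" if b: "b \<in> V" for b
  proof (cases "b = a0")
    case False
    then have "l (- a0 + b) = (if b = a then 1 else 0)" using l2[of "- a0 + b"] b by auto
    then show ?thesis by (simp add: lg inner_diff_left split: if_splits)
  qed (use a0 in simp)
  then show ?thesis by blast
qed

lemma polys_prod:
  "finite I \<Longrightarrow> (\<And>i. i \<in> I \<Longrightarrow> f i \<in> polys (d i)) \<Longrightarrow> (\<lambda>x. \<Prod>i\<in>I. f i x) \<in> polys (\<Sum>i\<in>I. d i)"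
  by (induction I rule: finite_induct) (auto intro: polys_mult)

text \<open>The classical product formula. Two different lattice points have weights of equal sum,
  so at \<open>j\<close> some weight is smaller than at \<open>i\<close>, and the corresponding
  factor vanishes.\<close>

lemma lagrange_exists:
  fixes V :: "'a::euclidean_space set"
  assumes V: "finite V" "\<not> affine_dependent V" and k: "1 \<le> k" and i: "i \<in> principal_lattice k V"
  shows "\<exists>L\<in>polys k. (\<forall>j\<in>principal_lattice k V. L j = (if j = i then 1 else 0)) \<and>
      (\<forall>x\<in>convex hull V. \<bar>L x\<bar> \<le> real k ^ k)"
proof -
  have "\<forall>a\<in>V. \<exists>gc. \<forall>b\<in>V. b \<bullet> fst gc + snd gc = (if b = a then 1 else (0::real))"
    using barycentric_coordinate[OF V(2)] by simp
  then obtain gc where gc: "\<forall>a\<in>V. \<forall>b\<in>V. b \<bullet> fst (gc a) + snd (gc a) = (if b = a then 1 else (0::real))"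
    by (rule bchoice[THEN exE])
  define l where "l a x = x \<bullet> fst (gc a) + snd (gc a)" for a x
  have l: "l a (\<Sum>b\<in>V. w b *\<^sub>R b) = w a" if "a \<in> V" "sum w V = 1" for a w
  proof -
    have "l a (\<Sum>b\<in>V. w b *\<^sub>R b) = (\<Sum>b\<in>V. w b * (b \<bullet> fst (gc a))) + sum w V * snd (gc a)"
      by (simp add: l_def inner_sum_left that(2))
    also have "\<dots> = (\<Sum>b\<in>V. w b * (b \<bullet> fst (gc a) + snd (gc a)))"
      by (simp add: distrib_left sum.distrib sum_distrib_right)
    also have "\<dots> = (\<Sum>b\<in>V. w b * (if b = a then 1 else 0))"
      using gc that by (intro sum.cong) auto
    also have "\<dots> = w a" using that V(1) by (simp add: mult_if_delta if_distrib cong: if_cong)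
    finally show ?thesis .
  qed
  obtain n where n: "i = (\<Sum>a\<in>V. (real (n a) / real k) *\<^sub>R a)" "(\<Sum>a\<in>V. n a) = k"
    using i by (auto simp: principal_lattice_def)
  have nk: "n a \<le> k" if "a \<in> V" for a using member_le_sum[OF that, of n] V(1) n(2) by simp
  \<comment> \<open>For barycentric coordinates \<open>l a\<close>, the product of
    \<open>(k * l a x - q) / (n a - q)\<close> over \<open>q < n a\<close>, written with each factor
    as an affine function in the form of \<open>polys_linear\<close>. The number of factors is the
    sum of the \<open>n a\<close>, that is \<open>k\<close>.\<close>
  define L where "L x = (\<Prod>a\<in>V. \<Prod>q<n a. (x \<bullet> ((k / (real (n a) - real q)) *\<^sub>R fst (gc a))
      + (k * snd (gc a) - q) / (real (n a) - real q)))" for x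
  have Leq: "L x = (\<Prod>a\<in>V. \<Prod>q<n a. (k * l a x - q) / (real (n a) - real q))" for x
    unfolding L_def l_def by (intro prod.cong refl)
    (simp add: add_divide_distrib diff_divide_distrib distrib_left)
  have "(\<lambda>x. \<Prod>q<n a. (x \<bullet> ((k / (real (n a) - real q)) *\<^sub>R fst (gc a))
      + (k * snd (gc a) - q) / (real (n a) - real q))) \<in> polys (n a)" for a
  proof -
    have "(\<lambda>x. \<Prod>q<n a. (x \<bullet> ((k / (real (n a) - real q)) *\<^sub>R fst (gc a))
      + (k * snd (gc a) - q) / (real (n a) - real q))) \<in> polys (\<Sum>q<n a. Suc 0)"
      by (intro polys_prod polys_linear) simp
    then show ?thesis by (simp only: sum_constant card_lessThan mult_1_right of_nat_id One_nat_def[symmetric])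
  qed
  then have "(\<lambda>x. L x) \<in> polys (\<Sum>a\<in>V. n a)"
    unfolding L_def by (intro polys_prod V)
  then have LP: "L \<in> polys k" by (simp add: n(2))
  have one: "L i = 1"
  proof -
    have "l a i = n a / k" if "a \<in> V" for a unfolding n(1)
      using n(2) k that by (intro l) (auto simp: sum_divide_distrib[symmetric] of_nat_sum[symmetric] simp del: of_nat_sum)
    then have "L i = (\<Prod>a\<in>V. \<Prod>q<n a. (1::real))"
      unfolding Leq using k by (intro prod.cong refl) auto
    then show ?thesis by simp
  qed
  have zero: "L j = 0" if j: "j \<in> principal_lattice k V" "j \<noteq> i" for j
  proof -
    obtain m where m: "j = (\<Sum>a\<in>V. (real (m a) / real k) *\<^sub>R a)" "(\<Sum>a\<in>V. m a) = k"
      using j by (auto simp: principal_lattice_def)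
    have "\<exists>a\<in>V. m a < n a"
    proof (rule ccontr)
      assume "\<not> ?thesis"
      then have le: "\<And>a. a \<in> V \<Longrightarrow> n a \<le> m a" by (auto simp: not_less)
      have "\<forall>a\<in>V. m a - n a = 0"
        using sum_subtractf_nat[of V n m] le n(2) m(2) V(1) by simp
      then have "\<And>a. a \<in> V \<Longrightarrow> m a = n a" using le by (metis diff_is_0_eq antisym)
      then show False using j(2) unfolding m(1) n(1) by simp
    qed
    then obtain a where a: "a \<in> V" "m a < n a" by auto
    have "l a j = m a / k" unfolding m(1)
      using m(2) k a(1) by (intro l) (auto simp: sum_divide_distrib[symmetric] of_nat_sum[symmetric] simp del: of_nat_sum)
    then have "(\<Prod>q<n a. (k * l a j - q) / (real (n a) - real q)) = 0"
      using a(2) k by (intro prod_zero) auto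
    then show ?thesis unfolding Leq using a(1) V(1) by (intro prod_zero) auto
  qed
  have bnd: "\<bar>L x\<bar> \<le> real k ^ k" if x: "x \<in> convex hull V" for x
  proof -
    obtain w where w: "\<forall>a\<in>V. 0 \<le> w a" "sum w V = 1" "(\<Sum>a\<in>V. w a *\<^sub>R a) = x"
      using x unfolding convex_hull_finite[OF V(1)] by auto
    have lw: "l a x = w a" if "a \<in> V" for a using l[OF that w(2)] w(3) by simp
    have w1: "w a \<le> 1" if "a \<in> V" for a using member_le_sum[OF that, of w] w V(1) by auto
    \<comment> \<open>In the simplex \<open>k * l a x\<close> and \<open>q\<close> both lie between
      0 and \<open>k\<close>, and the denominator is at least 1. There are \<open>k\<close> such
      factors, hence the bound \<open>real k ^ k\<close>.\<close>
    have f: "\<bar>(k * l a x - q) / (real (n a) - real q)\<bar> \<le> real k" if "a \<in> V" "q < n a" for a q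
    proof -
      have "0 \<le> w a" "w a \<le> 1" using w(1) w1 that(1) by auto
      then have "0 \<le> k * w a" "k * w a \<le> k" by (auto simp: mult_left_le)
      moreover have "real q \<le> k" using that nk[OF that(1)] by simp
      ultimately have "\<bar>k * l a x - q\<bar> \<le> k" unfolding lw[OF that(1)] by (simp add: abs_le_iff)
      moreover have "1 \<le> real (n a) - real q" using that(2) by linarith
      ultimately have "\<bar>k * l a x - q\<bar> / (real (n a) - real q) \<le> k / 1"
        by (intro frac_le) auto
      then show ?thesis using that(2) by (simp add: abs_divide)
    qed
    have "\<bar>L x\<bar> = (\<Prod>a\<in>V. \<Prod>q<n a. \<bar>(k * l a x - q) / (real (n a) - real q)\<bar>)"
      unfolding Leq by (simp add: abs_prod)
    also have "\<dots> \<le> (\<Prod>a\<in>V. \<Prod>q<n a. real k)"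
      using f by (intro prod_mono conjI prod_nonneg) auto
    also have "\<dots> = real k ^ k" by (simp add: power_sum[symmetric] n(2))
    finally show ?thesis .
  qed
  show ?thesis using LP one zero bnd by (intro bexI[of _ L]) auto
qed

section \<open>Element nodes and the global nodal basis\<close>

lemma simplex_vertices:
  fixes T :: "'a::euclidean_space set"
  assumes "int DIM('a) simplex T"
  defines "V \<equiv> {a. a extreme_point_of T}"
  shows "finite V" "\<not> affine_dependent V" "T = convex hull V" "card V = Suc DIM('a)"
proof -
  obtain C where C: "finite C" "\<not> affine_dependent C" "int (card C) = int DIM('a) + 1" "T = convex hull C"
    using assms(1) by (auto simp: simplex)
  have "V = C" unfolding V_def C(4) using extreme_point_of_convex_hull_affine_independent[OF C(2)] by auto
  then show "finite V" "\<not> affine_dependent V" "T = convex hull V" "card V = Suc DIM('a)" using C by auto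
qed

lemma element_nodes_props:
  fixes T :: "'a::euclidean_space set"
  assumes T: "int DIM('a) simplex T" and k: "1 \<le> k"
  shows "finite (element_nodes k T)" "card (element_nodes k T) \<le> (k + 1) ^ Suc DIM('a)"
    "element_nodes k T \<subseteq> T"
    "p \<in> polys k \<Longrightarrow> (\<And>j. j \<in> element_nodes k T \<Longrightarrow> p j = 0) \<Longrightarrow> x \<in> T \<Longrightarrow> p x = 0"
proof -
  note S = simplex_vertices[OF T]
  show "finite (element_nodes k T)" "card (element_nodes k T) \<le> (k + 1) ^ Suc DIM('a)"
    using principal_lattice_finite_card[OF S(1), of k] S(4) by (simp_all add: element_nodes_lattice)
  show "element_nodes k T \<subseteq> T"
    using principal_lattice_subset_hull[OF S(1) k] S(3) by (simp add: element_nodes_lattice)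
  show "p \<in> polys k \<Longrightarrow> (\<And>j. j \<in> element_nodes k T \<Longrightarrow> p j = 0) \<Longrightarrow> x \<in> T \<Longrightarrow> p x = 0"
    using polys_zero_on_hull[OF _ k S(1)] S(3) by (simp add: element_nodes_lattice)
qed

lemma local_basis_exists:
  fixes T :: "'a::euclidean_space set"
  assumes T: "int DIM('a) simplex T" and k: "1 \<le> k"
  shows "\<exists>L\<in>polys k. (\<forall>j\<in>element_nodes k T. L j = (if j = i then 1 else 0)) \<and> (\<forall>x\<in>T. \<bar>L x\<bar> \<le> real k ^ k)"
proof (cases "i \<in> element_nodes k T")
  case True
  note S = simplex_vertices[OF T]
  show ?thesis using lagrange_exists[OF S(1,2) k, of i] True S(3) by (simp add: element_nodes_lattice)
next
  case False
  \<comment> \<open>An element that does not have \<open>i\<close> as a node carries the zero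
    polynomial.\<close>
  show ?thesis by (rule bexI[of _ "\<lambda>_. 0"]) (use False in auto)
qed

text \<open>By Krein-Milman a face is the hull of its extreme points, which are vertices of
  \<open>T\<close>; so unisolvence holds on the face with its own nodes.\<close>

lemma polys_zero_on_face:
  fixes T :: "'a::euclidean_space set"
  assumes T: "int DIM('a) simplex T" and k: "1 \<le> k" and F: "F face_of T"
    and p: "p \<in> polys k" and z: "\<And>j. j \<in> element_nodes k F \<Longrightarrow> p j = 0" and x: "x \<in> F"
  shows "p x = 0"
proof -
  note S = simplex_vertices[OF T]
  have cT: "compact T" "convex T" using S(1,3) by (metis finite_imp_compact_convex_hull, metis convex_convex_hull)
  have "compact F" "convex F"
    using face_of_imp_compact[OF cT(2,1) F] face_of_imp_convex[OF F] by auto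
  then have hull: "F = convex hull {a. a extreme_point_of F}" by (rule Krein_Milman_Minkowski)
  have "{a. a extreme_point_of F} \<subseteq> {a. a extreme_point_of T}" using extreme_point_of_face[OF F] by auto
  then have "finite {a. a extreme_point_of F}" using S(1) finite_subset by blast
  then show ?thesis
    using polys_zero_on_hull[OF p k] z x hull by (simp add: element_nodes_lattice)
qed

lemma element_nodes_face:
  fixes T :: "'a::euclidean_space set"
  assumes T: "int DIM('a) simplex T" and F: "F face_of T"
  shows "element_nodes k F \<subseteq> element_nodes k T"
  unfolding element_nodes_lattice
  by (rule principal_lattice_mono[OF simplex_vertices(1)[OF T]]) (use extreme_point_of_face[OF F] in auto)

text \<open>Two local polynomials agree on the common face, because their difference vanishes at the
  nodes of that face. Hence they glue to a continuous function.\<close>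

lemma global_basis_exists:
  fixes \<T> :: "'a::euclidean_space set set"
  assumes tri: "triangulation \<T>" and simp: "\<And>T. T \<in> \<T> \<Longrightarrow> int DIM('a) simplex T" and k: "1 \<le> k"
  shows "\<exists>\<phi>\<in>fe_space k \<T>. \<forall>T\<in>\<T>. (\<forall>j\<in>element_nodes k T. \<phi> j = (if j = i then 1 else 0)) \<and>
    (\<forall>x\<in>T. \<bar>\<phi> x\<bar> \<le> real k ^ k)"
proof -
  have "\<forall>T\<in>\<T>. \<exists>L. L \<in> polys k \<and> (\<forall>j\<in>element_nodes k T. L j = (if j = i then 1 else 0)) \<and> (\<forall>x\<in>T. \<bar>L x\<bar> \<le> real k ^ k)"
    using local_basis_exists[OF simp k] by blast
  then obtain L where L: "\<forall>T\<in>\<T>. L T \<in> polys k \<and> (\<forall>j\<in>element_nodes k T. L T j = (if j = i then 1 else 0)) \<and> (\<forall>x\<in>T. \<bar>L T x\<bar> \<le> real k ^ k)"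
    by (rule bchoice[THEN exE])
  have agree: "L T x = L T' x" if TT: "T \<in> \<T>" "T' \<in> \<T>" "x \<in> T" "x \<in> T'" for T T' x
  proof -
    have "(T \<inter> T') face_of T" "(T' \<inter> T) face_of T'"
      using tri TT(1,2) by (simp_all add: triangulation_def)
    then have F: "(T \<inter> T') face_of T" "(T \<inter> T') face_of T'"
      by (simp_all only: Int_commute)
    have "L T x - L T' x = 0"
    proof (rule polys_zero_on_face[OF simp[OF TT(1)] k F(1), where p = "\<lambda>x. L T x - L T' x"])
      show "(\<lambda>x. L T x - L T' x) \<in> polys k" using L TT by (intro polys_diff) auto
      show "x \<in> T \<inter> T'" using TT by simp
      fix j assume "j \<in> element_nodes k (T \<inter> T')"
      then have "j \<in> element_nodes k T" "j \<in> element_nodes k T'"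
        using element_nodes_face[OF simp[OF TT(1)] F(1)] element_nodes_face[OF simp[OF TT(2)] F(2)] by auto
      then show "L T j - L T' j = 0" using L TT by simp
    qed
    then show ?thesis by simp
  qed
  \<comment> \<open>By \<open>agree\<close> the value does not depend on the element chosen.\<close>
  define \<phi> where "\<phi> x = L (SOME T. T \<in> \<T> \<and> x \<in> T) x" for x
  have \<phi>: "\<phi> x = L T x" if "T \<in> \<T>" "x \<in> T" for T x
  proof -
    have "(SOME T. T \<in> \<T> \<and> x \<in> T) \<in> \<T> \<and> x \<in> (SOME T. T \<in> \<T> \<and> x \<in> T)"
      by (rule someI[of "\<lambda>T. T \<in> \<T> \<and> x \<in> T"]) (use that in simp)
    then show ?thesis unfolding \<phi>_def by (intro agree that) simp_all
  qed
  have clo: "closed T" if "T \<in> \<T>" for T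
    using simplex_vertices(1,3)[OF simp[OF that]] by (metis compact_imp_closed finite_imp_compact_convex_hull)
  have "continuous_on (\<Union>T\<in>\<T>. T) \<phi>"
  proof (rule continuous_on_closed_Union)
    show "finite \<T>" using tri by (simp add: triangulation_def)
    fix T assume T: "T \<in> \<T>"
    show "closed T" by (rule clo[OF T])
    have "continuous_on T (L T)" using L T by (intro polys_continuous) auto
    then show "continuous_on T \<phi>" by (rule continuous_on_eq) (rule \<phi>[OF T, symmetric])
  qed
  moreover have "\<exists>p\<in>polys k. \<forall>x\<in>T. \<phi> x = p x" if T: "T \<in> \<T>" for T
    by (rule bexI[of _ "L T"]) (use \<phi>[OF T] L T in auto)
  ultimately have "\<phi> \<in> fe_space k \<T>"
    unfolding fe_space_def by simp
  moreover have "\<forall>T\<in>\<T>. (\<forall>j\<in>element_nodes k T. \<phi> j = (if j = i then 1 else 0)) \<and> (\<forall>x\<in>T. \<bar>\<phi> x\<bar> \<le> real k ^ k)"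
  proof (intro ballI conjI)
    fix T assume T: "T \<in> \<T>"
    show "\<phi> j = (if j = i then 1 else 0)" if "j \<in> element_nodes k T" for j
      using \<phi>[OF T, of j] L T that element_nodes_props(3)[OF simp[OF T] k] by auto
    show "\<bar>\<phi> x\<bar> \<le> real k ^ k" if "x \<in> T" for x using \<phi>[OF T that] L T that by simp
  qed
  ultimately show ?thesis by (intro bexI[of _ \<phi>])
qed

lemma poly_ext_eq:
  assumes "p \<in> polys k" "\<And>x. x \<in> T \<Longrightarrow> v x = p x" "interior T \<noteq> {}"
  shows "poly_ext k T v = p"
  unfolding poly_ext_def
proof (rule the_equality)
  show "p \<in> polys k \<and> (\<forall>x\<in>T. p x = v x)" using assms by simp
  fix q assume q: "q \<in> polys k \<and> (\<forall>x\<in>T. q x = v x)"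
  have "(\<lambda>x. q x - p x) = (\<lambda>_. 0)"
    by (rule polys_zero_on_open[where S = T]) (use q assms in \<open>auto intro: polys_diff\<close>)
  then show "q = p" by (auto simp: fun_eq_iff)
qed

text \<open>Collects what the nodal basis requires of the mesh, without sizes. Both meshes are
  present because the active space consists of restrictions from the background mesh.\<close>

locale simplicial_mesh =
  fixes k :: nat and \<T>0 \<T> :: "'a::euclidean_space set set"
  assumes tri: "triangulation \<T>0"
    and simplices: "\<And>T. T \<in> \<T>0 \<Longrightarrow> int DIM('a) simplex T"
    and interior_nonempty: "\<And>T. T \<in> \<T>0 \<Longrightarrow> interior T \<noteq> {}"
    and sub: "\<T> \<subseteq> \<T>0" and k: "1 \<le> k"
begin

lemma active_simplex: "T \<in> \<T> \<Longrightarrow> int DIM('a) simplex T"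
  using simplices sub by blast

lemma node_in: "T \<in> \<T> \<Longrightarrow> j \<in> element_nodes k T \<Longrightarrow> j \<in> nodes k \<T> \<and> j \<in> T"
  using element_nodes_props(3)[OF active_simplex k] by (auto simp: nodes_def)

lemma active_space_poly:
  assumes "v \<in> active_space k \<T>0 \<T>" "T \<in> \<T>" shows "\<exists>p\<in>polys k. \<forall>x\<in>T. v x = p x"
proof -
  obtain u where u: "u \<in> fe_space k \<T>0" "v = restrict u (\<Union>\<T>)" using assms(1) by (auto simp: active_space_def)
  then have "\<exists>p\<in>polys k. \<forall>x\<in>T. u x = p x" using assms(2) sub by (auto simp: fe_space_def)
  then show ?thesis using u(2) assms(2) by auto
qed

text \<open>Unisolvence on each element; off the active mesh both functions are
  \<open>undefined\<close>, so they coincide as total functions. This is the uniqueness behind the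
  definite description of \<open>nodal_basis\<close>.\<close>

lemma active_space_eqI:
  assumes "u \<in> active_space k \<T>0 \<T>" "v \<in> active_space k \<T>0 \<T>"
    and eq: "\<And>j. j \<in> nodes k \<T> \<Longrightarrow> u j = v j"
  shows "u = v"
proof
  fix x
  show "u x = v x"
  proof (cases "x \<in> \<Union>\<T>")
    case True
    then obtain T where T: "T \<in> \<T>" "x \<in> T" by blast
    obtain p where p: "p \<in> polys k" "\<forall>x\<in>T. u x = p x" using active_space_poly[OF assms(1) T(1)] by (rule bexE)
    obtain q where q: "q \<in> polys k" "\<forall>x\<in>T. v x = q x" using active_space_poly[OF assms(2) T(1)] by (rule bexE)
    have "p x - q x = 0"
    proof (rule element_nodes_props(4)[OF active_simplex[OF T(1)] k, where p = "\<lambda>x. p x - q x"])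
      show "(\<lambda>x. p x - q x) \<in> polys k" by (intro polys_diff p q)
      fix j assume "j \<in> element_nodes k T"
      from node_in[OF T(1) this] show "p j - q j = 0" using eq[of j] p(2) q(2) by simp
    qed (rule T(2))
    then show ?thesis using p(2) q(2) T(2) by simp
  next
    case False
    then show ?thesis using assms(1,2) by (auto simp: active_space_def restrict_def)
  qed
qed

lemma nodal_basis:
  shows "nodal_basis k \<T>0 \<T> i \<in> active_space k \<T>0 \<T>"
    and "j \<in> nodes k \<T> \<Longrightarrow> nodal_basis k \<T>0 \<T> i j = (if j = i then 1 else 0)"
    and "T \<in> \<T> \<Longrightarrow> x \<in> T \<Longrightarrow> \<bar>nodal_basis k \<T>0 \<T> i x\<bar> \<le> real k ^ k"
proof -
  obtain \<Phi> where \<Phi>: "\<Phi> \<in> fe_space k \<T>0" and \<Phi>': "\<forall>T\<in>\<T>0. (\<forall>j\<in>element_nodes k T. \<Phi> j = (if j = i then 1 else 0)) \<and>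
    (\<forall>x\<in>T. \<bar>\<Phi> x\<bar> \<le> real k ^ k)"
    using global_basis_exists[OF tri simplices k] by (rule bexE)
  \<comment> \<open>A background basis function restricted to the active mesh keeps its nodal values
    and its bound.\<close>
  define u where "u = restrict \<Phi> (\<Union>\<T>)"
  have uA: "u \<in> active_space k \<T>0 \<T>" using \<Phi> by (simp add: u_def active_space_def)
  have ud: "u j = (if j = i then 1 else 0)" if j: "j \<in> nodes k \<T>" for j
  proof -
    obtain T where T: "T \<in> \<T>" "j \<in> element_nodes k T" using j by (auto simp: nodes_def)
    have "j \<in> \<Union>\<T>" using node_in[OF T] T(1) by blast
    moreover have "\<Phi> j = (if j = i then 1 else 0)" using \<Phi>' T sub by blast
    ultimately show ?thesis by (simp add: u_def)
  qed
  have "nodal_basis k \<T>0 \<T> i = u"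
    unfolding nodal_basis_def
  proof (rule the_equality)
    show "u \<in> active_space k \<T>0 \<T> \<and> (\<forall>j\<in>nodes k \<T>. dof j u = (if j = i then 1 else 0))"
      using uA ud by (simp add: dof_def)
    fix \<phi> assume \<phi>: "\<phi> \<in> active_space k \<T>0 \<T> \<and> (\<forall>j\<in>nodes k \<T>. dof j \<phi> = (if j = i then 1 else 0))"
    show "\<phi> = u" by (rule active_space_eqI) (use \<phi> uA ud in \<open>auto simp: dof_def\<close>)
  qed
  then show "nodal_basis k \<T>0 \<T> i \<in> active_space k \<T>0 \<T>"
    and "j \<in> nodes k \<T> \<Longrightarrow> nodal_basis k \<T>0 \<T> i j = (if j = i then 1 else 0)"
    and "T \<in> \<T> \<Longrightarrow> x \<in> T \<Longrightarrow> \<bar>nodal_basis k \<T>0 \<T> i x\<bar> \<le> real k ^ k"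
    using uA ud \<Phi>' sub by (auto simp: u_def)
qed

text \<open>On \<open>T\<close> the basis function is a polynomial that vanishes at all nodes of
  \<open>T\<close>. This is the locality of the basis.\<close>

lemma nodal_basis_outside:
  assumes T: "T \<in> \<T>" "x \<in> T" and i: "i \<notin> element_nodes k T"
  shows "nodal_basis k \<T>0 \<T> i x = 0"
proof -
  obtain p where p: "p \<in> polys k" "\<forall>x\<in>T. nodal_basis k \<T>0 \<T> i x = p x"
    using active_space_poly[OF nodal_basis(1) T(1)] by (rule bexE)
  have "p x = 0"
  proof (rule element_nodes_props(4)[OF active_simplex[OF T(1)] k p(1) _ T(2)])
    fix j assume j: "j \<in> element_nodes k T"
    then show "p j = 0" using node_in[OF T(1) j] nodal_basis(2)[of j i] p(2) i by auto
  qed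
  then show ?thesis using p(2) T(2) by simp
qed

lemma finite_nodes: "finite (nodes k \<T>)"
proof -
  have "finite \<T>" using tri sub finite_subset by (auto simp: triangulation_def)
  then show ?thesis unfolding nodes_def using element_nodes_props(1)[OF active_simplex k] by blast
qed

lemma sum_nodal_basis:
  assumes T: "T \<in> \<T>" "x \<in> T"
  shows "(\<Sum>i\<in>nodes k \<T>. c i * nodal_basis k \<T>0 \<T> i x) = (\<Sum>i\<in>element_nodes k T. c i * nodal_basis k \<T>0 \<T> i x)"
proof (rule sum.mono_neutral_right[OF finite_nodes])
  show "element_nodes k T \<subseteq> nodes k \<T>" using node_in[OF T(1)] by blast
  show "\<forall>i\<in>nodes k \<T> - element_nodes k T. c i * nodal_basis k \<T>0 \<T> i x = 0"
    using nodal_basis_outside[OF T] by simp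
qed

lemma nodal_basis_combination_poly:
  assumes T: "T \<in> \<T>"
  shows "\<exists>q\<in>polys k. \<forall>x\<in>T. (\<Sum>i\<in>element_nodes k T. c i * nodal_basis k \<T>0 \<T> i x) = q x"
proof -
  have "\<forall>i\<in>element_nodes k T. \<exists>p. p \<in> polys k \<and> (\<forall>x\<in>T. nodal_basis k \<T>0 \<T> i x = p x)"
    using active_space_poly[OF nodal_basis(1) T] by blast
  then obtain \<psi> where \<psi>: "\<forall>i\<in>element_nodes k T. \<psi> i \<in> polys k \<and> (\<forall>x\<in>T. nodal_basis k \<T>0 \<T> i x = \<psi> i x)"
    by (rule bchoice[THEN exE])
  show ?thesis
    by (rule bexI[of _ "\<lambda>x. \<Sum>i\<in>element_nodes k T. c i * \<psi> i x"])
      (use \<psi> in \<open>auto intro!: polys_sum polys_cmult sum.cong\<close>)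
qed

text \<open>Reproduction of polynomials on an element, the reason why a polynomial may be subtracted
  from the data of the interpolation operator.\<close>

lemma poly_nodal_expansion:
  assumes T: "T \<in> \<T>" "x \<in> T" and p: "p \<in> polys k"
  shows "p x = (\<Sum>i\<in>element_nodes k T. p i * nodal_basis k \<T>0 \<T> i x)"
proof -
  obtain q where q: "q \<in> polys k" "\<forall>x\<in>T. (\<Sum>i\<in>element_nodes k T. p i * nodal_basis k \<T>0 \<T> i x) = q x"
    using nodal_basis_combination_poly[OF T(1), of p] by (rule bexE)
  have "p x - q x = 0"
  proof (rule element_nodes_props(4)[OF active_simplex[OF T(1)] k _ _ T(2), where p = "\<lambda>x. p x - q x"])
    show "(\<lambda>x. p x - q x) \<in> polys k" by (intro polys_diff p q)
    fix j assume j: "j \<in> element_nodes k T"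
    have "q j = (\<Sum>i\<in>element_nodes k T. p i * nodal_basis k \<T>0 \<T> i j)"
      using q(2) node_in[OF T(1) j] by simp
    also have "\<dots> = (\<Sum>i\<in>element_nodes k T. if i = j then p i else 0)"
      using node_in[OF T(1) j] nodal_basis(2)[of j] by (intro sum.cong) auto
    also have "\<dots> = p j" using element_nodes_props(1)[OF active_simplex[OF T(1)] k] j by simp
    finally show "p j - q j = 0" by simp
  qed
  then show ?thesis using q(2) T(2) by simp
qed

lemma clement_eq:
  assumes T: "T \<in> \<T>" "x \<in> T"
  shows "clement k \<T>0 \<T> Tc w x = (\<Sum>i\<in>element_nodes k T. L2_proj k (Tc i) w i * nodal_basis k \<T>0 \<T> i x)"
proof -
  have "x \<in> \<Union>\<T>" using T by blast
  then show ?thesis using sum_nodal_basis[OF T, of "\<lambda>i. L2_proj k (Tc i) w i"]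
    by (simp add: clement_def dof_def)
qed

lemma clement_poly:
  assumes T: "T \<in> \<T>" shows "\<exists>q\<in>polys k. \<forall>x\<in>T. clement k \<T>0 \<T> Tc w x = q x"
  using nodal_basis_combination_poly[OF T, of "\<lambda>i. L2_proj k (Tc i) w i"] clement_eq[OF T] by simp

text \<open>By reproduction the error is a combination of at most
  \<open>(k + 1) ^ Suc DIM('a)\<close> basis functions with coefficients bounded by
  \<open>A\<close>, each basis function being bounded by \<open>real k ^ k\<close>.\<close>

lemma clement_error:
  assumes T: "T \<in> \<T>" "x \<in> T" and p: "p \<in> polys k"
    and A: "\<And>i. i \<in> element_nodes k T \<Longrightarrow> \<bar>L2_proj k (Tc i) w i - p i\<bar> \<le> A"
  shows "\<bar>clement k \<T>0 \<T> Tc w x - p x\<bar> \<le> real ((k + 1) ^ Suc DIM('a)) * (A * real k ^ k)"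
proof -
  let ?N = "element_nodes k T"
  have "clement k \<T>0 \<T> Tc w x - p x = (\<Sum>i\<in>?N. (L2_proj k (Tc i) w i - p i) * nodal_basis k \<T>0 \<T> i x)"
    unfolding clement_eq[OF T] poly_nodal_expansion[OF T p] by (simp add: left_diff_distrib sum_subtractf)
  also have "\<bar>\<dots>\<bar> \<le> (\<Sum>i\<in>?N. A * real k ^ k)"
  proof (rule order_trans[OF sum_abs], rule sum_mono)
    fix i assume i: "i \<in> ?N"
    have "0 \<le> A" using A[OF i] by linarith
    then show "\<bar>(L2_proj k (Tc i) w i - p i) * nodal_basis k \<T>0 \<T> i x\<bar> \<le> A * real k ^ k"
      unfolding abs_mult using A[OF i] nodal_basis(3)[OF T] by (intro mult_mono) auto
  qed
  also have "\<dots> = real (card ?N) * (A * real k ^ k)" by simp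
  also have "\<dots> \<le> real ((k + 1) ^ Suc DIM('a)) * (A * real k ^ k)"
  proof (cases "?N = {}")
    case False
    then obtain i where "i \<in> ?N" by blast
    then have "0 \<le> A" using A[of i] by linarith
    then show ?thesis
      by (intro mult_right_mono of_nat_mono element_nodes_props(2)[OF active_simplex[OF T(1)] k]) simp
  next
    case True
    \<comment> \<open>The sign of \<open>A\<close> is known only if a node exists. Without nodes
      even the constant 1 would have to vanish on \<open>T\<close>.\<close>
    have "\<exists>q\<in>polys k. \<forall>x\<in>T. q x \<noteq> 0" by (rule bexI[of _ "\<lambda>_. 1"]) auto
    then have False using element_nodes_props(4)[OF active_simplex[OF T(1)] k _ _ T(2)] True T(2) by blast
    then show ?thesis ..
  qed
  finally show ?thesis .
qed

text \<open>If \<open>i\<close> were not a node of \<open>Tc i\<close>, its basis function would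
  vanish on \<open>Tc i\<close>, and no interior point of \<open>Tc i\<close> could lie in the
  support. So the chosen element contains the node, and the interpolation operator is local.\<close>

lemma clement_choice_node:
  assumes Tc: "clement_choice k \<T>0 \<T> Tc" and i: "i \<in> nodes k \<T>"
  shows "Tc i \<in> \<T>" "i \<in> Tc i"
proof -
  have T: "Tc i \<in> \<T>" "Tc i \<subseteq> basis_support k \<T>0 \<T> i" using Tc i by (auto simp: clement_choice_def)
  have "i \<in> element_nodes k (Tc i)"
  proof (rule ccontr)
    assume "i \<notin> element_nodes k (Tc i)"
    then have z: "\<And>x. x \<in> Tc i \<Longrightarrow> nodal_basis k \<T>0 \<T> i x = 0" using nodal_basis_outside[OF T(1)] by blast
    obtain x where x: "x \<in> interior (Tc i)" using interior_nonempty T(1) sub by blast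
    then have "x \<in> closure {x \<in> \<Union>\<T>. nodal_basis k \<T>0 \<T> i x \<noteq> 0}"
      using T(2) interior_subset by (auto simp: basis_support_def)
    moreover have "interior (Tc i) \<inter> {x \<in> \<Union>\<T>. nodal_basis k \<T>0 \<T> i x \<noteq> 0} = {}"
      using z interior_subset by blast
    then have "interior (Tc i) \<inter> closure {x \<in> \<Union>\<T>. nodal_basis k \<T>0 \<T> i x \<noteq> 0} = {}"
      by (simp add: open_Int_closure_eq_empty)
    ultimately show False using x by blast
  qed
  then show "Tc i \<in> \<T>" "i \<in> Tc i" using T(1) node_in[OF T(1)] by auto
qed

end

section \<open>Quasiuniform meshes\<close>

lemma set_LINT_overlap:
  fixes f :: "'a::euclidean_space \<Rightarrow> real"
  assumes f: "set_integrable lebesgue X f" "\<And>x. 0 \<le> f x" and fin: "finite I"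
    and B: "\<And>i. i \<in> I \<Longrightarrow> B i \<in> sets lebesgue" and X: "X \<in> sets lebesgue"
    and card: "\<And>x. real (card {i \<in> I. x \<in> B i}) \<le> K"
  shows "(\<Sum>i\<in>I. LINT x:X \<inter> B i|lebesgue. f x) \<le> K * (LINT x:X|lebesgue. f x)"
proof -
  have int: "integrable lebesgue (\<lambda>x. indicator (X \<inter> B i) x *\<^sub>R f x)" if "i \<in> I" for i
    using set_integrable_subset[OF f(1), of "X \<inter> B i"] B[OF that] X by (simp add: set_integrable_def sets.Int)
  have "(\<Sum>i\<in>I. LINT x:X \<inter> B i|lebesgue. f x) = (LINT x|lebesgue. (\<Sum>i\<in>I. indicator (X \<inter> B i) x *\<^sub>R f x))"
    unfolding set_lebesgue_integral_def by (rule Bochner_Integration.integral_sum[symmetric]) (rule int)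
  also have "\<dots> \<le> (LINT x|lebesgue. K * (indicator X x *\<^sub>R f x))"
  proof (rule integral_mono)
    show "integrable lebesgue (\<lambda>x. \<Sum>i\<in>I. indicator (X \<inter> B i) x *\<^sub>R f x)"
      by (rule Bochner_Integration.integrable_sum) (rule int)
    show "integrable lebesgue (\<lambda>x. K * (indicator X x *\<^sub>R f x))"
      using f(1) unfolding set_integrable_def by (rule integrable_mult_right)
    fix x
    have "(\<Sum>i\<in>I. indicator (X \<inter> B i) x *\<^sub>R f x) = (\<Sum>i\<in>I. if x \<in> B i then 1 else 0) * (indicator X x *\<^sub>R f x)"
      unfolding sum_distrib_right by (intro sum.cong) (auto simp: indicator_def)
    also have "(\<Sum>i\<in>I. if x \<in> B i then 1 else 0) = real (card {i \<in> I. x \<in> B i})"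
      using fin by (simp add: sum.If_cases Int_def)
    also have "\<dots> * (indicator X x *\<^sub>R f x) \<le> K * (indicator X x *\<^sub>R f x)"
      using f(2) by (intro mult_right_mono card) (auto simp: indicator_def)
    finally show "(\<Sum>i\<in>I. indicator (X \<inter> B i) x *\<^sub>R f x) \<le> K * (indicator X x *\<^sub>R f x)" .
  qed
  also have "\<dots> = K * (LINT x:X|lebesgue. f x)" by (simp add: set_lebesgue_integral_def)
  finally show ?thesis .
qed

lemma path_distance:
  assumes "successively (\<lambda>S T. S \<inter> T \<noteq> {}) P" "P \<noteq> []"
    and "\<And>T x y. T \<in> set P \<Longrightarrow> x \<in> T \<Longrightarrow> y \<in> T \<Longrightarrow> dist x y \<le> d"
    and "x \<in> hd P" "y \<in> last P"
  shows "dist x y \<le> real (length P) * d"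
  using assms
proof (induction P arbitrary: x)
  case (Cons T P)
  show ?case
  proof (cases "P = []")
    case False
    then obtain S Q where P: "P = S # Q" by (cases P) auto
    then obtain z where z: "z \<in> T" "z \<in> S" using Cons.prems(1) by auto
    have "dist z y \<le> real (length P) * d"
      by (rule Cons.IH) (use Cons.prems P z in auto)
    moreover have "dist x z \<le> d" using Cons.prems z by auto
    ultimately show ?thesis using dist_triangle[of x y z] by (simp add: algebra_simps)
  qed (use Cons.prems in auto)
qed simp

lemma triangulation_interiors_disjoint:
  assumes "triangulation \<T>" "T \<in> \<T>" "T' \<in> \<T>" "T \<noteq> T'"
  shows "interior T \<inter> interior T' = {}"
proof (rule ccontr)
  assume "interior T \<inter> interior T' \<noteq> {}"
  then obtain x where x: "x \<in> interior T" "x \<in> interior T'" by blast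
  then have xF: "x \<in> T \<inter> T'" using interior_subset by blast
  have F: "(T \<inter> T') face_of T" "(T' \<inter> T) face_of T'"
    using assms by (simp_all add: triangulation_def)
  have "T \<inter> T' = T" using face_of_disjoint_interior[OF F(1)] x xF by blast
  moreover have "T' \<inter> T = T'" using face_of_disjoint_interior[OF F(2)] x xF by blast
  ultimately show False using assms(4) by blast
qed

locale mesh =
  fixes k :: nat and \<sigma> \<kappa> h :: real and D :: "'a::euclidean_space set" and \<T>0 \<T> :: "'a set set"
  assumes qm: "quasiuniform_mesh \<sigma> \<kappa> h D \<T>0" and pos: "0 < \<sigma>" "0 < \<kappa>" "0 < h"
    and active_subset: "\<T> \<subseteq> \<T>0" and degree_pos: "1 \<le> k"
begin

lemma diameter_bounds: "T \<in> \<T>0 \<Longrightarrow> h / \<kappa> \<le> diameter T" "T \<in> \<T>0 \<Longrightarrow> diameter T \<le> \<kappa> * h"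
  using qm pos by (auto simp: quasiuniform_mesh_def divide_le_eq mult.commute)

text \<open>The centre of an inscribed ball. Its radius is proportional to the diameter of
  \<open>T\<close>; \<open>centre_ball\<close> passes to the smaller radius
  \<open>\<sigma> / \<kappa> * h\<close> common to all elements.\<close>

definition centre :: "'a set \<Rightarrow> 'a" where
  "centre T = (SOME z. cball z (\<sigma> * diameter T) \<subseteq> T)"

lemma centre_cball: "T \<in> \<T>0 \<Longrightarrow> cball (centre T) (\<sigma> * diameter T) \<subseteq> T"
  unfolding centre_def by (rule someI_ex) (use qm in \<open>auto simp: quasiuniform_mesh_def\<close>)

lemma centre_ball: assumes "T \<in> \<T>0" shows "ball (centre T) (\<sigma> / \<kappa> * h) \<subseteq> T"
proof -
  have "\<sigma> * (h / \<kappa>) \<le> \<sigma> * diameter T"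
    using diameter_bounds(1)[OF assms] pos by (intro mult_left_mono) auto
  then show ?thesis using centre_cball[OF assms] by (auto simp: subset_iff)
qed

lemma centre_in: assumes "T \<in> \<T>0" shows "centre T \<in> T"
  using subsetD[OF centre_ball[OF assms], of "centre T"] pos by simp

sublocale simplicial_mesh k \<T>0 \<T>
proof
  show "triangulation \<T>0" "\<And>T. T \<in> \<T>0 \<Longrightarrow> int DIM('a) simplex T"
    using qm by (auto simp: quasiuniform_mesh_def)
  show "\<T> \<subseteq> \<T>0" "1 \<le> k" by (rule active_subset, rule degree_pos)
  fix T assume T: "T \<in> \<T>0"
  have "ball (centre T) (\<sigma> / \<kappa> * h) \<subseteq> interior T"
    using centre_ball[OF T] by (intro interior_maximal) auto
  moreover have "centre T \<in> ball (centre T) (\<sigma> / \<kappa> * h)" using pos by simp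
  ultimately show "interior T \<noteq> {}" by blast
qed

lemma element: assumes "T \<in> \<T>0"
  shows "compact T" "convex T" "bounded T" "T \<in> sets lebesgue" "closed T"
proof -
  note S = simplex_vertices[OF simplices[OF assms]]
  show c: "compact T" by (subst S(3)) (rule finite_imp_compact_convex_hull[OF S(1)])
  show "convex T" by (subst S(3)) (rule convex_convex_hull)
  show "bounded T" "closed T" using c by (auto simp: compact_imp_bounded compact_imp_closed)
  then show "T \<in> sets lebesgue" using borel_closed by (metis sets_completionI_sets sets_lborel)
qed

lemma finite_mesh: "finite \<T>0" "finite \<T>"
  using tri sub finite_subset by (auto simp: triangulation_def)

lemma element_dist:
  assumes "T \<in> \<T>0" "x \<in> T" "y \<in> T" shows "dist x y \<le> \<kappa> * h"
proof -
  have "dist x y \<le> diameter T" by (rule diameter_bounded_bound[OF element(3)[OF assms(1)] assms(2,3)])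
  then show ?thesis using diameter_bounds(2)[OF assms(1)] by linarith
qed

text \<open>The inscribed balls of the counted elements are disjoint, since distinct elements have
  disjoint interiors, and all of them lie in the ball of radius
  \<open>(R + \<sigma> / \<kappa>) * h\<close> about \<open>x\<close>. Comparing volumes, the powers
  of \<open>h\<close> cancel.\<close>

lemma overlap:
  assumes "0 \<le> R"
  shows "real (card {T \<in> \<T>0. x \<in> ball (centre T) (R * h)}) \<le> ((R + \<sigma> / \<kappa>) / (\<sigma> / \<kappa>)) ^ DIM('a)"
proof -
  define \<rho> where "\<rho> = \<sigma> / \<kappa>"
  have \<rho>: "0 < \<rho>" using pos by (simp add: \<rho>_def)
  let ?A = "{T \<in> \<T>0. x \<in> ball (centre T) (R * h)}"
  let ?B = "\<lambda>T. ball (centre T) (\<rho> * h)"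
  let ?v = "unit_ball_vol (real DIM('a))"
  have fin: "finite ?A" using finite_mesh(1) by simp
  have vol: "measure lebesgue (ball z (s * h)) = ?v * (s * h) ^ DIM('a)" if "0 \<le> s" for z :: 'a and s
    using content_ball[of "s * h" z] that pos by simp
  have int: "?B T \<subseteq> interior T" if "T \<in> \<T>0" for T
    using centre_ball[OF that] by (intro interior_maximal) (auto simp: \<rho>_def)
  have disj: "disjoint_family_on ?B ?A"
    unfolding disjoint_family_on_def
  proof (intro ballI impI)
    fix T T' assume "T \<in> ?A" "T' \<in> ?A" "T \<noteq> T'"
    then show "?B T \<inter> ?B T' = {}"
      using triangulation_interiors_disjoint[OF tri, of T T'] int[of T] int[of T'] by blast
  qed
  have "real (card ?A) * (?v * (\<rho> * h) ^ DIM('a)) = (\<Sum>T\<in>?A. measure lebesgue (?B T))"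
    using vol \<rho> by simp
  also have "\<dots> = measure lebesgue (\<Union>T\<in>?A. ?B T)"
    by (rule measure_finite_Union[symmetric, OF fin _ disj]) (use emeasure_lborel_ball_finite in \<open>auto simp: less_top\<close>)
  also have "\<dots> \<le> measure lebesgue (ball x ((R + \<rho>) * h))"
  proof (rule measure_mono_fmeasurable)
    show "(\<Union>T\<in>?A. ?B T) \<subseteq> ball x ((R + \<rho>) * h)"
    proof
      fix y assume "y \<in> (\<Union>T\<in>?A. ?B T)"
      then obtain T where "dist (centre T) x < R * h" "dist (centre T) y < \<rho> * h" by auto
      then show "y \<in> ball x ((R + \<rho>) * h)"
        using dist_triangle3[of x y "centre T"] by (simp add: algebra_simps)
    qed
    show "(\<Union>T\<in>?A. ?B T) \<in> sets lebesgue" using fin by (intro sets.finite_UN) auto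
  qed simp
  also have "\<dots> = ?v * ((R + \<rho>) * h) ^ DIM('a)" using vol[of "R + \<rho>"] assms \<rho> by simp
  finally have "?v * (h ^ DIM('a) * (real (card ?A) * \<rho> ^ DIM('a))) \<le> ?v * (h ^ DIM('a) * (R + \<rho>) ^ DIM('a))"
    by (simp add: power_mult_distrib mult_ac)
  then have "real (card ?A) * \<rho> ^ DIM('a) \<le> (R + \<rho>) ^ DIM('a)"
    using pos by (simp add: unit_ball_vol_pos)
  then show ?thesis using \<rho> by (simp add: \<rho>_def[symmetric] power_divide pos_le_divide_eq)
qed

lemma overlap_integral:
  fixes f :: "'a \<Rightarrow> real"
  assumes R: "0 \<le> R" and f: "set_integrable lebesgue X f" "\<And>x. 0 \<le> f x" "X \<in> sets lebesgue"
    and I: "I \<subseteq> \<T>0"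
  shows "(\<Sum>T\<in>I. LINT x:X \<inter> ball (centre T) (R * h)|lebesgue. f x)
    \<le> ((R + \<sigma> / \<kappa>) / (\<sigma> / \<kappa>)) ^ DIM('a) * (LINT x:X|lebesgue. f x)"
proof (rule set_LINT_overlap[OF f(1,2) _ _ f(3)])
  show "finite I" using I finite_mesh(1) finite_subset by blast
  fix x
  have "card {T \<in> I. x \<in> ball (centre T) (R * h)} \<le> card {T \<in> \<T>0. x \<in> ball (centre T) (R * h)}"
    using I finite_mesh(1) by (intro card_mono) auto
  then show "real (card {T \<in> I. x \<in> ball (centre T) (R * h)}) \<le> ((R + \<sigma> / \<kappa>) / (\<sigma> / \<kappa>)) ^ DIM('a)"
    using overlap[OF R, of x] by linarith
qed simp

text \<open>Consecutive elements meet because a facet is nonempty, and each element on the path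
  contributes at most one diameter.\<close>

lemma face_path_dist:
  assumes P: "P \<noteq> []" "set P \<subseteq> \<T>" "successively face_neighbors P" "length P \<le> N"
    and "x \<in> hd P" "y \<in> last P"
  shows "dist x y \<le> real N * (\<kappa> * h)"
proof -
  have "successively (\<lambda>S T. S \<inter> T \<noteq> {}) P"
    using P(3) by (rule successively_mono) (auto simp: face_neighbors_def facet_of_def)
  then have "dist x y \<le> real (length P) * (\<kappa> * h)"
    by (rule path_distance) (use assms sub element_dist in auto)
  also have "\<dots> \<le> real N * (\<kappa> * h)" using P(4) pos by (intro mult_right_mono) auto
  finally show ?thesis .
qed

end

section \<open>Piecewise polynomials, and sums over the stabilization triples\<close>

lemma pderiv_at_diff:
  assumes "p \<in> polys k" "q \<in> polys k"
  shows "pderiv_at b (\<lambda>x. p x - q x) x = pderiv_at b p x - pderiv_at b q x"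
proof -
  have d: "(f has_derivative frechet_derivative f (at x)) (at x)" if "f \<in> polys k" for f :: "'a \<Rightarrow> real"
    using has_derivative_pderiv_at(1)[OF that] differentiable_def frechet_derivative_works by blast
  from frechet_derivative_at[OF has_derivative_diff[OF d[OF assms(1)] d[OF assms(2)]]]
  show ?thesis by (simp add: pderiv_at_def fun_eq_iff)
qed

lemma nabla_norm_diff_le:
  assumes p: "p \<in> polys k" "q \<in> polys k" and T: "bounded T" "T \<in> sets lebesgue"
  shows "(nabla_norm m T (\<lambda>x. p x - q x))\<^sup>2 \<le> 2 * (nabla_norm m T p)\<^sup>2 + 2 * (nabla_norm m T q)\<^sup>2"
proof -
  have sq: "(a - b)\<^sup>2 \<le> 2 * a\<^sup>2 + 2 * b\<^sup>2" for a b :: real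
    using zero_le_power2[of "a + b"] by (simp add: power2_eq_square algebra_simps)
  have le: "grad_density m (\<lambda>x. p x - q x) x \<le> 2 * grad_density m p x + 2 * grad_density m q x" for x
  proof (cases "m = 0")
    case False
    have "(\<Sum>b\<in>Basis. (pderiv_at b p x - pderiv_at b q x)\<^sup>2) \<le> (\<Sum>b\<in>Basis. 2 * (pderiv_at b p x)\<^sup>2 + 2 * (pderiv_at b q x)\<^sup>2)"
      by (intro sum_mono sq)
    then show ?thesis using False
      by (simp add: grad_density_pderiv pderiv_at_diff[OF p] sum.distrib sum_distrib_left)
  qed (use sq in \<open>simp add: grad_density_pderiv\<close>)
  have i: "set_integrable lebesgue T (grad_density m f)" if "f \<in> polys k" for f
    by (rule continuous_set_integrable[OF grad_density_polys_continuous[OF that] T])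
  have "(LINT x:T|lebesgue. grad_density m (\<lambda>x. p x - q x) x) \<le> (LINT x:T|lebesgue. 2 * grad_density m p x + 2 * grad_density m q x)"
    by (intro set_integral_mono set_integral_add set_integrable_mult_right i p polys_diff le)
  also have "\<dots> = 2 * (LINT x:T|lebesgue. grad_density m p x) + 2 * (LINT x:T|lebesgue. grad_density m q x)"
    using i[OF p(1)] i[OF p(2)] by (simp add: set_integral_add set_integrable_mult_right)
  finally show ?thesis by (simp add: nabla_norm_sq)
qed

text \<open>The two functions agree on \<open>T\<close> only, so their classical gradients are sure
  to agree just in the interior. The frontier of a convex set is negligible, and measurability
  passes to \<open>v\<close> because equality almost everywhere suffices for
  \<open>lebesgue\<close>.\<close>

lemma piecewise_nabla_norm:
  assumes p: "p \<in> polys k" "\<And>x. x \<in> T \<Longrightarrow> v x = p x" and T: "convex T" "bounded T" "T \<in> sets lebesgue"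
  shows "set_integrable lebesgue T (grad_density m v)" and "(nabla_norm m T p)\<^sup>2 = (nabla_norm m T v)\<^sup>2"
proof -
  have eq: "grad_density m v x = grad_density m p x" if x: "x \<in> interior T" for x
  proof (cases "m = 0")
    case False
    have "\<exists>D. (p has_derivative D) (at x)" using has_derivative_pderiv_at(1)[OF p(1)] by blast
    then obtain D where D: "(p has_derivative D) (at x)" by (rule exE)
    have "(v has_derivative D) (at x)"
      by (rule has_derivative_transform_within_open[OF D open_interior x])
        (rule p(2)[symmetric], erule subsetD[OF interior_subset])
    then have "frechet_derivative v (at x) = frechet_derivative p (at x)"
      using frechet_derivative_at D by metis
    then show ?thesis using False by (simp add: grad_density_def grad_def)
  qed (use p(2)[OF subsetD[OF interior_subset x]] in \<open>simp add: grad_density_def\<close>)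
  have "negligible (frontier T)" using negligible_convex_frontier[OF T(1)] .
  then have "AE x in lebesgue. x \<notin> frontier T" by (simp add: AE_not_in negligible_iff_null_sets)
  then have ae: "AE x in lebesgue. indicator T x *\<^sub>R grad_density m p x = indicator T x *\<^sub>R grad_density m v x"
  proof eventually_elim
    case (elim x)
    show ?case
    proof (cases "x \<in> T")
      case True
      then have "x \<in> interior T" using elim closure_subset by (auto simp: frontier_def)
      then show ?thesis by (simp add: eq)
    qed simp
  qed
  have ip: "integrable lebesgue (\<lambda>x. indicator T x *\<^sub>R grad_density m p x)"
    using continuous_set_integrable[OF grad_density_polys_continuous[OF p(1)] T(2,3), of m] by (simp add: set_integrable_def)
  have m: "(\<lambda>x. indicator T x *\<^sub>R grad_density m v x) \<in> borel_measurable lebesgue"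
    by (rule borel_measurable_AE[OF borel_measurable_integrable[OF ip] ae])
  then show "set_integrable lebesgue T (grad_density m v)"
    unfolding set_integrable_def by (rule integrable_cong_AE_imp[OF ip _ ae])
  show "(nabla_norm m T p)\<^sup>2 = (nabla_norm m T v)\<^sup>2"
    unfolding nabla_norm_sq set_lebesgue_integral_def
    by (rule integral_cong_AE[OF borel_measurable_integrable[OF ip] m ae])
qed

lemma set_integrable_finite_Union:
  fixes f :: "'a::euclidean_space \<Rightarrow> real"
  assumes "finite I" "\<And>T. T \<in> I \<Longrightarrow> set_integrable lebesgue T f" "\<And>T. T \<in> I \<Longrightarrow> T \<in> sets lebesgue"
  shows "set_integrable lebesgue (\<Union>I) f"
  using assms
proof (induction I)
  case empty then show ?case by (simp add: set_integrable_def)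
next
  case (insert T I)
  then have "set_integrable lebesgue (T \<union> \<Union>I) f"
    by (intro set_integrable_Un) (auto intro!: sets.finite_Union)
  then show ?case by simp
qed

text \<open>The triples are grouped by their small element; a group is in bijection with the at most
  \<open>M\<close> forms attached to that element, which also shows that the set of triples is
  finite.\<close>

lemma stab_triples_sum_le:
  assumes S: "stab_triples M k small Sh \<S>" and fin: "finite small" and F: "\<And>T. 0 \<le> F T"
    and G: "\<And>b T T'. (b, T, T') \<in> \<S> \<Longrightarrow> G b T T' \<le> F T"
  shows "(\<Sum>(b, T, T')\<in>\<S>. G b T T') \<le> real M * (\<Sum>T\<in>small. F T)"
proof -
  have S': "T \<in> small" "T' = Sh T" if "(b, T, T') \<in> \<S>" for b T T'
    using S that unfolding stab_triples_def by fastforce+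
  let ?b = "\<lambda>T. {b. (b, T, Sh T) \<in> \<S>}"
  have fb: "finite (?b T)" "card (?b T) \<le> M" if "T \<in> small" for T
    using conjunct2[OF S[unfolded stab_triples_def]] that by simp_all
  have eq: "{s \<in> \<S>. fst (snd s) = T} = (\<lambda>b. (b, T, Sh T)) ` ?b T" for T
  proof (intro set_eqI iffI)
    fix s assume "s \<in> {s \<in> \<S>. fst (snd s) = T}"
    then obtain b T' where s: "s = (b, T, T')" "(b, T, T') \<in> \<S>" by (cases s) auto
    then have "s = (b, T, Sh T)" "b \<in> ?b T" using S'(2)[OF s(2)] by simp_all
    then show "s \<in> (\<lambda>b. (b, T, Sh T)) ` ?b T" by (rule image_eqI)
  next
    fix s assume "s \<in> (\<lambda>b. (b, T, Sh T)) ` ?b T"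
    then show "s \<in> {s \<in> \<S>. fst (snd s) = T}" by (elim imageE) simp
  qed
  have sm: "fst (snd s) \<in> small" if "s \<in> \<S>" for s
    using that S'(1) by (cases s) simp
  have "\<S> \<subseteq> (\<Union>T\<in>small. {s \<in> \<S>. fst (snd s) = T})" using sm by blast
  moreover have "finite (\<Union>T\<in>small. {s \<in> \<S>. fst (snd s) = T})"
    unfolding eq using fin fb(1) by (intro finite_UN_I finite_imageI)
  ultimately have finS: "finite \<S>" by (rule finite_subset)
  have "(\<Sum>(b, T, T')\<in>\<S>. G b T T') \<le> (\<Sum>s\<in>\<S>. F (fst (snd s)))"
    by (rule sum_mono) (use G in auto)
  also have "\<dots> = (\<Sum>T\<in>small. \<Sum>s\<in>{s \<in> \<S>. fst (snd s) = T}. F (fst (snd s)))"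
    by (rule sum.group[symmetric, OF finS fin]) (use sm in blast)
  also have "\<dots> \<le> (\<Sum>T\<in>small. real M * F T)"
  proof (rule sum_mono)
    fix T assume T: "T \<in> small"
    have "(\<Sum>s\<in>{s \<in> \<S>. fst (snd s) = T}. F (fst (snd s))) = real (card {s \<in> \<S>. fst (snd s) = T}) * F T"
      by simp
    also have "card {s \<in> \<S>. fst (snd s) = T} = card (?b T)"
      unfolding eq by (rule card_image) (auto simp: inj_on_def)
    also have "real (card (?b T)) * F T \<le> real M * F T"
      using fb(2)[OF T] F[of T] by (intro mult_right_mono) auto
    finally show "(\<Sum>s\<in>{s \<in> \<S>. fst (snd s) = T}. F (fst (snd s))) \<le> real M * F T" .
  qed
  also have "\<dots> = real M * (\<Sum>T\<in>small. F T)" by (simp add: sum_distrib_left)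
  finally show ?thesis .
qed

section \<open>Stabilization\<close>

text \<open>\<open>R\<close> and \<open>K\<close> are parameters and not obtained inside the locale,
  because they must be chosen before \<open>h\<close> and the mesh. The assumption
  \<open>inv\<close> is \<open>polys_inverse_estimates\<close> with inner radius
  \<open>\<sigma> / \<kappa>\<close>, at the present \<open>h\<close>.\<close>

locale stabilized_mesh = mesh k \<sigma> \<kappa> h D \<T>0 \<T>
  for k :: nat and \<sigma> \<kappa> h :: real and D :: "'a::euclidean_space set" and \<T>0 \<T> :: "'a set set" +
  fixes N m :: nat and R K :: real
  assumes m: "m \<in> {0, 1}" and R: "R = (real N + 3) * \<kappa>" and K: "0 \<le> K"
    and inv: "\<And>p z T T'. p \<in> polys k \<Longrightarrow> T \<subseteq> cball (z::'a) (R * h) \<Longrightarrow> T \<in> sets lebesgue \<Longrightarrow>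
        ball z (\<sigma> / \<kappa> * h) \<subseteq> T' \<Longrightarrow> bounded T' \<Longrightarrow> T' \<in> sets lebesgue \<Longrightarrow>
      (\<forall>x\<in>cball z (R * h). h ^ DIM('a) * (p x)\<^sup>2 \<le> K * (L2_norm T' p)\<^sup>2) \<and>
      h ^ (2 * m) * (nabla_norm m T p)\<^sup>2 \<le> K * (L2_norm T' p)\<^sup>2 \<and>
      (nabla_norm m T p)\<^sup>2 \<le> K * (nabla_norm m T' p)\<^sup>2"
begin

lemma R_pos: "0 < R"
proof -
  have "0 < real N + 3" by simp
  then show ?thesis using pos(2) unfolding R by (rule mult_pos_pos)
qed

text \<open>The metric consequence of A2, in which the path no longer appears.\<close>

definition near :: "'a set \<Rightarrow> 'a set \<Rightarrow> bool" where
  "near T T' \<longleftrightarrow> T \<in> \<T> \<and> T' \<in> \<T> \<and> (\<forall>x\<in>T. \<forall>y\<in>T'. dist x y \<le> real N * (\<kappa> * h))"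

lemma active_in_mesh: "T \<in> \<T> \<Longrightarrow> T \<in> \<T>0" using sub by blast

text \<open>The spare \<open>\<kappa> * h\<close> turns a weak bound on the distance into membership
  in an open ball.\<close>

lemma near_ball:
  assumes "dist z y \<le> (real N + 2) * (\<kappa> * h)" shows "y \<in> ball z (R * h)"
proof -
  have "(real N + 2) * (\<kappa> * h) < (real N + 3) * (\<kappa> * h)" using pos by (intro mult_strict_right_mono) auto
  then show ?thesis using assms by (simp add: R mult.assoc)
qed

lemma kappa_h_pos: "0 < \<kappa> * h" using pos by simp

lemma near_subsets:
  assumes "near T T'"
  shows "T \<subseteq> ball (centre T) (R * h)" "T' \<subseteq> ball (centre T) (R * h)" "T \<subseteq> cball (centre T') (R * h)"
proof -
  have T: "T \<in> \<T>" "T' \<in> \<T>" and d: "\<And>x y. x \<in> T \<Longrightarrow> y \<in> T' \<Longrightarrow> dist x y \<le> real N * (\<kappa> * h)"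
    using assms by (auto simp: near_def)
  have le: "real N * (\<kappa> * h) \<le> (real N + 2) * (\<kappa> * h)" "1 * (\<kappa> * h) \<le> (real N + 2) * (\<kappa> * h)"
    using kappa_h_pos by (intro mult_right_mono; simp)+
  show "T \<subseteq> ball (centre T) (R * h)"
  proof
    fix x assume "x \<in> T"
    then have "dist (centre T) x \<le> \<kappa> * h" by (rule element_dist[OF active_in_mesh[OF T(1)] centre_in[OF active_in_mesh[OF T(1)]]])
    then show "x \<in> ball (centre T) (R * h)" using le by (intro near_ball) simp
  qed
  show "T' \<subseteq> ball (centre T) (R * h)"
  proof
    fix x assume "x \<in> T'"
    then have "dist (centre T) x \<le> real N * (\<kappa> * h)" by (rule d[OF centre_in[OF active_in_mesh[OF T(1)]]])
    then show "x \<in> ball (centre T) (R * h)" using le by (intro near_ball) simp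
  qed
  show "T \<subseteq> cball (centre T') (R * h)"
  proof
    fix x assume "x \<in> T"
    then have "dist x (centre T') \<le> real N * (\<kappa> * h)" by (rule d[OF _ centre_in[OF active_in_mesh[OF T(2)]]])
    then have "x \<in> ball (centre T') (R * h)" using le by (intro near_ball) (simp add: dist_commute)
    then show "x \<in> cball (centre T') (R * h)" by simp
  qed
qed

text \<open>The jump is \<open>p - q\<close>, with \<open>q\<close> the polynomial of
  \<open>T'\<close>. Since \<open>T\<close> lies in the large ball about the centre of
  \<open>T'\<close>, the seminorm of \<open>q\<close> on \<open>T\<close> is controlled by that on
  \<open>T'\<close>. Both elements lie in the patch about the centre of \<open>T\<close>, so the
  bound depends on \<open>T\<close> only.\<close>

lemma jump_bound:
  assumes n: "near T T'" and v: "\<And>T. T \<in> \<T> \<Longrightarrow> \<exists>p\<in>polys k. \<forall>x\<in>T. v x = p x"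
  shows "jump k v T T' \<in> polys k"
    and "(nabla_norm m T (jump k v T T'))\<^sup>2
      \<le> 2 * (1 + K) * (LINT x:\<Union>\<T> \<inter> ball (centre T) (R * h)|lebesgue. grad_density m v x)"
proof -
  have T: "T \<in> \<T>" "T' \<in> \<T>" using n by (auto simp: near_def)
  note T0 = active_in_mesh[OF T(1)] active_in_mesh[OF T(2)]
  note near = near_subsets[OF n]
  obtain p where p: "p \<in> polys k" "\<forall>x\<in>T. v x = p x" using v[OF T(1)] by (rule bexE)
  obtain q where q: "q \<in> polys k" "\<forall>x\<in>T'. v x = q x" using v[OF T(2)] by (rule bexE)
  have "poly_ext k T v = p" by (rule poly_ext_eq[OF p(1) _ interior_nonempty[OF T0(1)]]) (use p(2) in simp)
  moreover have "poly_ext k T' v = q" by (rule poly_ext_eq[OF q(1) _ interior_nonempty[OF T0(2)]]) (use q(2) in simp)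
  ultimately have J: "jump k v T T' = (\<lambda>x. p x - q x)" by (simp add: jump_def)
  show "jump k v T T' \<in> polys k" unfolding J by (rule polys_diff[OF p(1) q(1)])
  let ?X = "\<Union>\<T> \<inter> ball (centre T) (R * h)"
  have pw: "set_integrable lebesgue S (grad_density m v)" if S: "S \<in> \<T>" for S
  proof -
    obtain f where f: "f \<in> polys k" "\<forall>x\<in>S. v x = f x" using v[OF S] by (rule bexE)
    show ?thesis by (rule piecewise_nabla_norm(1)[OF f(1) _ element(2,3,4)[OF active_in_mesh[OF S]]]) (use f(2) in simp)
  qed
  have XU: "\<Union>\<T> \<in> sets lebesgue"
    using finite_mesh(2) element(4)[OF active_in_mesh] by (intro sets.finite_Union) auto
  have int: "set_integrable lebesgue ?X (grad_density m v)"
    by (rule set_integrable_subset[OF set_integrable_finite_Union[OF finite_mesh(2) pw element(4)[OF active_in_mesh]]])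
      (use XU in auto)
  have sub: "(nabla_norm m S v)\<^sup>2 \<le> (LINT x:?X|lebesgue. grad_density m v x)"
    if "S \<in> \<T>" "S \<subseteq> ball (centre T) (R * h)" for S
    unfolding nabla_norm_sq
    by (rule set_LINT_mono_set[OF _ element(4)[OF active_in_mesh[OF that(1)]] int grad_density_nonneg]) (use that in blast)
  have "(nabla_norm m T p)\<^sup>2 = (nabla_norm m T v)\<^sup>2"
    by (rule piecewise_nabla_norm(2)[OF p(1) _ element(2,3,4)[OF T0(1)]]) (use p(2) in simp)
  then have a: "(nabla_norm m T p)\<^sup>2 \<le> (LINT x:?X|lebesgue. grad_density m v x)" using sub[OF T(1) near(1)] by simp
  have "(nabla_norm m T' q)\<^sup>2 = (nabla_norm m T' v)\<^sup>2"
    by (rule piecewise_nabla_norm(2)[OF q(1) _ element(2,3,4)[OF T0(2)]]) (use q(2) in simp)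
  then have b: "(nabla_norm m T' q)\<^sup>2 \<le> (LINT x:?X|lebesgue. grad_density m v x)" using sub[OF T(2) near(2)] by simp
  have "(nabla_norm m T q)\<^sup>2 \<le> K * (nabla_norm m T' q)\<^sup>2"
    using inv[OF q(1) near(3) element(4)[OF T0(1)] centre_ball[OF T0(2)] element(3,4)[OF T0(2)]] by simp
  also have "\<dots> \<le> K * (LINT x:?X|lebesgue. grad_density m v x)" by (rule mult_left_mono[OF b K])
  finally have c: "(nabla_norm m T q)\<^sup>2 \<le> K * (LINT x:?X|lebesgue. grad_density m v x)" .
  show "(nabla_norm m T (jump k v T T'))\<^sup>2 \<le> 2 * (1 + K) * (LINT x:?X|lebesgue. grad_density m v x)"
    using nabla_norm_diff_le[OF p(1) q(1) element(3,4)[OF T0(1)], of m] a c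
    unfolding J by (simp add: algebra_simps)
qed

lemma stab_norm_le:
  assumes S: "stab_triples M k small Sh \<S>" "finite small" and A1: "assumption_A1 C1 m k h \<alpha> \<S>"
    and \<tau>: "0 < \<tau>" and F: "\<And>T. 0 \<le> F T"
    and J: "\<And>b T T'. (b, T, T') \<in> \<S> \<Longrightarrow> jump k v T T' \<in> polys k"
    and JF: "\<And>b T T'. (b, T, T') \<in> \<S> \<Longrightarrow> (nabla_norm m T (jump k v T T'))\<^sup>2 \<le> F T"
  shows "stab_norm k \<tau> h \<alpha> \<S> v \<le> sqrt \<tau> * sqrt (\<bar>C1\<bar> * real M * (\<Sum>T\<in>small. F T))"
proof -
  have "stab k \<tau> h \<alpha> \<S> v v \<le> real M * (\<Sum>T\<in>small. \<tau> * (\<bar>C1\<bar> * F T))"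
    unfolding stab_def
  proof (rule stab_triples_sum_le[OF S])
    show "0 \<le> \<tau> * (\<bar>C1\<bar> * F T)" for T using \<tau> F by simp
    fix b T T' assume bT: "(b, T, T') \<in> \<S>"
    let ?J = "jump k v T T'"
    have "psd_form k b" using S(1) bT unfolding stab_triples_def by fastforce
    then have "0 \<le> b ?J ?J" using J[OF bT] by (simp add: psd_form_def)
    then have "h powr \<alpha> * b ?J ?J = h powr \<alpha> * (form_norm b ?J)\<^sup>2" by (simp add: form_norm_def)
    also have "\<dots> \<le> C1 * (nabla_norm m T ?J)\<^sup>2"
      using A1 bT J[OF bT] unfolding assumption_A1_def by fastforce
    \<comment> \<open>The constant of A1 is an arbitrary real, so its absolute value is
      used.\<close>
    also have "\<dots> \<le> \<bar>C1\<bar> * F T" by (intro mult_mono JF[OF bT]) auto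
    finally have "\<tau> * (h powr \<alpha> * b ?J ?J) \<le> \<tau> * (\<bar>C1\<bar> * F T)" using \<tau> by (intro mult_left_mono) auto
    then show "\<tau> * h powr \<alpha> * b ?J ?J \<le> \<tau> * (\<bar>C1\<bar> * F T)" by (simp only: mult.assoc)
  qed
  also have "\<dots> = \<tau> * (\<bar>C1\<bar> * real M * (\<Sum>T\<in>small. F T))"
    by (simp add: sum_distrib_left mult_ac)
  finally have "sqrt (stab k \<tau> h \<alpha> \<S> v v) \<le> sqrt (\<tau> * (\<bar>C1\<bar> * real M * (\<Sum>T\<in>small. F T)))"
    by (rule real_sqrt_le_mono)
  then show ?thesis by (simp add: stab_norm_def real_sqrt_mult)
qed

text \<open>Formed with radius \<open>2 * R\<close>, so that it also covers the smaller radius: the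
  first estimate uses patches of radius \<open>R * h\<close>, the second the doubled balls of the
  Bramble-Hilbert estimate.\<close>

definition overlap_const :: real where
  "overlap_const = ((2 * R + \<sigma> / \<kappa>) / (\<sigma> / \<kappa>)) ^ DIM('a)"

lemma overlap_const:
  assumes "set_integrable lebesgue X f" "\<And>x. 0 \<le> f x" "X \<in> sets lebesgue" "I \<subseteq> \<T>0" "s \<in> {1, 2}"
  shows "(\<Sum>T\<in>I. LINT x:X \<inter> ball (centre T) (s * R * h)|lebesgue. f x) \<le> overlap_const * (LINT x:X|lebesgue. f x)"
proof -
  have s: "0 \<le> s * R" "s * R \<le> 2 * R" using assms(5) R_pos by auto
  have f0: "0 \<le> (LINT x:X|lebesgue. f x)"
    unfolding set_lebesgue_integral_def by (rule Bochner_Integration.integral_nonneg) (simp add: assms(2))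
  have "((s * R + \<sigma> / \<kappa>) / (\<sigma> / \<kappa>)) ^ DIM('a) \<le> overlap_const"
    unfolding overlap_const_def using pos s R_pos by (intro power_mono divide_right_mono) auto
  then show ?thesis
    using overlap_integral[OF s(1) assms(1-4)] mult_right_mono[OF _ f0] by (meson order_trans)
qed

lemma stab_norm_fe:
  assumes S: "stab_triples M k small Sh \<S>" "finite small" and small: "small \<subseteq> \<T>"
    and A1: "assumption_A1 C1 m k h \<alpha> \<S>" and \<tau>: "0 < \<tau>"
    and near: "\<And>b T T'. (b, T, T') \<in> \<S> \<Longrightarrow> near T T'" and v: "v \<in> active_space k \<T>0 \<T>"
  shows "stab_norm k \<tau> h \<alpha> \<S> v
    \<le> sqrt (\<bar>C1\<bar> * real M * (2 * (1 + K) * overlap_const)) * sqrt \<tau> * nabla_norm m (\<Union>\<T>) v"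
proof -
  note vp = active_space_poly[OF v]
  let ?F = "\<lambda>T. 2 * (1 + K) * (LINT x:\<Union>\<T> \<inter> ball (centre T) (R * h)|lebesgue. grad_density m v x)"
  have F0: "0 \<le> ?F T" for T
  proof -
    have "0 \<le> (LINT x:\<Union>\<T> \<inter> ball (centre T) (R * h)|lebesgue. grad_density m v x)"
      unfolding set_lebesgue_integral_def by (rule Bochner_Integration.integral_nonneg) (simp add: grad_density_nonneg)
    then show ?thesis using K by simp
  qed
  have pw: "set_integrable lebesgue T (grad_density m v)" if T: "T \<in> \<T>" for T
  proof -
    obtain f where f: "f \<in> polys k" "\<forall>x\<in>T. v x = f x" using vp[OF T] by (rule bexE)
    show ?thesis by (rule piecewise_nabla_norm(1)[OF f(1) _ element(2,3,4)[OF active_in_mesh[OF T]]]) (use f(2) in simp)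
  qed
  have XU: "\<Union>\<T> \<in> sets lebesgue"
    using finite_mesh(2) element(4)[OF active_in_mesh] by (intro sets.finite_Union) auto
  have int: "set_integrable lebesgue (\<Union>\<T>) (grad_density m v)"
    by (rule set_integrable_finite_Union[OF finite_mesh(2) pw element(4)[OF active_in_mesh]])
  have "(\<Sum>T\<in>small. ?F T) = 2 * (1 + K) * (\<Sum>T\<in>small. LINT x:\<Union>\<T> \<inter> ball (centre T) (1 * R * h)|lebesgue. grad_density m v x)"
    by (simp add: sum_distrib_left)
  also have "\<dots> \<le> 2 * (1 + K) * (overlap_const * (LINT x:\<Union>\<T>|lebesgue. grad_density m v x))"
    by (intro mult_left_mono overlap_const int grad_density_nonneg XU) (use small sub K in auto)
  finally have le: "(\<Sum>T\<in>small. ?F T) \<le> 2 * (1 + K) * overlap_const * (nabla_norm m (\<Union>\<T>) v)\<^sup>2"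
    by (simp add: nabla_norm_sq mult.assoc)
  have "stab_norm k \<tau> h \<alpha> \<S> v \<le> sqrt \<tau> * sqrt (\<bar>C1\<bar> * real M * (\<Sum>T\<in>small. ?F T))"
    by (rule stab_norm_le[OF S A1 \<tau> F0 jump_bound(1)[OF near vp] jump_bound(2)[OF near vp]])
  also have "\<dots> \<le> sqrt \<tau> * sqrt ((\<bar>C1\<bar> * real M * (2 * (1 + K) * overlap_const)) * (nabla_norm m (\<Union>\<T>) v)\<^sup>2)"
  proof (intro mult_left_mono real_sqrt_le_mono)
    have "\<bar>C1\<bar> * real M * (\<Sum>T\<in>small. ?F T)
        \<le> \<bar>C1\<bar> * real M * (2 * (1 + K) * overlap_const * (nabla_norm m (\<Union>\<T>) v)\<^sup>2)"
      by (rule mult_left_mono[OF le]) simp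
    then show "\<bar>C1\<bar> * real M * (\<Sum>T\<in>small. ?F T)
        \<le> (\<bar>C1\<bar> * real M * (2 * (1 + K) * overlap_const)) * (nabla_norm m (\<Union>\<T>) v)\<^sup>2" by (simp only: mult.assoc)
  qed (use \<tau> in simp)
  also have "\<dots> = sqrt (\<bar>C1\<bar> * real M * (2 * (1 + K) * overlap_const)) * sqrt \<tau> * nabla_norm m (\<Union>\<T>) v"
  proof -
    have "0 \<le> nabla_norm m (\<Union>\<T>) v" by (simp add: nabla_norm_def L2_norm_nonneg)
    then show ?thesis by (simp add: real_sqrt_mult mult_ac)
  qed
  finally show ?thesis .
qed

section \<open>Interpolation error and the second estimate\<close>

definition clement_const :: real where
  "clement_const = real ((k + 1) ^ Suc DIM('a)) * real k ^ k"

text \<open>The factor 4 comes from the difference of two polynomials, the outer \<open>K\<close>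
  from the inverse estimate, the following product from \<open>clement_element_error\<close>. The
  last line is the Bramble-Hilbert constant for radius \<open>R * h\<close> with its power of
  \<open>h\<close> split off.\<close>

definition patch_const :: real where
  "patch_const = 4 * (K * (unit_ball_vol (real DIM('a)) * \<kappa> ^ DIM('a) * (clement_const\<^sup>2 * K)))
    * (2 * (card (dirs (Suc k) :: 'a list set) * (2 * R) ^ (2 * Suc k) * 2 ^ DIM('a)))"

text \<open>At a node, the projection on the chosen element minus \<open>p\<close> is a polynomial;
  its point value is bounded by its norm there, and that norm by stability of the projection.
  Integration over \<open>S\<close> supplies the power of \<open>h\<close> that the point value
  costs.\<close>

lemma clement_element_error:
  assumes Tc: "clement_choice k \<T>0 \<T> Tc" and S: "S \<in> \<T>" and p: "p \<in> polys k"
    and B: "\<And>i. i \<in> element_nodes k S \<Longrightarrow> Tc i \<subseteq> B" "B \<in> sets lebesgue" "bounded B"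
    and w: "w \<in> L2 B"
    and q: "q \<in> polys k" "\<And>x. x \<in> S \<Longrightarrow> clement k \<T>0 \<T> Tc w x = q x"
  shows "(L2_norm S (\<lambda>x. q x - p x))\<^sup>2
    \<le> unit_ball_vol (real DIM('a)) * \<kappa> ^ DIM('a) * (clement_const\<^sup>2 * K) * (L2_norm B (\<lambda>x. w x - p x))\<^sup>2"
proof -
  define E where "E = (L2_norm B (\<lambda>x. w x - p x))\<^sup>2"
  \<comment> \<open>The bound for nodal values that results from solving the pointwise inverse
    estimate for the value at the node.\<close>
  define A where "A = sqrt (K * E / h ^ DIM('a))"
  have E0: "0 \<le> E" by (simp add: E_def)
  have hd: "0 < h ^ DIM('a)" using pos by simp
  have A2: "A\<^sup>2 = K * E / h ^ DIM('a)" unfolding A_def using K E0 hd by simp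
  have A0: "0 \<le> A" using K E0 hd by (simp add: A_def)
  have wp: "(\<lambda>x. w x - p x) \<in> L2 B"
    using w polys_sq_int[OF p B(3,2)] by (simp add: L2_eq_sq_int[OF B(2)] sq_int_diff)
  have node: "\<bar>L2_proj k (Tc i) w i - p i\<bar> \<le> A" if i: "i \<in> element_nodes k S" for i
  proof -
    have in_nodes: "i \<in> nodes k \<T>" using node_in[OF S i] by simp
    note C = clement_choice_node[OF Tc in_nodes]
    note C0 = active_in_mesh[OF C(1)]
    note el = element[OF C0]
    let ?r = "\<lambda>x. L2_proj k (Tc i) w x - p x"
    have wC: "w \<in> L2 (Tc i)" by (rule L2_subset[OF w B(1)[OF i] el(4)])
    have r: "?r \<in> polys k" by (intro polys_diff p L2_proj_properties(1)[OF el(3,4) interior_nonempty[OF C0] wC])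
    have in_ball: "x \<in> ball (centre (Tc i)) (R * h)" if "x \<in> Tc i" for x
    proof (rule near_ball)
      have "dist (centre (Tc i)) x \<le> 1 * (\<kappa> * h)" using element_dist[OF C0 centre_in[OF C0] that] by simp
      also have "\<dots> \<le> (real N + 2) * (\<kappa> * h)" using kappa_h_pos by (intro mult_right_mono) auto
      finally show "dist (centre (Tc i)) x \<le> (real N + 2) * (\<kappa> * h)" .
    qed
    then have sub: "Tc i \<subseteq> cball (centre (Tc i)) (R * h)" using ball_subset_cball by blast
    have "h ^ DIM('a) * (?r i)\<^sup>2 \<le> K * (L2_norm (Tc i) ?r)\<^sup>2"
      using inv[OF r sub el(4) centre_ball[OF C0] el(3,4)] sub C(2) by blast
    also have "\<dots> \<le> K * (L2_norm (Tc i) (\<lambda>x. w x - p x))\<^sup>2"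
      by (rule mult_left_mono[OF L2_proj_bounds(1)[OF el(3,4) interior_nonempty[OF C0] wC p] K])
    also have "\<dots> \<le> K * E"
      unfolding E_def L2_norm_sq_LINT
      by (rule mult_left_mono[OF set_LINT_mono_set[OF B(1)[OF i] el(4)] K]) (use wp in \<open>auto simp: L2_def\<close>)
    finally have "(?r i)\<^sup>2 \<le> A\<^sup>2" unfolding A2 using hd by (simp add: pos_le_divide_eq mult.commute)
    then show ?thesis using A0 by (simp add: abs_le_square_iff[symmetric])
  qed
  note S0 = active_in_mesh[OF S]
  have bound: "\<bar>q x - p x\<bar> \<le> clement_const * A" if x: "x \<in> S" for x
    using clement_error[OF S x p node] q(2)[OF x] by (simp add: clement_const_def mult_ac)
  have "(L2_norm S (\<lambda>x. q x - p x))\<^sup>2 \<le> unit_ball_vol (real DIM('a)) * (\<kappa> * h) ^ DIM('a) * (clement_const * A)\<^sup>2"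
    unfolding L2_norm_sq_LINT
  proof (rule set_LINT_le_bound)
    show "S \<subseteq> cball (centre S) (\<kappa> * h)" using element_dist[OF S0 centre_in[OF S0]] by auto
    show "S \<in> sets lebesgue" by (rule element(4)[OF S0])
    show "set_integrable lebesgue S (\<lambda>x. (q x - p x)\<^sup>2)"
      by (rule continuous_set_integrable[OF _ element(3,4)[OF S0]])
        (intro continuous_intros polys_continuous[OF p] polys_continuous[OF q(1)])
    show "(q x - p x)\<^sup>2 \<le> (clement_const * A)\<^sup>2" if "x \<in> S" for x
      using power_mono[OF bound[OF that], of 2] by simp
  qed (use kappa_h_pos in auto)
  also have "\<dots> = unit_ball_vol (real DIM('a)) * \<kappa> ^ DIM('a) * (clement_const\<^sup>2 * K) * E"
    unfolding power_mult_distrib A2 using pos by simp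
  finally show ?thesis unfolding E_def .
qed

lemma clement_jump_bound:
  assumes n: "near T T'" and Tc: "clement_choice k \<T>0 \<T> Tc" and w: "w \<in> sobolev (Suc k) UNIV"
  shows "(nabla_norm m T (jump k (clement k \<T>0 \<T> Tc w) T T'))\<^sup>2
    \<le> patch_const * (h ^ (k + 1 - m))\<^sup>2
      * (\<Sum>bs\<in>dirs (Suc k). (L2_norm (ball (centre T) (2 * R * h)) (weak_deriv UNIV bs w))\<^sup>2)"
proof -
  have T: "T \<in> \<T>" "T' \<in> \<T>" and d: "\<And>x y. x \<in> T \<Longrightarrow> y \<in> T' \<Longrightarrow> dist x y \<le> real N * (\<kappa> * h)"
    using n by (auto simp: near_def)
  note T0 = active_in_mesh[OF T(1)] active_in_mesh[OF T(2)]
  note near = near_subsets[OF n]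
  let ?B = "ball (centre T) (R * h)"
  let ?S = "\<Sum>bs\<in>dirs (Suc k). (L2_norm (ball (centre T) (2 * R * h)) (weak_deriv UNIV bs w))\<^sup>2"
  have Rh: "0 < R * h" using R_pos pos by simp
  have B: "?B \<in> sets lebesgue" "bounded ?B" "interior ?B \<noteq> {}" using Rh by auto
  have wU: "w \<in> L2 UNIV" using w by (simp add: sobolev_def)
  have wB: "w \<in> L2 ?B" by (rule L2_subset[OF wU subset_UNIV B(1)])
  define p where "p = L2_proj k ?B w"
  have p: "p \<in> polys k" unfolding p_def by (rule L2_proj_properties(1)[OF B(2,1,3) wB])
  define E where "E = (L2_norm ?B (\<lambda>x. w x - p x))\<^sup>2"
  define V where "V = unit_ball_vol (real DIM('a)) * \<kappa> ^ DIM('a) * (clement_const\<^sup>2 * K)"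
  \<comment> \<open>The chosen element contains its node, so it reaches at most one diameter further
    than the element \<open>U\<close> to which the node belongs.\<close>
  have patch: "Tc i \<subseteq> ?B" if i: "i \<in> element_nodes k U" and U: "U \<in> \<T>"
    and dU: "\<And>y. y \<in> U \<Longrightarrow> dist (centre T) y \<le> (real N + 1) * (\<kappa> * h)" for i U
  proof
    note nd = node_in[OF U i]
    note C = clement_choice_node[OF Tc conjunct1[OF nd]]
    fix x assume "x \<in> Tc i"
    then have "dist i x \<le> \<kappa> * h" by (rule element_dist[OF active_in_mesh[OF C(1)] C(2)])
    then show "x \<in> ?B"
      using dU[OF conjunct2[OF nd]] dist_triangle[of "centre T" x i]
      by (intro near_ball) (simp add: algebra_simps)
  qed
  have dT: "dist (centre T) y \<le> (real N + 1) * (\<kappa> * h)" if "y \<in> T" for y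
  proof -
    have "dist (centre T) y \<le> 1 * (\<kappa> * h)" using element_dist[OF T0(1) centre_in[OF T0(1)] that] by simp
    also have "\<dots> \<le> (real N + 1) * (\<kappa> * h)" using kappa_h_pos by (intro mult_right_mono) auto
    finally show ?thesis .
  qed
  have dT': "dist (centre T) y \<le> (real N + 1) * (\<kappa> * h)" if "y \<in> T'" for y
  proof -
    have "dist (centre T) y \<le> real N * (\<kappa> * h)" by (rule d[OF centre_in[OF T0(1)] that])
    also have "\<dots> \<le> (real N + 1) * (\<kappa> * h)" using kappa_h_pos by (intro mult_right_mono) auto
    finally show ?thesis .
  qed
  obtain q where q: "q \<in> polys k" "\<forall>x\<in>T. clement k \<T>0 \<T> Tc w x = q x"
    using clement_poly[OF T(1)] by (rule bexE)
  obtain q' where q': "q' \<in> polys k" "\<forall>x\<in>T'. clement k \<T>0 \<T> Tc w x = q' x"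
    using clement_poly[OF T(2)] by (rule bexE)
  have e1: "(L2_norm T (\<lambda>x. q x - p x))\<^sup>2 \<le> V * E"
    unfolding V_def E_def
    by (rule clement_element_error[OF Tc T(1) p patch[OF _ T(1) dT] B(1,2) wB q(1)]) (use q(2) in auto)
  have e2: "(L2_norm T' (\<lambda>x. q' x - p x))\<^sup>2 \<le> V * E"
    unfolding V_def E_def
    by (rule clement_element_error[OF Tc T(2) p patch[OF _ T(2) dT'] B(1,2) wB q'(1)]) (use q'(2) in auto)
  have "poly_ext k T (clement k \<T>0 \<T> Tc w) = q" by (rule poly_ext_eq[OF q(1) _ interior_nonempty[OF T0(1)]]) (use q(2) in simp)
  moreover have "poly_ext k T' (clement k \<T>0 \<T> Tc w) = q'" by (rule poly_ext_eq[OF q'(1) _ interior_nonempty[OF T0(2)]]) (use q'(2) in simp)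
  \<comment> \<open>Adding and subtracting the same \<open>p\<close> leaves the jump unchanged, and
    both parts are interpolation errors of \<open>w\<close> against \<open>p\<close>.\<close>
  ultimately have J: "jump k (clement k \<T>0 \<T> Tc w) T T' = (\<lambda>x. (q x - p x) - (q' x - p x))"
    by (simp add: jump_def)
  note qp = polys_diff[OF q(1) p] and qp' = polys_diff[OF q'(1) p]
  have TB: "T \<subseteq> cball (centre T) (R * h)" using near(1) ball_subset_cball by blast
  have n1: "h ^ (2 * m) * (nabla_norm m T (\<lambda>x. q x - p x))\<^sup>2 \<le> K * (V * E)"
    using inv[OF qp TB element(4)[OF T0(1)] centre_ball[OF T0(1)] element(3,4)[OF T0(1)]] mult_left_mono[OF e1 K] by linarith
  have n2: "h ^ (2 * m) * (nabla_norm m T (\<lambda>x. q' x - p x))\<^sup>2 \<le> K * (V * E)"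
    using inv[OF qp' near(3) element(4)[OF T0(1)] centre_ball[OF T0(2)] element(3,4)[OF T0(2)]] mult_left_mono[OF e2 K] by linarith
  have "h ^ (2 * m) * (nabla_norm m T (\<lambda>x. (q x - p x) - (q' x - p x)))\<^sup>2
      \<le> h ^ (2 * m) * (2 * (nabla_norm m T (\<lambda>x. q x - p x))\<^sup>2 + 2 * (nabla_norm m T (\<lambda>x. q' x - p x))\<^sup>2)"
    using pos by (intro mult_left_mono nabla_norm_diff_le[OF qp qp' element(3,4)[OF T0(1)]]) auto
  also have "\<dots> \<le> 4 * (K * V) * E" using n1 n2 by (simp add: algebra_simps)
  also have "\<dots> \<le> 4 * (K * V) * (2 * (card (dirs (Suc k) :: 'a list set) * (2 * (R * h)) ^ (2 * Suc k) * 2 ^ DIM('a)) * ?S)"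
  proof (rule mult_left_mono)
    show "E \<le> 2 * (card (dirs (Suc k) :: 'a list set) * (2 * (R * h)) ^ (2 * Suc k) * 2 ^ DIM('a)) * ?S"
      using bramble_hilbert[OF w Rh, of "centre T"] unfolding E_def p_def by (simp only: mult.assoc)
    show "0 \<le> 4 * (K * V)" using K pos by (simp add: V_def)
  qed
  also have "\<dots> = patch_const * h ^ (2 * Suc k) * ?S"
    unfolding patch_const_def V_def power_mult_distrib by (simp only: mult_ac)
  \<comment> \<open>The factor \<open>h ^ (2 * m)\<close> is the loss of the inverse estimate and
    cancels below. As \<open>m\<close> is at most 1, the subtraction in the exponent is
    exact.\<close>
  also have "h ^ (2 * Suc k) = h ^ (2 * m) * (h ^ (k + 1 - m))\<^sup>2"
  proof -
    have "2 * Suc k = 2 * m + (k + 1 - m) * 2" using m by auto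
    then show ?thesis by (simp only: power_add power_mult)
  qed
  also have "patch_const * (h ^ (2 * m) * (h ^ (k + 1 - m))\<^sup>2) * ?S = h ^ (2 * m) * (patch_const * (h ^ (k + 1 - m))\<^sup>2 * ?S)"
    by (simp only: mult_ac)
  finally have fin: "h ^ (2 * m) * (nabla_norm m T (\<lambda>x. (q x - p x) - (q' x - p x)))\<^sup>2
      \<le> h ^ (2 * m) * (patch_const * (h ^ (k + 1 - m))\<^sup>2 * ?S)" .
  have "0 < h ^ (2 * m)" using pos by simp
  from mult_left_le_imp_le[OF fin this] show ?thesis unfolding J .
qed

lemma patch_const_nonneg: "0 \<le> patch_const"
  unfolding patch_const_def using K pos R_pos by (intro mult_nonneg_nonneg) auto

lemma stab_norm_clement:
  assumes S: "stab_triples M k small Sh \<S>" "finite small" and small: "small \<subseteq> \<T>"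
    and A1: "assumption_A1 C1 m k h \<alpha> \<S>" and \<tau>: "0 < \<tau>"
    and near: "\<And>b T T'. (b, T, T') \<in> \<S> \<Longrightarrow> near T T'"
    and Tc: "clement_choice k \<T>0 \<T> Tc" and w: "w \<in> sobolev (Suc k) UNIV"
  shows "stab_norm k \<tau> h \<alpha> \<S> (clement k \<T>0 \<T> Tc w)
    \<le> sqrt (\<bar>C1\<bar> * real M * (patch_const * overlap_const)) * sqrt \<tau> * h ^ (k + 1 - m) * sobolev_norm (Suc k) UNIV w"
proof -
  let ?D = "\<lambda>bs. weak_deriv UNIV bs w"
  let ?I = "dirs (Suc k) :: 'a list set"
  let ?H = "(h ^ (k + 1 - m))\<^sup>2"
  let ?F = "\<lambda>T. patch_const * ?H * (\<Sum>bs\<in>?I. (L2_norm (ball (centre T) (2 * R * h)) (?D bs))\<^sup>2)"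
  have F0: "0 \<le> ?F T" for T
    by (intro mult_nonneg_nonneg patch_const_nonneg sum_nonneg) auto
  have Dsub: "?I \<subseteq> derivs (Suc k)" by (auto simp: dirs_def derivs_def)
  have DL: "?D bs \<in> L2 UNIV" if "bs \<in> ?I" for bs
    using sobolev_weak_deriv[OF w, of bs] that Dsub by (auto simp: is_weak_deriv_def)
  \<comment> \<open>The sums are exchanged so that the overlap bound can be applied to each weak
    derivative separately on the whole space.\<close>
  have "(\<Sum>T\<in>small. ?F T) = patch_const * ?H * (\<Sum>bs\<in>?I. \<Sum>T\<in>small. (L2_norm (ball (centre T) (2 * R * h)) (?D bs))\<^sup>2)"
    unfolding sum_distrib_left[symmetric] by (subst sum.swap) simp
  also have "\<dots> \<le> patch_const * ?H * (\<Sum>bs\<in>?I. overlap_const * (L2_norm UNIV (?D bs))\<^sup>2)"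
  proof (intro mult_left_mono sum_mono)
    fix bs assume bs: "bs \<in> ?I"
    have "set_integrable lebesgue UNIV (\<lambda>x. (?D bs x)\<^sup>2)" using DL[OF bs] by (simp add: L2_def)
    from overlap_const[OF this, of small 2]
    show "(\<Sum>T\<in>small. (L2_norm (ball (centre T) (2 * R * h)) (?D bs))\<^sup>2) \<le> overlap_const * (L2_norm UNIV (?D bs))\<^sup>2"
      using small sub by (auto simp: L2_norm_sq_LINT)
  next
    show "0 \<le> patch_const * ?H" by (intro mult_nonneg_nonneg patch_const_nonneg) simp
  qed
  also have "\<dots> = patch_const * overlap_const * ?H * (\<Sum>bs\<in>?I. (L2_norm UNIV (?D bs))\<^sup>2)"
    by (simp add: sum_distrib_left[symmetric] mult_ac)
  also have "\<dots> \<le> patch_const * overlap_const * ?H * (sobolev_norm (Suc k) UNIV w)\<^sup>2"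
  proof (rule mult_left_mono)
    have "finite (derivs (Suc k) :: 'a list set)"
      unfolding derivs_def by (rule finite_lists_length_le) simp
    then have "(\<Sum>bs\<in>?I. (L2_norm UNIV (?D bs))\<^sup>2) \<le> (\<Sum>bs\<in>derivs (Suc k). (L2_norm UNIV (?D bs))\<^sup>2)"
      using Dsub by (intro sum_mono2) auto
    also have "\<dots> = (sobolev_norm (Suc k) UNIV w)\<^sup>2"
      unfolding sobolev_norm_def by (simp add: sum_nonneg)
    finally show "(\<Sum>bs\<in>?I. (L2_norm UNIV (?D bs))\<^sup>2) \<le> (sobolev_norm (Suc k) UNIV w)\<^sup>2" .
    have "0 \<le> overlap_const" unfolding overlap_const_def using pos R_pos by (intro zero_le_power) auto
    then show "0 \<le> patch_const * overlap_const * ?H" by (intro mult_nonneg_nonneg patch_const_nonneg) auto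
  qed
  finally have le: "(\<Sum>T\<in>small. ?F T) \<le> patch_const * overlap_const * ?H * (sobolev_norm (Suc k) UNIV w)\<^sup>2" .
  have "stab_norm k \<tau> h \<alpha> \<S> (clement k \<T>0 \<T> Tc w) \<le> sqrt \<tau> * sqrt (\<bar>C1\<bar> * real M * (\<Sum>T\<in>small. ?F T))"
    by (rule stab_norm_le[OF S A1 \<tau> F0 jump_bound(1)[OF near clement_poly] clement_jump_bound[OF near Tc w]])
  also have "\<dots> \<le> sqrt \<tau> * sqrt ((\<bar>C1\<bar> * real M * (patch_const * overlap_const)) * (?H * (sobolev_norm (Suc k) UNIV w)\<^sup>2))"
  proof (intro mult_left_mono real_sqrt_le_mono)
    have "\<bar>C1\<bar> * real M * (\<Sum>T\<in>small. ?F T)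
        \<le> \<bar>C1\<bar> * real M * (patch_const * overlap_const * ?H * (sobolev_norm (Suc k) UNIV w)\<^sup>2)"
      by (rule mult_left_mono[OF le]) simp
    then show "\<bar>C1\<bar> * real M * (\<Sum>T\<in>small. ?F T)
        \<le> (\<bar>C1\<bar> * real M * (patch_const * overlap_const)) * (?H * (sobolev_norm (Suc k) UNIV w)\<^sup>2)"
      by (simp only: mult.assoc)
  qed (use \<tau> in simp)
  also have "\<dots> = sqrt (\<bar>C1\<bar> * real M * (patch_const * overlap_const)) * sqrt \<tau> * h ^ (k + 1 - m) * sobolev_norm (Suc k) UNIV w"
  proof -
    have "0 \<le> sobolev_norm (Suc k) UNIV w" by (simp add: sobolev_norm_def sum_nonneg)
    moreover have "0 \<le> h ^ (k + 1 - m)" using pos by simp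
    ultimately show ?thesis unfolding real_sqrt_mult real_sqrt_abs by (simp add: mult_ac)
  qed
  finally show ?thesis .
qed

end

theorem lemma3p3:
  fixes k m M N :: nat and \<alpha> \<gamma> \<sigma> \<kappa> C1 h0 :: real and CE :: "nat \<Rightarrow> real"
  assumes "k \<ge> 1" and "m \<in> {0, 1}" and "0 < \<gamma>" and "\<gamma> \<le> 1"
    and "0 < \<sigma>" and "0 < \<kappa>" and "0 < h0"
  shows "\<exists>C. \<forall>h \<tau> (\<Omega>0 :: 'a::euclidean_space set) \<T>0 \<Omega> \<T> Sh \<S> E Tc.
      0 < h \<longrightarrow> h \<le> h0 \<longrightarrow> 0 < \<tau> \<longrightarrow>
      quasiuniform_mesh \<sigma> \<kappa> h \<Omega>0 \<T>0 \<longrightarrow>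
      closed_domain \<Omega> \<longrightarrow> \<Omega> \<subseteq> \<Omega>0 \<longrightarrow> \<T> = active_mesh \<T>0 \<Omega> \<longrightarrow>
      (\<forall>T\<in>small_elements \<gamma> \<T> \<Omega>. Sh T \<in> large_elements \<gamma> \<T> \<Omega>) \<longrightarrow>
      stab_triples M k (small_elements \<gamma> \<T> \<Omega>) Sh \<S> \<longrightarrow>
      assumption_A1 C1 m k h \<alpha> \<S> \<longrightarrow>
      assumption_A2 N \<T> \<S> \<longrightarrow>
      extension_operator CE \<Omega> E \<longrightarrow>
      clement_choice k \<T>0 \<T> Tc \<longrightarrow>
        (\<forall>v\<in>active_space k \<T>0 \<T>.
           stab_norm k \<tau> h \<alpha> \<S> v \<le> C * sqrt \<tau> * nabla_norm m (\<Union>\<T>) v) \<and>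
        (\<forall>v\<in>sobolev (k + 1) (interior \<Omega>).
           stab_norm k \<tau> h \<alpha> \<S> (clement k \<T>0 \<T> Tc (E v))
             \<le> C * sqrt \<tau> * h ^ (k + 1 - m) * sobolev_norm (k + 1) (interior \<Omega>) v)"
proof -
  define R where "R = (real N + 3) * \<kappa>"
  have "0 < real N + 3" by simp
  then have R: "0 < R" using \<open>0 < \<kappa>\<close> unfolding R_def by (rule mult_pos_pos)
  have r: "0 < \<sigma> / \<kappa>" using \<open>0 < \<sigma>\<close> \<open>0 < \<kappa>\<close> by simp
  obtain K where Kest: "K \<ge> 0 \<and> (\<forall>p\<in>polys k. \<forall>(z::'a::euclidean_space) h T T'. 0 < h \<longrightarrow>
      T \<subseteq> cball z (R * h) \<longrightarrow> T \<in> sets lebesgue \<longrightarrow> ball z (\<sigma> / \<kappa> * h) \<subseteq> T' \<longrightarrow> bounded T' \<longrightarrow> T' \<in> sets lebesgue \<longrightarrow>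
      (\<forall>x\<in>cball z (R * h). h ^ DIM('a) * (p x)\<^sup>2 \<le> K * (L2_norm T' p)\<^sup>2) \<and>
      h ^ (2 * m) * (nabla_norm m T p)\<^sup>2 \<le> K * (L2_norm T' p)\<^sup>2 \<and>
      (nabla_norm m T p)\<^sup>2 \<le> K * (nabla_norm m T' p)\<^sup>2)"
    using polys_inverse_estimates[OF r less_imp_le[OF R] \<open>m \<in> {0, 1}\<close>, of k] by (rule exE)
  \<comment> \<open>\<open>OC\<close>, \<open>CC\<close> and \<open>PC\<close> spell out the
    constants of the locale, which can be interpreted only after \<open>h\<close> and the mesh have
    been fixed.\<close>
  define OC where "OC = ((2 * R + \<sigma> / \<kappa>) / (\<sigma> / \<kappa>)) ^ DIM('a)"
  define CC where "CC = real ((k + 1) ^ Suc DIM('a)) * real k ^ k"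
  define PC where "PC = 4 * (K * (unit_ball_vol (real DIM('a)) * \<kappa> ^ DIM('a) * (CC\<^sup>2 * K)))
    * (2 * (card (dirs (Suc k) :: 'a list set) * (2 * R) ^ (2 * Suc k) * 2 ^ DIM('a)))"
  define c1 where "c1 = sqrt (\<bar>C1\<bar> * real M * (2 * (1 + K) * OC))"
  define c2 where "c2 = sqrt (\<bar>C1\<bar> * real M * (PC * OC))"
  have OC0: "0 \<le> OC" unfolding OC_def using R assms by (intro zero_le_power divide_nonneg_nonneg) auto
  have PC0: "0 \<le> PC" unfolding PC_def using Kest R \<open>0 < \<kappa>\<close> by (intro mult_nonneg_nonneg) auto
  have c: "0 \<le> c1" "0 \<le> c2" unfolding c1_def c2_def using OC0 PC0 Kest by auto
  have main: "(\<forall>v\<in>active_space k \<T>0 \<T>.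
           stab_norm k \<tau> h \<alpha> \<S> v \<le> (c1 + c2 * \<bar>CE (k + 1)\<bar>) * sqrt \<tau> * nabla_norm m (\<Union>\<T>) v) \<and>
        (\<forall>v\<in>sobolev (k + 1) (interior \<Omega>).
           stab_norm k \<tau> h \<alpha> \<S> (clement k \<T>0 \<T> Tc (E v))
             \<le> (c1 + c2 * \<bar>CE (k + 1)\<bar>) * sqrt \<tau> * h ^ (k + 1 - m) * sobolev_norm (k + 1) (interior \<Omega>) v)"
    if h: "0 < h" and \<tau>: "0 < \<tau>" and qm: "quasiuniform_mesh \<sigma> \<kappa> h \<Omega>0 \<T>0"
      and \<Omega>: "closed_domain \<Omega>" and \<T>: "\<T> = active_mesh \<T>0 \<Omega>"
      and S: "stab_triples M k (small_elements \<gamma> \<T> \<Omega>) Sh \<S>" and A1: "assumption_A1 C1 m k h \<alpha> \<S>"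
      and A2: "assumption_A2 N \<T> \<S>" and E: "extension_operator CE \<Omega> E" and Tc: "clement_choice k \<T>0 \<T> Tc"
    for h \<tau> and \<Omega>0 \<Omega> :: "'a set" and \<T>0 \<T> Sh \<S> E Tc
  proof -
    interpret stabilized_mesh k \<sigma> \<kappa> h \<Omega>0 \<T>0 \<T> N m R K
    proof
      show "quasiuniform_mesh \<sigma> \<kappa> h \<Omega>0 \<T>0" by (rule qm)
      show "\<T> \<subseteq> \<T>0" unfolding \<T> active_mesh_def by blast
      show "R = (real N + 3) * \<kappa>" by (rule R_def)
      show "0 \<le> K" using Kest by simp
      fix p :: "'a \<Rightarrow> real" and z and T T' :: "'a set"
      assume "p \<in> polys k" "T \<subseteq> cball (z::'a) (R * h)" "T \<in> sets lebesgue" "ball z (\<sigma> / \<kappa> * h) \<subseteq> T'"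
        "bounded T'" "T' \<in> sets lebesgue"
      then show "(\<forall>x\<in>cball z (R * h). h ^ DIM('a) * (p x)\<^sup>2 \<le> K * (L2_norm T' p)\<^sup>2) \<and>
          h ^ (2 * m) * (nabla_norm m T p)\<^sup>2 \<le> K * (L2_norm T' p)\<^sup>2 \<and>
          (nabla_norm m T p)\<^sup>2 \<le> K * (nabla_norm m T' p)\<^sup>2"
        using conjunct2[OF Kest] h by simp
    qed (use assms h in auto)
    have small: "small_elements \<gamma> \<T> \<Omega> \<subseteq> \<T>" by (auto simp: small_elements_def)
    have fin: "finite (small_elements \<gamma> \<T> \<Omega>)" using small finite_mesh(2) finite_subset by blast
    have near: "near T T'" if bT: "(b, T, T') \<in> \<S>" for b T T'
    proof -
      have "\<exists>P. P \<noteq> [] \<and> set P \<subseteq> \<T> \<and> hd P = T \<and> last P = T' \<and> length P \<le> N \<and> successively face_neighbors P"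
        using A2 bT unfolding assumption_A2_def by fastforce
      then obtain P where P: "P \<noteq> []" "set P \<subseteq> \<T>" "hd P = T" "last P = T'" "length P \<le> N"
          "successively face_neighbors P" by (elim exE conjE)
      have "T \<in> \<T>" "T' \<in> \<T>" using P(1-4) hd_in_set last_in_set by blast+
      then show ?thesis
        unfolding near_def using face_path_dist[OF P(1,2,6,5)] P(3,4) by simp
    qed
    have c1: "c1 = sqrt (\<bar>C1\<bar> * real M * (2 * (1 + K) * overlap_const))"
      unfolding c1_def OC_def overlap_const_def ..
    have c2: "c2 = sqrt (\<bar>C1\<bar> * real M * (patch_const * overlap_const))"
      unfolding c2_def OC_def PC_def CC_def overlap_const_def patch_const_def clement_const_def ..
    show ?thesis
    proof (intro conjI ballI)
      fix v assume v: "v \<in> active_space k \<T>0 \<T>"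
      have nn: "0 \<le> nabla_norm m (\<Union>\<T>) v" by (simp add: nabla_norm_def L2_norm_nonneg)
      have "stab_norm k \<tau> h \<alpha> \<S> v \<le> c1 * sqrt \<tau> * nabla_norm m (\<Union>\<T>) v"
        unfolding c1 by (rule stab_norm_fe[OF S fin small A1 \<tau> near v])
      also have "\<dots> \<le> (c1 + c2 * \<bar>CE (k + 1)\<bar>) * sqrt \<tau> * nabla_norm m (\<Union>\<T>) v"
        using c \<tau> nn by (intro mult_right_mono) auto
      finally show "stab_norm k \<tau> h \<alpha> \<S> v \<le> (c1 + c2 * \<bar>CE (k + 1)\<bar>) * sqrt \<tau> * nabla_norm m (\<Union>\<T>) v" .
    next
      fix v assume v: "v \<in> sobolev (k + 1) (interior \<Omega>)"
      let ?n = "sobolev_norm (k + 1) (interior \<Omega>) v"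
      have n0: "0 \<le> ?n" by (simp add: sobolev_norm_def sum_nonneg)
      \<comment> \<open>Here the extension is used: the interpolated function is a Sobolev function
        on the whole space, so the balls around elements may leave \<open>\<Omega>\<close>.\<close>
      have Ev: "E v \<in> sobolev (Suc k) UNIV" "sobolev_norm (Suc k) UNIV (E v) \<le> CE (k + 1) * ?n"
        using E v unfolding extension_operator_def by auto
      have "sobolev_norm (Suc k) UNIV (E v) \<le> \<bar>CE (k + 1)\<bar> * ?n"
        using Ev(2) mult_right_mono[OF abs_ge_self n0, of "CE (k + 1)"] by linarith
      then have "c2 * sqrt \<tau> * h ^ (k + 1 - m) * sobolev_norm (Suc k) UNIV (E v)
          \<le> c2 * sqrt \<tau> * h ^ (k + 1 - m) * (\<bar>CE (k + 1)\<bar> * ?n)"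
        using c \<tau> h by (intro mult_left_mono) auto
      moreover have "stab_norm k \<tau> h \<alpha> \<S> (clement k \<T>0 \<T> Tc (E v))
          \<le> c2 * sqrt \<tau> * h ^ (k + 1 - m) * sobolev_norm (Suc k) UNIV (E v)"
        unfolding c2 by (rule stab_norm_clement[OF S fin small A1 \<tau> near Tc Ev(1)])
      moreover have "(c2 * \<bar>CE (k + 1)\<bar>) * (sqrt \<tau> * h ^ (k + 1 - m) * ?n)
          \<le> (c1 + c2 * \<bar>CE (k + 1)\<bar>) * (sqrt \<tau> * h ^ (k + 1 - m) * ?n)"
        using c \<tau> h n0 by (intro mult_right_mono) auto
      ultimately show "stab_norm k \<tau> h \<alpha> \<S> (clement k \<T>0 \<T> Tc (E v))
             \<le> (c1 + c2 * \<bar>CE (k + 1)\<bar>) * sqrt \<tau> * h ^ (k + 1 - m) * ?n"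
        by (simp add: mult_ac)
    qed
  qed
  \<comment> \<open>One constant serves both estimates: \<open>c1\<close> and \<open>c2\<close> are
    nonnegative, so the sum dominates each of the two constants.\<close>
  show ?thesis
    by (rule exI[of _ "c1 + c2 * \<bar>CE (k + 1)\<bar>"], intro allI impI, rule main; assumption)
qed

end
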